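(* Consider the number of internal incidences $\mathscr I_t$ of the typical maximal edge of an isotropic spherical splitting tessellation $Y_t$ on $\mathbb S^2$ with time parameter $t>0$. Then, for any $n\in\{0,1,2,\dots\}$, $$\lim_{t\to\infty}\mathbb P(\mathscr I_t=n)=2^{n+1}\int_0^1u^2\frac{(1-u)^n}{(2-u)^{n+1}}\,\mathrm du.$$
   Context: $\mathbb S^2\subset\mathbb R^3$ is the unit sphere; $\mathbb S_1$ is the space of great circles; for $S\in\mathbb S_1$, $S^\pm$ are the two closed hemispheres bounded by $S$; $\mathbb S_1[A]$ is the set of great circles hitting $A\subset\mathbb S^2$; $\kappa$ is the rotation invariant probability measure on $\mathbb S_1$ (isotropic case). Splitting process: $Y_0=\{\mathbb S^2\}$; each cell $c$ has an exponential lifetime with parameter $\kappa(\mathbb S_1[c])$; when it expires a great circle $S$ is drawn from $\kappa(\cdot\cap\mathbb S_1[c])/\kappa(\mathbb S_1[c])$ and $c$ is replaced by $c\cap S^+$ and $c\cap S^-$; all lifetimes and great circles are (conditionally) independent. $Y_t$ is the tessellation at time $t$. $M_t$ is the random finite collection of pairs $(e,s)$, where $e=c\cap S$ is the spherical segment (maximal edge) created when a cell $c$ is split by $S$, and $s\le t$ is the time of this split (birth time of $e$). The first maximal edge is a full great circle, whose relative interior is the whole circle. For $(e,s)\in M_t$ put $\mathscr I(e,s,M_t)=|\{(f,u)\in M_t:u>s,\ f\cap\operatorname{relint}e\ne\varnothing\}|$. The number $\mathscr I_t$ of internal incidences of the typical maximal edge is the random variable with distribution $\mathbb P(\mathscr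 I_t=n)=\frac1{N_1(t)}\mathbb E\sum_{(e,s)\in M_t}\mathbf 1\{\mathscr I(e,s,M_t)=n\}$, where $N_1(t)=\mathbb E|M_t|=t^2+1-e^{-t}$. *)

theory Defs
  imports "HOL-Probability.Probability"
begin

abbreviation sphere2 :: "(real^3) set"
  where "sphere2 \<equiv> sphere 0 1"

definition great_circle :: "real^3 \<Rightarrow> (real^3) set"
  where "great_circle x = {y \<in> sphere2. x \<bullet> y = 0}"

definition great_circles :: "(real^3) set set"
  where "great_circles = great_circle ` sphere2"

definition hitting :: "(real^3) set \<Rightarrow> (real^3) set set"
  where "hitting A = {S \<in> great_circles. S \<inter> A \<noteq> {}}"

text \<open>
  The map sending a unit normal to its great circle identifies the space of great circles with
  the quotient of the sphere by the antipodal map.  Its Borel sets are those whose preimage is a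
  Borel set of the sphere; the family below is already closed under the \<sigma>-algebra operations.
\<close>

definition great_circle_space :: "(real^3) set measure"
  where "great_circle_space =
    sigma great_circles
      {A. A \<subseteq> great_circles \<and> {x \<in> sphere2. great_circle x \<in> A} \<in> sets borel}"

locale isotropic_measure = prob_space \<kappa> for \<kappa> :: "(real^3) set measure" +
  assumes sets_kappa: "sets \<kappa> = sets great_circle_space"
    and rotation_invariant:
      "\<And>Q :: real^3^3. rotation_matrix Q \<Longrightarrow> distr \<kappa> great_circle_space (image ((*v) Q)) = \<kappa>"

definition hemisphere :: "bool \<Rightarrow> real^3 \<Rightarrow> (real^3) set"
  where "hemisphere b x = {y \<in> sphere2. if b then 0 \<le> x \<bullet> y else x \<bullet> y \<le> 0}"

text \<open>
  The cells that ever occur are indexed by the nodes of the infinite binary tree.  A node is a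
  list of booleans read from right to left: \<open>[]\<close> is the initial cell, and \<open>b # w\<close> is the
  intersection of the cell \<open>w\<close> with one of the hemispheres of the great circle that splits it.
  The family \<open>N\<close> gives unit normals of the splitting great circles (the choice between the two
  normals only decides which half is called \<open>True # w\<close>), and \<open>\<tau>\<close> gives the lifetimes.
\<close>

primrec cell :: "(bool list \<Rightarrow> real^3) \<Rightarrow> bool list \<Rightarrow> (real^3) set"
  where
    "cell N [] = sphere2"
  | "cell N (b # w) = cell N w \<inter> hemisphere b (N w)"

primrec birth_time :: "(bool list \<Rightarrow> real) \<Rightarrow> bool list \<Rightarrow> real"
  where
    "birth_time \<tau> [] = 0"
  | "birth_time \<tau> (b # w) = birth_time \<tau> w + \<tau> w"

definition split_time :: "(bool list \<Rightarrow> real) \<Rightarrow> bool list \<Rightarrow> real"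
  where "split_time \<tau> w = birth_time \<tau> w + \<tau> w"

definition tessellation ::
    "(bool list \<Rightarrow> real) \<Rightarrow> (bool list \<Rightarrow> real^3) \<Rightarrow> real \<Rightarrow> (real^3) set set"
  where "tessellation \<tau> N t = {cell N w | w. birth_time \<tau> w \<le> t \<and> t < split_time \<tau> w}"

definition maximal_edges ::
    "(bool list \<Rightarrow> real) \<Rightarrow> (bool list \<Rightarrow> real^3) \<Rightarrow> real \<Rightarrow> ((real^3) set \<times> real) set"
  where "maximal_edges \<tau> N t =
    {(cell N w \<inter> great_circle (N w), split_time \<tau> w) | w. split_time \<tau> w \<le> t}"

text \<open>The information carried by the lifetimes and great circles of all generations before \<open>k\<close>.\<close>

definition history ::
    "'a measure \<Rightarrow> (bool list \<Rightarrow> 'a \<Rightarrow> real) \<Rightarrow> (bool list \<Rightarrow> 'a \<Rightarrow> real^3) \<Rightarrow> nat \<Rightarrow> 'a measure"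
  where "history \<Omega> \<tau> N k =
    vimage_algebra (space \<Omega>) (\<lambda>\<omega>. \<lambda>v\<in>{v. length v < k}. (\<tau> v \<omega>, N v \<omega>))
      (\<Pi>\<^sub>M v\<in>{v. length v < k}. borel)"

text \<open>
  Given the earlier generations, which determine the cells of generation \<open>k\<close>, the lifetimes and
  the splitting great circles of these cells are all independent, the lifetime of a cell \<open>c\<close>
  being exponential with parameter \<open>\<kappa> (hitting c)\<close> and its great circle having law
  \<open>\<kappa> (\<cdot> \<inter> hitting c) / \<kappa> (hitting c)\<close>.
\<close>

locale splitting_process =
  isotropic_measure \<kappa> + \<Omega>: prob_space \<Omega>
  for \<kappa> :: "(real^3) set measure"
    and \<Omega> :: "'a measure"
    and \<tau> :: "bool list \<Rightarrow> 'a \<Rightarrow> real"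
    and N :: "bool list \<Rightarrow> 'a \<Rightarrow> real^3" +
  assumes lifetime_measurable: "\<And>w. \<tau> w \<in> borel_measurable \<Omega>"
    and normal_measurable: "\<And>w. N w \<in> borel_measurable \<Omega>"
    and normal_in_sphere: "\<And>w \<omega>. \<omega> \<in> space \<Omega> \<Longrightarrow> N w \<omega> \<in> sphere2"
    and conditional_law:
      "\<And>k (B :: bool list \<Rightarrow> real set) (D :: bool list \<Rightarrow> (real^3) set set).
        (\<And>w. length w = k \<Longrightarrow> B w \<in> sets borel \<and> D w \<in> sets great_circle_space) \<Longrightarrow>
        AE \<omega> in \<Omega>.
          real_cond_exp \<Omega> (history \<Omega> \<tau> N k)
            (indicator {\<omega> \<in> space \<Omega>. \<forall>w. length w = k \<longrightarrow>
               \<tau> w \<omega> \<in> B w \<and> great_circle (N w \<omega>) \<in> D w}) \<omega> =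
          (\<Prod>w | length w = k.
             let H = hitting (cell (\<lambda>v. N v \<omega>) w)
             in measure (density lborel (exponential_density (measure \<kappa> H))) (B w)
                * (measure \<kappa> (D w \<inter> H) / measure \<kappa> H))"

text \<open>
  Relative interior of a spherical segment: the interior relative to the great circle (in general,
  great subsphere) that it spans.  The library's \<open>rel_interior\<close> refers to the affine hull in
  space and would be empty for circular arcs.
\<close>

definition relint :: "(real^3) set \<Rightarrow> (real^3) set"
  where "relint e = (top_of_set (sphere2 \<inter> span e)) interior_of e"

definition internal_incidences ::
    "(real^3) set \<Rightarrow> real \<Rightarrow> ((real^3) set \<times> real) set \<Rightarrow> nat"
  where "internal_incidences e s M = card {(f, u) \<in> M. u > s \<and> f \<inter> relint e \<noteq> {}}"

text \<open>
  Expectations of nonnegative quantities are \<open>nn_integral\<close>s, whose value does not depend on what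
  happens on null sets (where, e.g., there might be infinitely many splits).
\<close>

definition mean_edge_number ::
    "'a measure \<Rightarrow> (bool list \<Rightarrow> 'a \<Rightarrow> real) \<Rightarrow> (bool list \<Rightarrow> 'a \<Rightarrow> real^3) \<Rightarrow> real \<Rightarrow> real"
  where "mean_edge_number \<Omega> \<tau> N t =
    enn2real (\<integral>\<^sup>+ \<omega>. of_nat (card (maximal_edges (\<lambda>w. \<tau> w \<omega>) (\<lambda>w. N w \<omega>) t)) \<partial>\<Omega>)"

definition typical_incidence_prob ::
    "'a measure \<Rightarrow> (bool list \<Rightarrow> 'a \<Rightarrow> real) \<Rightarrow> (bool list \<Rightarrow> 'a \<Rightarrow> real^3) \<Rightarrow> real \<Rightarrow> nat \<Rightarrow> real"
  where "typical_incidence_prob \<Omega> \<tau> N t n =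
    1 / mean_edge_number \<Omega> \<tau> N t *
    enn2real (\<integral>\<^sup>+ \<omega>.
      (let M = maximal_edges (\<lambda>w. \<tau> w \<omega>) (\<lambda>w. N w \<omega>) t
       in \<Sum>(e, s)\<in>M. if internal_incidences e s M = n then 1 else 0) \<partial>\<Omega>)"

end

theory Submission
  imports Defs
begin

text \<open>
  Fix a great circle and one of its two half circles.  A random great circle hits the half circle
  in exactly one point almost surely, and the distribution function of this point carries the hit
  point to a uniform one (rotation invariance is only needed to see that no point is hit with positive
  probability).  Hence a segment on the circle is split like a uniformly fragmented interval: with
  \<open>F t l\<close> the expected sum of \<open>exp (- \<theta> * m)\<close> over the lengths \<open>m\<close> of its pieces at time \<open>t\<close>,
  \<open>F\<close> solves \<open>F' t l = - l * F t l + 2 * (\<integral>m=0..l. F t m)\<close>, whose solution is explicit.  Averaging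
  over the great circle gives the joint intensity of birth times and lengths of the maximal edges.

  Given the tessellation at its birth time \<open>s\<close>, an edge of length \<open>l\<close> is later met from both of its
  sides at rate \<open>2 * l\<close>: going through the generations of cells, one shows that the incidence number
  has the generating function \<open>exp (- 2 * (1 - z) * (t - s) * l)\<close>.  This is averaged
  over all edges by taking \<open>\<theta> = 2 * (1 - z) * (t - s)\<close> in \<open>F\<close>; dividing by \<open>t\<^sup>2\<close> and substituting
  \<open>s = t * u\<close> yields the limit \<open>\<integral>u=0..1. 2 * u\<^sup>2 / (u + 2 * (1 - z) * (1 - u))\<close>.  Its
  coefficients are the claimed integrals, and convergence of generating functions on \<open>[0, 1)\<close> implies
  convergence of coefficients.
\<close>

section \<open>Great circles and half circles\<close>

text \<open>The hypotheses describe the process one generation of the binary tree at a time and only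
  on product events, so no Markov property at a fixed time is given directly. Both main computations
  are therefore recast as identities that pass from generation \<open>k\<close> to
  \<open>k + 1\<close>: a telescoping sum for the intensity of edges (\<open>intensity_step\<close>)
  and a conserved expectation for the incidences (\<open>incidence_step\<close>). Each is its
  differential equation integrated over the next lifetime. What remains after \<open>k\<close>
  generations vanishes because a word of length \<open>k\<close> is born before time
  \<open>t\<close> with probability at most \<open>exp (3 * t) / 4 ^ k\<close>, while there are only
  \<open>2 ^ k\<close> words. Two great circles meet in two antipodal points, so a full circle is
  not cut like an interval; this is why half circles are used and why the root edge is treated
  apart: it contributes at most one, negligible against \<open>t\<^sup>2\<close>. General position
  turns the incidences, defined through sets and relative interiors, into a count of descendant
  words.\<close>

lemma great_circle_minus [simp]: "great_circle (- x) = great_circle x"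
  by (auto simp: great_circle_def)

text \<open>The part of \<open>y\<close> orthogonal to \<open>x\<close>, once normalised, lies on
  the circle of \<open>x\<close>, hence on that of \<open>y\<close>. It is then orthogonal to both
  \<open>x\<close> and \<open>y\<close>, so to itself, and vanishes.\<close>

lemma great_circle_eq_iff:
  assumes "x \<in> sphere2" "y \<in> sphere2"
  shows "great_circle x = great_circle y \<longleftrightarrow> y = x \<or> y = - x"
proof
  assume eq: "great_circle x = great_circle y"
  have xx: "x \<bullet> x = 1" and yy: "y \<bullet> y = 1" using assms by (auto simp: norm_eq_1)
  define v where "v = y - (x \<bullet> y) *\<^sub>R x"
  have xv: "x \<bullet> v = 0" by (simp add: v_def inner_diff_right xx)
  have "v = 0"
  proof (rule ccontr)
    assume v: "v \<noteq> 0"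
    have "v /\<^sub>R norm v \<in> great_circle x" using v xv by (simp add: great_circle_def)
    then have "y \<bullet> v = 0" using v by (simp add: eq) (simp add: great_circle_def)
    then have "v \<bullet> v = 0" using xv by (metis v_def inner_diff_left inner_scaleR_left mult_zero_right diff_0_right)
    with v show False by simp
  qed
  then have yx: "y = (x \<bullet> y) *\<^sub>R x" by (simp add: v_def)
  have "y \<bullet> y = (x \<bullet> y) * (x \<bullet> y)"
    using arg_cong[OF yx, of "\<lambda>v. v \<bullet> y"] by (simp only: inner_scaleR_left)
  then have "(x \<bullet> y)^2 = 1" using yy by (simp add: power2_eq_square)
  then have "x \<bullet> y = 1 \<or> x \<bullet> y = -1" by (simp add: power2_eq_1_iff)
  then show "y = x \<or> y = - x" using yx by (metis scaleR_minus1_left scaleR_one)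
qed auto

text \<open>By Lagrange's identity the double cross product is a combination with the two vanishing
  inner products as coefficients, so \<open>p\<close> is parallel to
  \<open>cross3 x y\<close>.\<close>

lemma orthogonal_cross3_cases:
  fixes x y p :: "real^3"
  assumes "x \<bullet> p = 0" "y \<bullet> p = 0" "cross3 x y \<noteq> 0"
  obtains c where "p = c *\<^sub>R cross3 x y"
proof -
  have "cross3 (cross3 x y) p = 0"
    using Lagrange[of p x y] assms(1,2) by (metis cross_skew cross_zero_left diff_zero inner_commute minus_zero scaleR_zero_left)
  then show ?thesis
    using that[of 0] that assms(3) unfolding cross_eq_0 collinear_lemma by (metis scaleR_zero_left)
qed

lemma cross3_nonzero:
  assumes "x \<in> sphere2" "y \<in> sphere2" "great_circle x \<noteq> great_circle y"
  shows "cross3 x y \<noteq> 0"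
proof
  assume "cross3 x y = 0"
  moreover have "x \<noteq> 0" "y \<noteq> 0" using assms by auto
  ultimately obtain c where "y = c *\<^sub>R x" unfolding cross_eq_0 collinear_lemma by auto
  moreover from this have "\<bar>c\<bar> = 1" using assms by auto
  ultimately have "y = x \<or> y = - x" by (auto simp: abs_if split: if_splits) 
  then show False using assms great_circle_eq_iff by blast
qed

lemma great_circle_Int_eq:
  assumes "x \<in> sphere2" "y \<in> sphere2" "great_circle x \<noteq> great_circle y"
  obtains a where "a \<in> sphere2" "great_circle x \<inter> great_circle y = {a, - a}"
proof -
  define a where "a = cross3 x y /\<^sub>R norm (cross3 x y)"
  have nz: "cross3 x y \<noteq> 0" using cross3_nonzero assms by blast
  have a: "a \<in> sphere2" "x \<bullet> a = 0" "y \<bullet> a = 0" using nz by (simp_all add: a_def dot_cross_self)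
  have "p = a \<or> p = - a" if "p \<in> great_circle x" "p \<in> great_circle y" for p
  proof -
    from that have p: "norm p = 1" "x \<bullet> p = 0" "y \<bullet> p = 0" by (auto simp: great_circle_def)
    obtain c where c: "p = c *\<^sub>R cross3 x y" using orthogonal_cross3_cases p nz by blast
    then have "p = (c * norm (cross3 x y)) *\<^sub>R a" using nz by (simp add: a_def)
    moreover from this have "\<bar>c * norm (cross3 x y)\<bar> = 1" using p a by (metis norm_scaleR mult.right_neutral mem_sphere_0)
    ultimately show ?thesis by (metis abs_if add.inverse_inverse scaleR_minus_left scaleR_one)
  qed
  with a have "great_circle x \<inter> great_circle y = {a, - a}" by (auto simp: great_circle_def)
  with a show ?thesis using that by blast
qed

lemma hemisphere_minus [simp]: "hemisphere b (- x) = hemisphere (\<not> b) x"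
  by (auto simp: hemisphere_def)

lemma hemisphere_Un: "hemisphere True x \<union> hemisphere False x = sphere2"
  by (auto simp: hemisphere_def)

lemma hemisphere_Int: "hemisphere True x \<inter> hemisphere False x = great_circle x"
  by (auto simp: hemisphere_def great_circle_def)

text \<open>The half circle runs from \<open>a\<close> over its midpoint \<open>d\<close> to
  \<open>- a\<close>; its circle has normal \<open>y\<close>, and \<open>h\<close> gives the
  hemisphere that cuts it out. The coordinate along \<open>a\<close> identifies a point of the arc,
  so the geometry on the arc reduces to the interval from -1 to 1.\<close>

locale half_circle =
  fixes y h a d :: "real^3"
  assumes unit: "norm y = 1" "norm a = 1" "norm d = 1"
    and orth: "y \<bullet> a = 0" "y \<bullet> d = 0" "a \<bullet> d = 0"
    and border: "h \<bullet> a = 0" "0 < h \<bullet> d"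
begin

definition arc :: "(real^3) set" where "arc = great_circle y \<inter> hemisphere True h"

text \<open>The coordinate along \<open>a\<close> of the point where the circle of \<open>x\<close>
  crosses the arc, for \<open>x \<bullet> a \<noteq> 0\<close>. In the basis \<open>a\<close>,
  \<open>d\<close> that point is orthogonal to \<open>(x \<bullet> a, x \<bullet> d)\<close>, and
  \<open>sgn (x \<bullet> a)\<close> selects, among the two antipodal solutions, the one with
  positive coordinate along \<open>d\<close>.\<close>

definition pos :: "real^3 \<Rightarrow> real"
  where "pos x = - (x \<bullet> d) * sgn (x \<bullet> a) / sqrt ((x \<bullet> a)\<^sup>2 + (x \<bullet> d)\<^sup>2)"

lemma dots [simp]: "y \<bullet> y = 1" "a \<bullet> a = 1" "d \<bullet> d = 1" "a \<bullet> y = 0" "d \<bullet> y = 0" "d \<bullet> a = 0"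
  "y \<bullet> a = 0" "y \<bullet> d = 0" "a \<bullet> d = 0" "h \<bullet> a = 0" "a \<bullet> h = 0"
  using unit orth border by (auto simp: norm_eq_1 inner_commute)

lemma expansion:
  assumes "y \<bullet> v = 0"
  shows "v = (a \<bullet> v) *\<^sub>R a + (d \<bullet> v) *\<^sub>R d"
proof -
  define w where "w = v - (a \<bullet> v) *\<^sub>R a - (d \<bullet> v) *\<^sub>R d"
  have w: "y \<bullet> w = 0" "a \<bullet> w = 0" "d \<bullet> w = 0"
    using assms by (simp_all add: w_def inner_diff_right)
  have nz: "cross3 a d \<noteq> 0"
    using norm_cross[of a d] unit by auto
  have "y \<bullet> cross3 a d \<noteq> 0"
  proof
    assume "y \<bullet> cross3 a d = 0"
    moreover obtain c where "y = c *\<^sub>R cross3 a d" by (rule orthogonal_cross3_cases[of a y d]) (use nz in auto)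
    ultimately have "y \<bullet> y = 0" by (metis inner_scaleR_right mult_zero_right)
    then show False by simp
  qed
  moreover obtain c where c: "w = c *\<^sub>R cross3 a d" using orthogonal_cross3_cases[of a w d] w nz by blast
  ultimately have "c = 0" using w(1) by auto
  then show ?thesis using c by (simp add: w_def algebra_simps)
qed

lemma arcD:
  assumes "v \<in> arc"
  shows "(a \<bullet> v)\<^sup>2 + (d \<bullet> v)\<^sup>2 = 1" "0 \<le> d \<bullet> v" "x \<bullet> v = (a \<bullet> v) * (x \<bullet> a) + (d \<bullet> v) * (x \<bullet> d)"
    "\<bar>a \<bullet> v\<bar> \<le> 1"
proof -
  have v: "norm v = 1" "y \<bullet> v = 0" "0 \<le> h \<bullet> v"
    using assms by (auto simp: arc_def great_circle_def hemisphere_def)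
  note e = expansion[OF v(2)]
  show *: "x \<bullet> v = (a \<bullet> v) * (x \<bullet> a) + (d \<bullet> v) * (x \<bullet> d)" for x
    using e by (metis inner_add_right inner_scaleR_right)
  show 1: "(a \<bullet> v)\<^sup>2 + (d \<bullet> v)\<^sup>2 = 1"
    using *[of v] v(1) by (simp add: norm_eq_1 power2_eq_square inner_commute)
  show "0 \<le> d \<bullet> v" using v(3) *[of h] border(2) by (simp add: zero_le_mult_iff)
  show "\<bar>a \<bullet> v\<bar> \<le> 1" using 1 by (metis abs_le_square_iff abs_one le_add_same_cancel1 power2_less_eq_zero_iff power_one zero_le_power2)
qed

lemma arcI:
  assumes "\<alpha>\<^sup>2 + \<delta>\<^sup>2 = 1" "0 \<le> \<delta>"
  shows "\<alpha> *\<^sub>R a + \<delta> *\<^sub>R d \<in> arc" "a \<bullet> (\<alpha> *\<^sub>R a + \<delta> *\<^sub>R d) = \<alpha>"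
  using assms border
  by (auto simp: arc_def great_circle_def hemisphere_def norm_eq_1 inner_add_left inner_add_right power2_eq_square)

lemma image_arc: "(\<bullet>) a ` arc = {-1..1}"
proof safe
  fix v assume "v \<in> arc" then show "a \<bullet> v \<in> {-1..1}" using arcD(4)[of v] by (simp add: abs_le_iff minus_le_iff)
next
  fix \<alpha> :: real assume "\<alpha> \<in> {-1..1}"
  then have "\<alpha>\<^sup>2 \<le> 1" by (simp add: abs_le_iff abs_square_le_1)
  then show "\<alpha> \<in> (\<bullet>) a ` arc"
    using arcI[of \<alpha> "sqrt (1 - \<alpha>\<^sup>2)"] by (intro image_eqI[where x="\<alpha> *\<^sub>R a + sqrt (1 - \<alpha>\<^sup>2) *\<^sub>R d"]) auto
qed

lemma pos_bounds:
  assumes "x \<bullet> a \<noteq> 0"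
  shows "\<bar>pos x\<bar> < 1"
proof -
  have "(x \<bullet> d)\<^sup>2 < (x \<bullet> a)\<^sup>2 + (x \<bullet> d)\<^sup>2" using assms by simp
  then have "\<bar>x \<bullet> d\<bar> < sqrt ((x \<bullet> a)\<^sup>2 + (x \<bullet> d)\<^sup>2)" using real_less_rsqrt real_sqrt_abs real_sqrt_less_iff by metis
  then show ?thesis using assms 
    by (simp add: pos_def abs_mult abs_sgn_eq sum_power2_gt_zero_iff divide_less_eq)
qed

text \<open>Along the half circle the side of the circle of \<open>x\<close> changes exactly once,
  at the crossing point.\<close>

lemma inner_arc_sgn:
  assumes x: "x \<bullet> a \<noteq> 0" and v: "v \<in> arc"
  shows "sgn (x \<bullet> v) = sgn (x \<bullet> a) * sgn (a \<bullet> v - pos x)"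
proof -
  define \<sigma> where "\<sigma> = sgn (x \<bullet> a)"
  have \<sigma>: "\<sigma>\<^sup>2 = 1" using x by (auto simp: \<sigma>_def sgn_if)
  define R where "R = sqrt ((x \<bullet> a)\<^sup>2 + (x \<bullet> d)\<^sup>2)"
  define q where "q = pos x"
  define r where "r = \<bar>x \<bullet> a\<bar> / R"
  have R: "0 < R" "R\<^sup>2 = (x \<bullet> a)\<^sup>2 + (x \<bullet> d)\<^sup>2" using x by (auto simp: R_def sum_power2_gt_zero_iff)
  have r: "0 < r" using x R by (simp add: r_def)
  have q: "\<bar>q\<bar> < 1" using pos_bounds x by (simp add: q_def)
  have A: "x \<bullet> a = \<sigma> * R * r" using R by (simp add: r_def \<sigma>_def sgn_mult_abs)
  have D: "x \<bullet> d = - \<sigma> * R * q" using R x by (simp add: q_def pos_def R_def[symmetric] \<sigma>_def sgn_if)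
  have "R\<^sup>2 = (\<sigma> * R * r)\<^sup>2 + (- \<sigma> * R * q)\<^sup>2" using R(2) unfolding A D .
  also have "\<dots> = \<sigma>\<^sup>2 * (R\<^sup>2 * (q\<^sup>2 + r\<^sup>2))" by (simp add: power_mult_distrib algebra_simps)
  finally have "R\<^sup>2 * 1 = R\<^sup>2 * (q\<^sup>2 + r\<^sup>2)" using \<sigma> by simp
  then have qr: "q\<^sup>2 + r\<^sup>2 = 1" using R(1) unfolding mult_cancel_left by simp
  define \<alpha> \<delta> where "\<alpha> = a \<bullet> v" "\<delta> = d \<bullet> v"
  have v1: "\<alpha>\<^sup>2 + \<delta>\<^sup>2 = 1" "0 \<le> \<delta>" "\<bar>\<alpha>\<bar> \<le> 1" using arcD(1,2,4)[OF v] by (simp_all add: \<alpha>_\<delta>_def)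
  have xv: "x \<bullet> v = \<sigma> * R * (\<alpha> * r - \<delta> * q)"
    unfolding arcD(3)[OF v, of x] A D \<alpha>_\<delta>_def[symmetric] by (simp add: algebra_simps)
  \<comment> \<open>Here \<open>(q, r)\<close> is the crossing point and
    \<open>(\<alpha>, \<delta>)\<close> is \<open>v\<close>, both on the upper unit half circle. The
    two additional factors are positive and turn the sine of the angle between the points into a
    difference of coordinates.\<close>
  have key: "(\<alpha> * r - \<delta> * q) * (\<delta> + r) = (\<alpha> - q) * (\<delta> * r + 1 + \<alpha> * q)"
    using qr v1(1) by algebra
  have "\<bar>\<alpha> * q\<bar> < 1" unfolding abs_mult using q v1(3) by (smt (verit) mult_left_le_one_le abs_ge_zero mult.commute)
  then have "0 < \<delta> * r + 1 + \<alpha> * q" using v1 r by (smt (verit) mult_nonneg_nonneg)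
  moreover have "0 < \<delta> + r" using v1 r by simp
  ultimately have "sgn (\<alpha> * r - \<delta> * q) = sgn (\<alpha> - q)"
    using arg_cong[OF key, of sgn] by (simp add: sgn_mult)
  then show ?thesis using xv R by (simp add: sgn_mult \<alpha>_\<delta>_def q_def \<sigma>_def)
qed

lemma hits_arc_iff:
  assumes "x \<bullet> a \<noteq> 0" "p \<subseteq> arc"
  shows "great_circle x \<inter> p \<noteq> {} \<longleftrightarrow> pos x \<in> (\<bullet>) a ` p"
proof -
  have "v \<in> great_circle x \<longleftrightarrow> a \<bullet> v = pos x" if "v \<in> p" for v
  proof -
    have v: "v \<in> arc" using that assms by auto
    have "v \<in> great_circle x \<longleftrightarrow> x \<bullet> v = 0" using v by (auto simp: arc_def great_circle_def)
    then show ?thesis using inner_arc_sgn[OF assms(1) v] assms(1) by (metis eq_iff_diff_eq_0 mult_eq_0_iff sgn_eq_0_iff)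
  qed
  then show ?thesis by (force simp: image_iff)
qed

lemma image_Int_hemisphere:
  assumes "x \<bullet> a \<noteq> 0" "p \<subseteq> arc"
  shows "(\<bullet>) a ` (p \<inter> hemisphere b x) =
    (\<bullet>) a ` p \<inter> (if b \<longleftrightarrow> 0 < x \<bullet> a then {pos x..} else {..pos x})"
proof -
  have *: "v \<in> hemisphere b x \<longleftrightarrow> a \<bullet> v \<in> (if b \<longleftrightarrow> 0 < x \<bullet> a then {pos x..} else {..pos x})" if "v \<in> p" for v
  proof -
    have v: "v \<in> arc" using that assms by auto
    have "v \<in> hemisphere b x \<longleftrightarrow> (if b then 0 \<le> x \<bullet> v else x \<bullet> v \<le> 0)" using v by (auto simp: arc_def great_circle_def hemisphere_def)
    then show ?thesis using inner_arc_sgn[OF assms(1) v] assms(1) by (auto simp: sgn_if split: if_splits)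
  qed
  then show ?thesis by auto
qed

end

lemma half_circle_exists:
  assumes "y \<in> sphere2" "h \<in> sphere2" "great_circle y \<noteq> great_circle h"
  obtains a d where "half_circle y h a d" "great_circle y \<inter> great_circle h = {a, - a}"
proof -
  obtain a where a: "a \<in> sphere2" "great_circle y \<inter> great_circle h = {a, - a}"
    using great_circle_Int_eq assms by blast
  have "a \<in> great_circle y" "a \<in> great_circle h" using a(2) by blast+
  then have ya: "y \<bullet> a = 0" "h \<bullet> a = 0" "norm a = 1" by (auto simp: great_circle_def)
  \<comment> \<open>Orthogonal to \<open>y\<close> and \<open>a\<close> and of unit length; only its
    sign is adjusted at the end, so that it points into the hemisphere of \<open>h\<close>.\<close>
  define d where "d = cross3 y a"
  have "norm d ^ 2 = 1" using norm_cross[of y a] assms ya by (simp add: d_def)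
  then have nd: "norm d = 1" by (smt (verit) norm_ge_zero power2_eq_1_iff)
  have hd: "h \<bullet> d \<noteq> 0"
  proof
    assume 0: "h \<bullet> d = 0"
    have "d \<in> great_circle y \<inter> great_circle h" using nd 0 by (simp add: great_circle_def d_def dot_cross_self)
    then have "d = a \<or> d = - a" using a by blast
    moreover have "a \<bullet> d = 0" by (simp add: d_def dot_cross_self)
    ultimately show False using ya by auto
  qed
  show ?thesis
  proof (rule that)
    show "half_circle y h a (sgn (h \<bullet> d) *\<^sub>R d)"
      using assms ya nd hd by unfold_locales (auto simp: d_def dot_cross_self sgn_if)
  qed fact
qed

section \<open>Random polytopes and normals of great circles\<close>

lemma sphere2_borel [measurable]: "sphere2 \<in> sets borel"
  by simp

text \<open>Cells and edges all have this form: a split adds one normal to the list of a cell, and a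
  circle enters with both signs of its normal.\<close>

definition polytope_of :: "(real^3) list \<Rightarrow> (real^3) set"
  where "polytope_of us = {y \<in> sphere2. \<forall>u\<in>set us. 0 \<le> u \<bullet> y}"

lemma polytope_of_simps:
  "polytope_of [] = sphere2"
  "polytope_of us \<inter> hemisphere b x = polytope_of ((if b then x else - x) # us)"
  "polytope_of us \<inter> great_circle x = polytope_of (x # - x # us)"
  by (auto simp: polytope_of_def hemisphere_def great_circle_def)

text \<open>Compactness of the sphere turns non-emptiness into countably many conditions.\<close>

lemma polytope_of_nonempty_iff:
  assumes D: "D \<subseteq> sphere2" "sphere2 \<subseteq> closure D"
  shows "polytope_of us \<noteq> {} \<longleftrightarrow> (\<forall>n::nat. \<exists>y\<in>D. \<forall>u\<in>set us. - inverse (real (Suc n)) < u \<bullet> y)"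
proof (intro iffI allI)
  fix n :: nat
  assume ne: "polytope_of us \<noteq> {}"
  let ?e = "inverse (real (Suc n))"
  from ne obtain y where y: "y \<in> sphere2" "\<forall>u\<in>set us. 0 \<le> u \<bullet> y" by (auto simp: polytope_of_def)
  let ?U = "\<Inter>u\<in>set us. {y. - ?e < u \<bullet> y}"
  have U: "open ?U" by (intro open_INT ballI open_Collect_less continuous_intros finite_set)
  have "y \<in> ?U" using y by (auto intro: less_le_trans[of _ 0])
  then have "?U \<inter> D \<noteq> {}" using y(1) D(2) open_Int_closure_eq_empty[OF U, of D] by blast
  then show "\<exists>y\<in>D. \<forall>u\<in>set us. - ?e < u \<bullet> y" by auto
next
  assume *: "\<forall>n::nat. \<exists>y\<in>D. \<forall>u\<in>set us. - inverse (real (Suc n)) < u \<bullet> y"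
  then have "\<forall>n. \<exists>y. y \<in> D \<and> (\<forall>u\<in>set us. - inverse (real (Suc n)) < u \<bullet> y)" by blast
  then obtain Y where "\<forall>n. Y n \<in> D \<and> (\<forall>u\<in>set us. - inverse (real (Suc n)) < u \<bullet> Y n)"
    by (rule choice[THEN exE])
  then have Y: "\<And>n. Y n \<in> D" "\<And>n u. u \<in> set us \<Longrightarrow> - inverse (real (Suc n)) < u \<bullet> Y n" by blast+
  have "\<forall>n. Y n \<in> sphere2" using Y(1) D(1) by blast
  moreover have "compact (sphere2)" by simp
  ultimately obtain l r where l: "l \<in> sphere2" "strict_mono (r::nat \<Rightarrow> nat)" "(Y \<circ> r) \<longlonglongrightarrow> l"
    unfolding compact_def by blast
  have "0 \<le> u \<bullet> l" if u: "u \<in> set us" for u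
  proof (rule LIMSEQ_le)
    show "(\<lambda>n. u \<bullet> (Y \<circ> r) n) \<longlonglongrightarrow> u \<bullet> l" using l(3) by (intro tendsto_intros)
    have "((\<lambda>n. - inverse (real (Suc n))) \<circ> r) \<longlonglongrightarrow> - 0"
      by (intro LIMSEQ_subseq_LIMSEQ l(2) tendsto_minus LIMSEQ_inverse_real_of_nat)
    then show "(\<lambda>n. - inverse (real (Suc (r n)))) \<longlonglongrightarrow> 0" by (simp add: o_def)
    show "\<exists>N. \<forall>n\<ge>N. - inverse (real (Suc (r n))) \<le> u \<bullet> (Y \<circ> r) n"
      using Y(2)[OF u] by (auto intro: less_imp_le)
  qed
  then have "l \<in> polytope_of us" using l by (auto simp: polytope_of_def)
  then show "polytope_of us \<noteq> {}" by blast
qed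

text \<open>Measurability of a random set is expressed through a fixed finite list of measurable
  normals, without a \<sigma>-algebra on sets of points. Nonemptiness, being hit, and later
  \<open>len\<close> then become measurable in the ordinary sense.\<close>

definition random_polytope :: "'a measure \<Rightarrow> ('a \<Rightarrow> (real^3) set) \<Rightarrow> bool"
  where "random_polytope M c \<longleftrightarrow>
    (\<exists>fs. set fs \<subseteq> borel_measurable M \<and> (\<forall>\<omega>\<in>space M. c \<omega> = polytope_of (map (\<lambda>f. f \<omega>) fs)))"

lemma random_polytope_sphere [intro, simp]: "random_polytope M (\<lambda>_. sphere2)"
  unfolding random_polytope_def by (rule exI[of _ "[]"]) (auto simp: polytope_of_simps)

lemma random_polytope_hemisphere [intro]:
  assumes "random_polytope M c" and [measurable]: "f \<in> borel_measurable M"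
  shows "random_polytope M (\<lambda>\<omega>. c \<omega> \<inter> hemisphere b (f \<omega>))"
proof -
  from assms obtain fs where "set fs \<subseteq> borel_measurable M" "\<forall>\<omega>\<in>space M. c \<omega> = polytope_of (map (\<lambda>f. f \<omega>) fs)"
    by (auto simp: random_polytope_def)
  then show ?thesis unfolding random_polytope_def
    by (intro exI[of _ "(if b then f else (\<lambda>\<omega>. - f \<omega>)) # fs"]) (auto simp: polytope_of_simps)
qed

lemma random_polytope_great_circle [intro]:
  assumes "random_polytope M c" and [measurable]: "f \<in> borel_measurable M"
  shows "random_polytope M (\<lambda>\<omega>. c \<omega> \<inter> great_circle (f \<omega>))"
proof -
  have "c \<omega> \<inter> great_circle (f \<omega>) = c \<omega> \<inter> hemisphere True (f \<omega>) \<inter> hemisphere False (f \<omega>)" for \<omega>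
    using hemisphere_Int by blast
  then show ?thesis using assms by (simp add: random_polytope_hemisphere)
qed

lemma random_polytope_compose:
  assumes "random_polytope M c" "g \<in> measurable N M"
  shows "random_polytope N (\<lambda>x. c (g x))"
proof -
  from assms obtain fs where fs: "set fs \<subseteq> borel_measurable M" "\<forall>\<omega>\<in>space M. c \<omega> = polytope_of (map (\<lambda>f. f \<omega>) fs)"
    by (auto simp: random_polytope_def)
  have "f \<circ> g \<in> borel_measurable N" if "f \<in> set fs" for f
    by (rule measurable_comp[OF assms(2)]) (use that fs in auto)
  then show ?thesis unfolding random_polytope_def using fs(2) measurable_space[OF assms(2)]
    by (intro exI[of _ "map (\<lambda>f. f \<circ> g) fs"]) (auto simp: o_def)
qed

lemma random_polytope_nonempty :
  assumes "random_polytope M c"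
  shows "Measurable.pred M (\<lambda>\<omega>. c \<omega> \<noteq> {})"
proof -
  from assms obtain fs where fs: "set fs \<subseteq> borel_measurable M" "\<forall>\<omega>\<in>space M. c \<omega> = polytope_of (map (\<lambda>f. f \<omega>) fs)"
    by (auto simp: random_polytope_def)
  obtain D where D: "countable D" "D \<subseteq> sphere2" "sphere2 \<subseteq> closure (D :: (real^3) set)"
    using separable by metis
  have "Measurable.pred M (\<lambda>\<omega>. \<forall>n::nat. \<exists>y\<in>D. \<forall>f\<in>set fs. - inverse (real (Suc n)) < f \<omega> \<bullet> y)"
  proof (intro pred_intros_countable(1) measurable_pred_countable(2) pred_intros_finite(3))
    fix f assume "f \<in> set fs"
    then have [measurable]: "f \<in> borel_measurable M" using fs by auto
    show "Measurable.pred M (\<lambda>\<omega>. - inverse (real (Suc n)) < f \<omega> \<bullet> y)" for n y by measurable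
  qed (auto simp: D)
  also have "?this \<longleftrightarrow> ?thesis"
    using fs(2) by (intro measurable_cong) (simp add: polytope_of_nonempty_iff[OF D(2,3)])
  finally show ?thesis .
qed

lemma random_polytope_hits:
  assumes "random_polytope M c" "f \<in> borel_measurable M"
  shows "Measurable.pred M (\<lambda>\<omega>. great_circle (f \<omega>) \<inter> c \<omega> \<noteq> {})"
  using random_polytope_nonempty[OF random_polytope_great_circle[OF assms]] by (simp add: Int_commute)

lemma random_polytope_const: "random_polytope M c \<Longrightarrow> \<omega> \<in> space M \<Longrightarrow> random_polytope N (\<lambda>_. c \<omega>)"
proof -
  assume "random_polytope M c" "\<omega> \<in> space M"
  then obtain fs where "c \<omega> = polytope_of (map (\<lambda>f. f \<omega>) fs)"
    by (auto simp: random_polytope_def)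
  then show ?thesis unfolding random_polytope_def
    by (intro exI[of _ "map (\<lambda>f _. f \<omega>) fs"]) (auto simp: o_def)
qed

text \<open>The sign is fixed by the first nonzero coordinate, which is a Borel choice between the
  two normals of a circle.\<close>

definition representative :: "real^3 \<Rightarrow> real^3"
  where "representative x =
    (if 0 < x$1 \<or> x$1 = 0 \<and> (0 < x$2 \<or> x$2 = 0 \<and> 0 < x$3) then x else - x)"

lemma representative_measurable [measurable]: "representative \<in> borel_measurable borel"
  unfolding representative_def by measurable

lemma representative_cases: "representative x = x \<or> representative x = - x"
  by (simp add: representative_def)

lemma great_circle_representative [simp]: "great_circle (representative x) = great_circle x"
  by (simp add: representative_def)

lemma representative_uminus: "x \<noteq> 0 \<Longrightarrow> representative (- x) = representative x"
  by (auto simp: representative_def vec_eq_iff forall_3)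

lemma norm_representative [simp]: "norm (representative x) = norm x"
  by (simp add: representative_def)

text \<open>A Borel section of the quotient map from unit normals to great circles.\<close>

definition pole :: "(real^3) set \<Rightarrow> real^3"
  where "pole S = representative (SOME x. x \<in> sphere2 \<and> great_circle x = S)"

lemma pole_great_circle: "x \<in> sphere2 \<Longrightarrow> pole (great_circle x) = representative x"
proof -
  assume x: "x \<in> sphere2"
  define z where "z = (SOME z. z \<in> sphere2 \<and> great_circle z = great_circle x)"
  have "z \<in> sphere2 \<and> great_circle z = great_circle x"
    unfolding z_def by (rule someI) (use x in auto)
  then have "x = z \<or> x = - z" using great_circle_eq_iff x by blast
  moreover have "z \<noteq> 0" using \<open>z \<in> sphere2 \<and> _\<close> by auto
  ultimately show ?thesis using representative_uminus unfolding pole_def z_def[symmetric] by auto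
qed

lemma pole_in_sphere: "S \<in> great_circles \<Longrightarrow> pole S \<in> sphere2 \<and> great_circle (pole S) = S"
  by (auto simp: great_circles_def pole_great_circle)

lemma space_great_circle_space [simp]: "space great_circle_space = great_circles"
  by (auto simp: great_circle_space_def space_measure_of_conv)

lemma sets_great_circle_space:
  "sets great_circle_space = {A. A \<subseteq> great_circles \<and> {x \<in> sphere2. great_circle x \<in> A} \<in> sets borel}"
  (is "_ = ?F")
proof -
  have s: "(sphere2 :: (real^3) set) \<in> sets borel" by simp
  have 1: "A \<subseteq> great_circles \<and> {x \<in> sphere2. great_circle x \<in> A} \<in> sets borel"
    if "A \<in> sigma_sets great_circles ?F" for A
    using that
  proof (induction rule: sigma_sets.induct)
    case (Compl a)
    have "{x \<in> sphere2. great_circle x \<in> great_circles - a} = sphere2 - {x \<in> sphere2. great_circle x \<in> a}"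
      by (auto simp: great_circles_def)
    then show ?case using Compl s by auto
  next
    case (Union a)
    have "{x \<in> sphere2. great_circle x \<in> (\<Union>i. a i)} = (\<Union>i. {x \<in> sphere2. great_circle x \<in> a i})" by auto
    then show ?case using Union by (auto simp del: mem_sphere_0 UN_iff) blast
  qed auto
  have "?F \<subseteq> Pow great_circles" by auto
  then have "sets great_circle_space = sigma_sets great_circles ?F"
    unfolding great_circle_space_def by (rule sets_measure_of)
  also have "\<dots> = ?F"
  proof (rule set_eqI, rule iffI)
    fix A assume "A \<in> sigma_sets great_circles ?F"
    then show "A \<in> ?F" using 1 by blast
  qed (rule sigma_sets.Basic)
  finally show ?thesis .
qed

lemma pole_measurable [measurable]: "pole \<in> borel_measurable great_circle_space"
proof (rule measurableI)
  fix A :: "(real^3) set" assume [measurable]: "A \<in> sets borel"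
  have "{x \<in> sphere2. great_circle x \<in> pole -` A \<inter> space great_circle_space} = {x \<in> space borel. x \<in> sphere2 \<and> representative x \<in> A}"
    by (auto simp: pole_great_circle great_circles_def)
  also have "\<dots> \<in> sets borel" by measurable
  finally show "pole -` A \<inter> space great_circle_space \<in> sets great_circle_space"
    by (auto simp: sets_great_circle_space)
qed simp

text \<open>Points of the moment curve: orthogonality to a fixed vector is a polynomial equation of
  degree at most two in \<open>i\<close>.\<close>

definition moment :: "nat \<Rightarrow> real^3"
  where "moment i = (\<chi> k. if k = 1 then 1 else if k = 2 then real i else (real i)\<^sup>2)"

lemma moment_nonzero: "moment i \<noteq> 0"
proof
  assume "moment i = 0"
  then have "moment i $ 1 = 0" by simp
  then show False by (simp add: moment_def)
qed

section \<open>The law of a random great circle, carried over to normals\<close>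

context isotropic_measure
begin

text \<open>Only the chosen one of two opposite normals is charged, so this law is not itself
  rotation invariant; it is only ever used through \<open>great_circle x\<close> or conditions that
  ignore the sign of \<open>x\<close>.\<close>

definition normal_law :: "(real^3) measure" where "normal_law = distr \<kappa> borel pole"

lemma space_kappa [simp]: "space \<kappa> = great_circles"
  using sets_eq_imp_space_eq[OF sets_kappa] by simp

lemma pole_measurable_kappa [measurable]: "pole \<in> borel_measurable \<kappa>"
  using pole_measurable measurable_cong_sets[OF sets_kappa refl] by blast

lemma sets_normal_law [simp, measurable_cong]: "sets normal_law = sets borel"
  and space_normal_law [simp]: "space normal_law = UNIV"
  by (auto simp: normal_law_def)

sublocale normal_law: prob_space normal_law
  unfolding normal_law_def by (rule prob_space_distr) measurable

lemma emeasure_kappa_hitting: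
  assumes c: "random_polytope (borel :: (real^3) measure) (\<lambda>_. c)" and [measurable]: "D \<in> sets borel"
  shows "emeasure \<kappa> ((pole -` D \<inter> great_circles) \<inter> hitting c) = emeasure normal_law (D \<inter> {x. great_circle x \<inter> c \<noteq> {}})"
proof -
  have [measurable]: "Measurable.pred borel (\<lambda>x. great_circle x \<inter> c \<noteq> {})"
    by (rule random_polytope_hits[OF c]) simp
  have "D \<inter> {x. great_circle x \<inter> c \<noteq> {}} = {x \<in> space borel. x \<in> D \<and> great_circle x \<inter> c \<noteq> {}}" by auto
  also have "\<dots> \<in> sets borel" by measurable
  finally have "emeasure normal_law (D \<inter> {x. great_circle x \<inter> c \<noteq> {}}) = emeasure \<kappa> (pole -` (D \<inter> {x. great_circle x \<inter> c \<noteq> {}}) \<inter> space \<kappa>)"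
    by (simp add: normal_law_def emeasure_distr)
  also have "pole -` (D \<inter> {x. great_circle x \<inter> c \<noteq> {}}) \<inter> space \<kappa> = (pole -` D \<inter> great_circles) \<inter> hitting c"
    using pole_in_sphere by (auto simp: hitting_def)
  finally show ?thesis by simp
qed

lemma AE_normal_in_sphere: "AE x in normal_law. x \<in> sphere2"
  unfolding normal_law_def by (subst AE_distr_iff) (use pole_in_sphere in \<open>auto intro!: AE_I2\<close>)

text \<open>A rotation taking \<open>p\<close> to \<open>q\<close> maps the circles through
  \<open>p\<close> onto those through \<open>q\<close>.\<close>

lemma hitting_point_rotate:
  assumes "p \<in> sphere2" "q \<in> sphere2"
  shows "emeasure \<kappa> (hitting {p}) = emeasure \<kappa> (hitting {q})"
proof -
  obtain f where f: "orthogonal_transformation f" "det (matrix f) = 1" "f p = q"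
    by (rule rotation_exists[of p q]) (use assms in auto)
  define Q where "Q = matrix f"
  have fQ: "f = (*v) Q" using f(1) unfolding Q_def by (auto simp: orthogonal_transformation_def matrix_of_matrix_vector_mul)
  have "rotation_matrix Q" using f by (simp add: rotation_matrix_def Q_def orthogonal_transformation_matrix)
  note inv = rotation_invariant[OF this, folded fQ]
  have inner: "f u \<bullet> f v = u \<bullet> v" for u v using f(1) by (simp add: orthogonal_transformation_def)
  have nf: "norm (f u) = norm u" for u by (simp add: norm_eq_sqrt_inner inner)
  have bij: "bij f" using f(1) orthogonal_transformation_bij by blast
  have fg: "f ` great_circle x = great_circle (f x)" for x
  proof -
    have "z \<in> f ` great_circle x" if "z \<in> great_circle (f x)" for z
    proof -
      obtain v where "z = f v" using bij by (meson bij_pointE)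
      then show ?thesis using that by (auto simp: great_circle_def nf inner)
    qed
    then show ?thesis by (auto simp: great_circle_def nf inner)
  qed
  have lin: "linear f" using f(1) by (simp add: orthogonal_transformation_def)
  have [measurable]: "f \<in> borel_measurable borel"
    by (intro borel_measurable_continuous_onI linear_continuous_on linear_conv_bounded_linear[THEN iffD1] lin)
  have meas: "image f \<in> measurable \<kappa> great_circle_space"
  proof (rule measurableI)
    fix A assume "A \<in> sets great_circle_space"
    then have A: "A \<subseteq> great_circles" and [measurable]: "{x \<in> sphere2. great_circle x \<in> A} \<in> sets borel"
      by (auto simp: sets_great_circle_space)
    have "{x \<in> sphere2. great_circle x \<in> image f -` A \<inter> space \<kappa>} = {x \<in> space borel. f x \<in> {x \<in> sphere2. great_circle x \<in> A}}"
      by (auto simp: fg nf great_circles_def)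
    also have "\<dots> \<in> sets borel" by measurable
    finally show "image f -` A \<inter> space \<kappa> \<in> sets \<kappa>"
      by (auto simp: sets_great_circle_space sets_kappa)
  qed (auto simp: great_circles_def fg nf)
  have h: "hitting {q} \<in> sets great_circle_space"
  proof -
    have "{x \<in> sphere2. great_circle x \<in> hitting {q}} = {x \<in> space borel. x \<in> sphere2 \<and> x \<bullet> q = 0}"
      using assms by (auto simp: hitting_def great_circles_def great_circle_def)
    also have "\<dots> \<in> sets borel" by measurable
    finally show ?thesis by (auto simp: sets_great_circle_space hitting_def)
  qed
  have "emeasure \<kappa> (hitting {q}) = emeasure (distr \<kappa> great_circle_space (image f)) (hitting {q})" by (simp add: inv)
  also have "\<dots> = emeasure \<kappa> (image f -` hitting {q} \<inter> space \<kappa>)" using meas h by (rule emeasure_distr)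
  also have "image f -` hitting {q} \<inter> space \<kappa> = hitting {p}"
  proof -
    have "q \<in> f ` S \<longleftrightarrow> p \<in> S" for S using f(3) bij by (metis bij_is_inj inj_image_mem_iff)
    moreover have "f ` S \<in> great_circles" if "S \<in> great_circles" for S using that by (auto simp: great_circles_def fg nf)
    ultimately show ?thesis by (auto simp: hitting_def)
  qed
  finally show ?thesis by simp
qed

text \<open>A great circle contains at most two of the points in direction \<open>(1, i, i\<^sup>2)\<close>, all of which
  are hit with the same probability.\<close>

lemma emeasure_hitting_point: "q \<in> sphere2 \<Longrightarrow> emeasure \<kappa> (hitting {q}) = 0"
proof -
  assume q: "q \<in> sphere2"
  define p where "p i = sgn (moment i)" for i
  have ps: "p i \<in> sphere2" for i by (simp add: p_def norm_sgn moment_nonzero)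
  have set: "hitting {p i} \<in> sets \<kappa>" for i
  proof -
    have "{x \<in> sphere2. great_circle x \<in> hitting {p i}} = {x \<in> space borel. x \<in> sphere2 \<and> x \<bullet> p i = 0}"
      using ps by (auto simp: hitting_def great_circles_def great_circle_def)
    also have "\<dots> \<in> sets borel" by measurable
    finally show ?thesis by (auto simp: sets_great_circle_space hitting_def sets_kappa)
  qed
  have two: "card {i. i < n \<and> S \<in> hitting {p i}} \<le> 2" if S: "S \<in> great_circles" for n S
  proof -
    obtain x where x: "x \<in> sphere2" "S = great_circle x" using S by (auto simp: great_circles_def)
    \<comment> \<open>Orthogonality of \<open>x\<close> to \<open>moment i\<close> says that
      \<open>i\<close> is a root of this polynomial, which is nonzero because \<open>x\<close> is a
      unit vector.\<close>
    define P where "P = [:x$1, x$2, x$3:]"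
    have P: "P \<noteq> 0" using x(1) by (auto simp: P_def norm_eq_sqrt_inner inner_vec_def sum_3)
    have "{i. i < n \<and> S \<in> hitting {p i}} \<subseteq> {i. poly P (real i) = 0}"
    proof safe
      fix i assume "S \<in> hitting {p i}"
      then have "x \<bullet> p i = 0" by (auto simp: hitting_def x great_circle_def)
      then have "x \<bullet> moment i = 0" by (simp add: p_def sgn_div_norm moment_nonzero)
      then show "poly P (real i) = 0" by (simp add: P_def moment_def inner_vec_def sum_3 power2_eq_square algebra_simps)
    qed
    moreover have fin: "finite {x. poly P x = 0}" using P poly_roots_finite by blast
    have f2: "finite {i. poly P (real i) = 0}"
      using finite_vimageI[OF fin, of real] by (simp add: vimage_def inj_def)
    ultimately have "card {i. i < n \<and> S \<in> hitting {p i}} \<le> card {i. poly P (real i) = 0}" by (intro card_mono)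
    also have "\<dots> = card (real ` {i. poly P (real i) = 0})" by (simp add: card_image inj_on_def)
    also have "\<dots> \<le> card {x. poly P x = 0}" by (intro card_mono fin) auto
    also have "\<dots> \<le> degree P" by (rule card_poly_roots_bound[OF P])
    also have "\<dots> \<le> 2" by (simp add: P_def)
    finally show ?thesis .
  qed
  have "ennreal (real n) * emeasure \<kappa> (hitting {q}) \<le> 2" for n
  proof -
    have "ennreal (real n) * emeasure \<kappa> (hitting {q}) = (\<Sum>i<n. emeasure \<kappa> (hitting {p i}))"
      using hitting_point_rotate[OF ps q] by (simp add: ennreal_of_nat_eq_real_of_nat)
    also have "\<dots> = (\<integral>\<^sup>+S. (\<Sum>i<n. indicator (hitting {p i}) S) \<partial>\<kappa>)"
      using set by (subst nn_integral_sum) auto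
    also have "\<dots> \<le> (\<integral>\<^sup>+S. 2 \<partial>\<kappa>)"
    proof (rule nn_integral_mono)
      fix S assume S: "S \<in> space \<kappa>"
      have "(\<Sum>i<n. indicator (hitting {p i}) S :: ennreal) = of_nat (card {i. i < n \<and> S \<in> hitting {p i}})"
        by (simp add: indicator_def sum.If_cases Int_def lessThan_def)
      also have "\<dots> \<le> of_nat 2" using two S by (intro of_nat_mono) auto
      finally show "(\<Sum>i<n. indicator (hitting {p i}) S :: ennreal) \<le> 2" by simp
    qed
    also have "\<dots> = 2" using emeasure_space_1 by simp
    finally show ?thesis .
  qed
  then have b: "real n * measure \<kappa> (hitting {q}) \<le> 2" for n
    by (simp add: emeasure_eq_measure flip: ennreal_mult) (metis ennreal_le_iff ennreal_numeral zero_le_numeral)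
  have "measure \<kappa> (hitting {q}) = 0"
  proof (rule ccontr)
    assume "measure \<kappa> (hitting {q}) \<noteq> 0"
    then have m: "0 < measure \<kappa> (hitting {q})" using measure_nonneg[of \<kappa> "hitting {q}"] by linarith
    obtain n where "2 < real n * measure \<kappa> (hitting {q})" using reals_Archimedean3[OF m] by blast
    then show False using b[of n] by simp
  qed
  then show ?thesis by (simp add: emeasure_eq_measure)
qed

lemma AE_normal_inner_nonzero:
  assumes "q \<noteq> 0"
  shows "AE x in normal_law. x \<bullet> q \<noteq> 0"
proof (rule AE_I')
  define p where "p = q /\<^sub>R norm q"
  have p: "p \<in> sphere2" using assms by (simp add: p_def)
  have "emeasure normal_law {x. x \<bullet> q = 0} = emeasure \<kappa> (pole -` {x. x \<bullet> q = 0} \<inter> space \<kappa>)"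
  proof -
    have "{x. x \<bullet> q = 0} = {x \<in> space borel. x \<bullet> q = 0}" by simp
    also have "\<dots> \<in> sets borel" by measurable
    finally show ?thesis by (simp add: normal_law_def emeasure_distr)
  qed
  also have "pole -` {x. x \<bullet> q = 0} \<inter> space \<kappa> = hitting {p}"
  proof -
    have "x \<bullet> q = 0 \<longleftrightarrow> p \<in> great_circle x" for x using p assms by (auto simp: p_def great_circle_def)
    then show ?thesis using pole_in_sphere by (auto simp: hitting_def)
  qed
  also have "emeasure \<kappa> \<dots> = 0" using emeasure_hitting_point p by blast
  finally show "{x. x \<bullet> q = 0} \<in> null_sets normal_law"
    by (intro null_setsI) (auto simp: borel_closed closed_hyperplane inner_commute intro!: borel_closed closed_Collect_eq continuous_intros)
  show "{x \<in> space normal_law. \<not> x \<bullet> q \<noteq> 0} \<subseteq> {x. x \<bullet> q = 0}" by auto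
qed

lemma AE_great_circle_neq: 
  assumes "y \<in> sphere2" shows "AE x in normal_law. great_circle x \<noteq> great_circle y"
proof -
  obtain q where q: "q \<noteq> 0" "orthogonal y q"
    using orthogonal_to_vector_exists[of y] by auto
  define p where "p = q /\<^sub>R norm q"
  have p: "p \<in> great_circle y" "p \<noteq> 0" using q by (auto simp: p_def great_circle_def orthogonal_def)
  from AE_normal_inner_nonzero[OF p(2)] show ?thesis
    by eventually_elim (use p(1) in \<open>auto simp: great_circle_def\<close>)
qed

lemma AE_great_circle_triple:
  assumes "y \<in> sphere2" "h \<in> sphere2" "great_circle y \<noteq> great_circle h"
  shows "AE x in normal_law. great_circle x \<inter> great_circle y \<inter> great_circle h = {}"
proof -
  obtain a where a: "a \<in> sphere2" "great_circle y \<inter> great_circle h = {a, - a}"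
    using great_circle_Int_eq assms by blast
  then have "a \<noteq> 0" by auto
  from AE_normal_inner_nonzero[OF this] show ?thesis
    by eventually_elim (use a in \<open>auto simp: great_circle_def Int_assoc\<close>)
qed

text \<open>Plays two roles: for a cell it is the rate of its lifetime, and for a piece of a half
  circle it serves as length, normalised so that the whole half circle has length one
  (\<open>len_arc\<close>).\<close>

definition len :: "(real^3) set \<Rightarrow> real"
  where "len c = measure normal_law {x. great_circle x \<inter> c \<noteq> {}}"

lemma len_nonneg [simp]: "0 \<le> len c" and len_le_1 [simp]: "len c \<le> 1"
  by (simp_all add: len_def)

lemma len_empty [simp]: "len {} = 0" by (simp add: len_def)

lemma emeasure_hits: "emeasure normal_law {x. great_circle x \<inter> c \<noteq> {}} = ennreal (len c)"
  by (simp add: len_def normal_law.emeasure_eq_measure)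

lemma hits_set [measurable]:
  assumes "random_polytope (borel :: (real^3) measure) (\<lambda>_. c)"
  shows "{x. great_circle x \<inter> c \<noteq> {}} \<in> sets borel"
  using random_polytope_hits[OF assms, of "\<lambda>x. x"] by (simp add: pred_def)

lemma len_mono:
  assumes "c \<subseteq> c'" "random_polytope (borel :: (real^3) measure) (\<lambda>_. c')"
  shows "len c \<le> len c'"
  unfolding len_def by (intro normal_law.finite_measure_mono) (use assms hits_set[OF assms(2)] in auto)

lemma measure_hitting:
  assumes "random_polytope (borel :: (real^3) measure) (\<lambda>_. c)"
  shows "measure \<kappa> (hitting c) = len c"
  using emeasure_kappa_hitting[OF assms, of UNIV] hitting_def
  by (simp add: len_def measure_def Int_absorb1 hitting_def subset_iff)

text \<open>The value is the mass of a section of a measurable set in the product with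
  \<open>normal_law\<close>, so Fubini applies.\<close>

lemma len_measurable:
  assumes "random_polytope M c"
  shows "(\<lambda>\<omega>. len (c \<omega>)) \<in> borel_measurable M"
proof -
  have [measurable]: "Measurable.pred (M \<Otimes>\<^sub>M normal_law) (\<lambda>z. great_circle (snd z) \<inter> c (fst z) \<noteq> {})"
    by (intro random_polytope_hits random_polytope_compose[OF assms]) measurable
  have "(\<lambda>\<omega>. \<integral>\<^sup>+x. indicator {z \<in> space (M \<Otimes>\<^sub>M normal_law). great_circle (snd z) \<inter> c (fst z) \<noteq> {}} (\<omega>, x) \<partial>normal_law) \<in> borel_measurable M"
    by measurable
  then have "(\<lambda>\<omega>. enn2real (\<integral>\<^sup>+x. indicator {z \<in> space (M \<Otimes>\<^sub>M normal_law). great_circle (snd z) \<inter> c (fst z) \<noteq> {}} (\<omega>, x) \<partial>normal_law)) \<in> borel_measurable M"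
    by measurable
  also have "?this \<longleftrightarrow> ?thesis"
  proof (rule measurable_cong)
    fix \<omega> assume \<omega>: "\<omega> \<in> space M"
    have "(\<integral>\<^sup>+x. indicator {z \<in> space (M \<Otimes>\<^sub>M normal_law). great_circle (snd z) \<inter> c (fst z) \<noteq> {}} (\<omega>, x) \<partial>normal_law)
      = (\<integral>\<^sup>+x. indicator {x. great_circle x \<inter> c \<omega> \<noteq> {}} x \<partial>normal_law)"
      using \<omega> by (intro nn_integral_cong) (auto simp: indicator_def space_pair_measure)
    also have "\<dots> = ennreal (len (c \<omega>))"
      using hits_set[OF random_polytope_const[OF assms \<omega>]] by (simp add: emeasure_hits)
    finally show "enn2real (\<integral>\<^sup>+x. indicator {z \<in> space (M \<Otimes>\<^sub>M normal_law). great_circle (snd z) \<inter> c (fst z) \<noteq> {}} (\<omega>, x) \<partial>normal_law) = len (c \<omega>)"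
      by simp
  qed
  finally show ?thesis .
qed

end

section \<open>The hit point on a half circle\<close>

text \<open>Probability integral transform on an interval: without atoms the partial mass
  \<open>measure M {\<alpha>..x}\<close> is continuous in \<open>x\<close> and carries the law
  restricted to the interval to Lebesgue measure. The two image measures are compared through their
  distribution functions.\<close>

lemma (in real_distribution) nn_integral_interval_mass:
  assumes atomless: "\<And>x. measure M {x} = 0" and ab: "\<alpha> \<le> \<beta>"
    and [measurable]: "G \<in> borel_measurable borel"
  shows "(\<integral>\<^sup>+x. G (measure M {\<alpha>..x}) * indicator {\<alpha>..\<beta>} x \<partial>M) =
    (\<integral>\<^sup>+u. G u * indicator {0..measure M {\<alpha>..\<beta>}} u \<partial>lborel)"
proof -
  define F where "F x = measure M {\<alpha>..x}" for x
  define L where "L = measure M {\<alpha>..\<beta>}"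
  have Fmono: "F x \<le> F y" if "x \<le> y" for x y
    unfolding F_def by (rule finite_measure_mono) (use that in auto)
  have mono_F: "mono F" using Fmono by (auto intro: monoI)
  have [measurable]: "F \<in> borel_measurable borel" by (rule borel_measurable_mono[OF mono_F])
  have F0: "0 \<le> F x" for x by (simp add: F_def)
  have FL: "F \<beta> = L" by (simp add: F_def L_def)
  have F\<alpha>: "F \<alpha> = 0" using atomless by (simp add: F_def)
  have Fcdf: "F x = cdf M x - cdf M \<alpha>" if "\<alpha> \<le> x" for x
  proof -
    have "measure M {..x} = measure M {..\<alpha>} + measure M {\<alpha><..x}"
      using that by (subst finite_measure_Union[symmetric]) (auto simp: ivl_disj_un)
    moreover have "measure M {\<alpha>..x} = measure M {\<alpha>} + measure M {\<alpha><..x}"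
      using that by (subst finite_measure_Union[symmetric]) (auto simp: ivl_disj_un intro!: arg_cong[where f="measure M"])
    ultimately show ?thesis by (simp add: F_def cdf_def atomless)
  qed
  have contF: "continuous_on {\<alpha>..\<beta>} F"
  proof -
    have "continuous_on {\<alpha>..\<beta>} (\<lambda>x. cdf M x - cdf M \<alpha>)"
      using isCont_cdf atomless by (intro continuous_intros continuous_at_imp_continuous_on) auto
    then show ?thesis using Fcdf by (subst continuous_on_cong[OF refl, of _ _ "\<lambda>x. cdf M x - cdf M \<alpha>"]) auto
  qed
  define M1 where "M1 = distr (density M (indicator {\<alpha>..\<beta>})) borel F"
  define M2 where "M2 = density lborel (indicator {0..L} :: real \<Rightarrow> ennreal)"
  have L0: "0 \<le> L" by (simp add: L_def)
  have e1: "emeasure M1 A = emeasure M {x\<in>{\<alpha>..\<beta>}. F x \<in> A}" if [measurable]: "A \<in> sets borel" for A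
  proof -
    have "emeasure M1 A = emeasure (density M (indicator {\<alpha>..\<beta>})) (F -` A)"
      by (simp add: M1_def emeasure_distr)
    also have "\<dots> = (\<integral>\<^sup>+x. indicator {\<alpha>..\<beta>} x * indicator (F -` A) x \<partial>M)"
      using measurable_sets[of F borel borel A] by (subst emeasure_density) auto
    also have "\<dots> = (\<integral>\<^sup>+x. indicator {x\<in>{\<alpha>..\<beta>}. F x \<in> A} x \<partial>M)"
      by (intro nn_integral_cong) (auto simp: indicator_def)
    also have "\<dots> = emeasure M {x\<in>{\<alpha>..\<beta>}. F x \<in> A}"
    proof (rule nn_integral_indicator)
      have "{x \<in> {\<alpha>..\<beta>}. F x \<in> A} = {x \<in> space borel. x \<in> {\<alpha>..\<beta>} \<and> F x \<in> A}" by auto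
      also have "\<dots> \<in> sets borel" by measurable
      finally show "{x \<in> {\<alpha>..\<beta>}. F x \<in> A} \<in> sets M" by simp
    qed
    finally show ?thesis .
  qed
  have e2: "emeasure M2 A = emeasure lborel ({0..L} \<inter> A)" if [measurable]: "A \<in> sets borel" for A
    by (simp add: M2_def emeasure_density nn_integral_set_ennreal indicator_inter_arith[symmetric])
  have "finite_measure M1" "finite_measure M2"
    using e1[of UNIV] e2[of UNIV] L0 emeasure_lborel_Icc[OF L0] by (auto intro!: finite_measureI simp: M1_def M2_def)
  then have fin: "finite_borel_measure M1" "finite_borel_measure M2"
    by (auto simp: finite_borel_measure_def finite_borel_measure_axioms_def M1_def M2_def)
  have "M1 = M2"
  proof (rule cdf_unique')
    show "finite_borel_measure M1" "finite_borel_measure M2" by (fact fin)+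
    show "cdf M1 = cdf M2"
    proof (rule ext)
      fix s :: real
      have "emeasure M {x\<in>{\<alpha>..\<beta>}. F x \<in> {..s}} = emeasure lborel ({0..L} \<inter> {..s})"
      proof (cases "s < 0")
        case True
        then have "\<not> F x \<le> s" for x using F0[of x] by linarith
        then have 1: "{x\<in>{\<alpha>..\<beta>}. F x \<in> {..s}} = {}" by auto
        have 2: "{0..L} \<inter> {..s} = {}" using True by auto
        show ?thesis unfolding 1 2 by simp
      next
        case s: False
        show ?thesis
        proof (cases "L \<le> s")
          case True
          then have "F x \<le> s" if "x \<le> \<beta>" for x using Fmono[OF that] FL by linarith
          with True have 1: "{x\<in>{\<alpha>..\<beta>}. F x \<in> {..s}} = {\<alpha>..\<beta>}" and 2: "{0..L} \<inter> {..s} = {0..L}"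
            by auto
          show ?thesis unfolding 1 2 using L0 by (simp add: L_def emeasure_eq_measure)
        next
          case False
          \<comment> \<open>\<open>F\<close> may be flat, so the sublevel set is described by its
            largest point; by continuity the mass up to that point is exactly
            \<open>s\<close>.\<close>
          define A where "A = {x\<in>{\<alpha>..\<beta>}. F x \<le> s}"
          obtain x0 where x0: "\<alpha> \<le> x0" "x0 \<le> \<beta>" "F x0 = s"
            using IVT'[of F \<alpha> s \<beta>] F\<alpha> FL s False ab contF by auto
          have "closed A"
            unfolding A_def using continuous_on_closed_Collect_le[OF contF continuous_on_const closed_atLeastAtMost, of s] by simp
          moreover have "bdd_above A" by (auto simp: A_def bdd_above_def)
          moreover have "A \<noteq> {}" using x0 by (auto simp: A_def)
          ultimately have SA: "Sup A \<in> A" by (intro closed_contains_Sup)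
          have "x0 \<le> Sup A" using x0 \<open>bdd_above A\<close> by (intro cSup_upper) (auto simp: A_def)
          then have FS: "F (Sup A) = s" using Fmono[of x0 "Sup A"] x0 SA by (auto simp: A_def)
          have "A = {\<alpha>..Sup A}"
          proof safe
            fix x assume x: "x \<in> A"
            then show "x \<in> {\<alpha>..Sup A}" using \<open>bdd_above A\<close> by (auto intro: cSup_upper simp: A_def)
          next
            fix x assume x: "x \<in> {\<alpha>..Sup A}"
            then show "x \<in> A" using SA Fmono[of x "Sup A"] by (auto simp: A_def)
          qed
          then have "emeasure M A = ennreal s" using FS by (simp add: F_def emeasure_eq_measure)
          moreover have "{0..L} \<inter> {..s} = {0..s}" using False by auto
          ultimately show ?thesis using s by (simp add: A_def)
        qed
      qed
      then show "cdf M1 s = cdf M2 s" using e1[of "{..s}"] e2[of "{..s}"]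
        by (simp add: cdf_def measure_def)
    qed
  qed
  have "(\<integral>\<^sup>+x. G (F x) * indicator {\<alpha>..\<beta>} x \<partial>M) = (\<integral>\<^sup>+u. G u \<partial>M1)"
    unfolding M1_def by (subst nn_integral_distr) (auto simp: nn_integral_density mult.commute)
  also have "\<dots> = (\<integral>\<^sup>+u. G u * indicator {0..L} u \<partial>lborel)"
    unfolding \<open>M1 = M2\<close> M2_def by (subst nn_integral_density) (auto simp: mult.commute)
  finally show ?thesis by (simp add: F_def L_def)
qed

lemma nn_integral_reflect_interval:
  fixes G :: "real \<Rightarrow> ennreal"
  assumes [measurable]: "G \<in> borel_measurable borel"
  shows "(\<integral>\<^sup>+u. G (L - u) * indicator {0..L} u \<partial>lborel) = (\<integral>\<^sup>+u. G u * indicator {0..L} u \<partial>lborel)"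
proof -
  have "(\<integral>\<^sup>+u. G u * indicator {0..L} u \<partial>lborel)
      = ennreal \<bar>-1\<bar> * (\<integral>\<^sup>+u. G (L + (-1) * u) * indicator {0..L} (L + (-1) * u) \<partial>lborel)"
    by (rule nn_integral_real_affine) auto
  also have "\<dots> = (\<integral>\<^sup>+u. G (L - u) * indicator {0..L} u \<partial>lborel)"
    by (auto intro!: nn_integral_cong simp: indicator_def)
  finally show ?thesis by simp
qed

section \<open>Segments of a half circle under a random cut\<close>

locale half_circle_law = isotropic_measure \<kappa> + half_circle y h a d
  for \<kappa> :: "(real^3) set measure" and y h a d
begin

lemma pos_measurable [measurable]: "pos \<in> borel_measurable borel"
  unfolding pos_def by measurable

definition pos_law :: "real measure" where "pos_law = distr normal_law borel pos"

sublocale pos_law: real_distribution pos_law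
  unfolding pos_law_def real_distribution_def real_distribution_axioms_def
  by (intro conjI normal_law.prob_space_distr) auto

lemma AE_inner_a: "AE x in normal_law. x \<bullet> a \<noteq> 0"
  using unit by (intro AE_normal_inner_nonzero) auto

text \<open>An atom in \<open>{-1..1}\<close> would mean that a fixed point of the arc is hit with
  positive probability; values outside are almost surely not taken.\<close>

lemma pos_law_atomless: "measure pos_law {s} = 0"
proof -
  have "AE x in normal_law. pos x \<noteq> s"
  proof (cases "\<bar>s\<bar> \<le> 1")
    case True
    then have "s \<in> (\<bullet>) a ` arc" unfolding image_arc by (auto simp: abs_le_iff)
    then obtain v where v: "v \<in> arc" "s = a \<bullet> v" by auto
    then have "v \<noteq> 0" by (auto simp: arc_def great_circle_def)
    from AE_normal_inner_nonzero[OF this] AE_inner_a show ?thesis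
    proof eventually_elim
      case (elim x)
      then show ?case using hits_arc_iff[of x "{v}"] v by (auto simp: great_circle_def)
    qed
  next
    case False
    from AE_inner_a show ?thesis by eventually_elim (use pos_bounds False in force)
  qed
  then have "emeasure normal_law {x \<in> space normal_law. \<not> pos x \<noteq> s} = 0"
    by (subst AE_iff_measurable[symmetric, OF _ refl]) auto
  moreover have "emeasure pos_law {s} = emeasure normal_law {x \<in> space normal_law. \<not> pos x \<noteq> s}"
    unfolding pos_law_def by (subst emeasure_distr) (auto intro!: arg_cong[where f="emeasure normal_law"])
  ultimately show ?thesis by (simp add: measure_def)
qed

text \<open>The interval may be empty (\<open>\<beta> < \<alpha>\<close>), so that cutting a segment
  always yields segments.\<close>

definition segment :: "(real^3) set \<Rightarrow> bool"
  where "segment p \<longleftrightarrow> p \<subseteq> arc \<and> (\<exists>\<alpha> \<beta>. (\<bullet>) a ` p = {\<alpha>..\<beta>})"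

lemma segment_arc: "segment arc"
  using image_arc by (auto simp: segment_def)

lemma segment_Int_hemisphere:
  assumes "segment p" "x \<bullet> a \<noteq> 0"
  shows "segment (p \<inter> hemisphere b x)"
proof -
  obtain \<alpha> \<beta> where p: "p \<subseteq> arc" "(\<bullet>) a ` p = {\<alpha>..\<beta>}" using assms by (auto simp: segment_def)
  have "(\<bullet>) a ` (p \<inter> hemisphere b x) = (if b \<longleftrightarrow> 0 < x \<bullet> a then {max \<alpha> (pos x)..\<beta>} else {\<alpha>..min \<beta> (pos x)})"
    unfolding image_Int_hemisphere[OF assms(2) p(1)] p(2) by auto
  then show ?thesis using p by (auto simp: segment_def split: if_splits)
qed

lemma len_interval:
  assumes "p \<subseteq> arc" "(\<bullet>) a ` p = {\<alpha>..\<beta>}" and poly: "random_polytope (borel :: (real^3) measure) (\<lambda>_. p)"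
  shows "len p = measure pos_law {\<alpha>..\<beta>}"
proof -
  have "measure normal_law {x. great_circle x \<inter> p \<noteq> {}} = measure normal_law (pos -` {\<alpha>..\<beta>} \<inter> space normal_law)"
  proof (rule normal_law.finite_measure_eq_AE)
    show "AE x in normal_law. (x \<in> {x. great_circle x \<inter> p \<noteq> {}}) = (x \<in> pos -` {\<alpha>..\<beta>} \<inter> space normal_law)"
      using AE_inner_a by eventually_elim (use hits_arc_iff[OF _ assms(1)] assms(2) in auto)
  qed (use hits_set[OF poly] measurable_sets_borel[OF pos_measurable] in auto)
  then show ?thesis by (simp add: len_def pos_law_def measure_distr)
qed

text \<open>A crossing point that misses an interval lies on one side of it.\<close>

lemma segment_not_hit:
  assumes "segment p" "x \<bullet> a \<noteq> 0" "great_circle x \<inter> p = {}"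
  obtains b where "p \<inter> hemisphere b x = p" "p \<inter> hemisphere (\<not> b) x = {}"
proof -
  obtain \<alpha> \<beta> where p: "p \<subseteq> arc" "(\<bullet>) a ` p = {\<alpha>..\<beta>}" using assms by (auto simp: segment_def)
  have nin: "pos x \<notin> {\<alpha>..\<beta>}" using hits_arc_iff[OF assms(2) p(1)] assms(3) p(2) by simp
  have "\<exists>b. p \<inter> hemisphere (\<not> b) x = {}"
  proof (cases "pos x < \<alpha>")
    case True
    then have "(\<bullet>) a ` (p \<inter> hemisphere (\<not> (0 < x \<bullet> a)) x) = {}"
      unfolding image_Int_hemisphere[OF assms(2) p(1)] p(2) by auto
    then show ?thesis by (intro exI[of _ "0 < x \<bullet> a"]) simp
  next
    case False
    then have "(\<bullet>) a ` (p \<inter> hemisphere (\<not> \<not> (0 < x \<bullet> a)) x) = {}"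
      using nin unfolding image_Int_hemisphere[OF assms(2) p(1)] p(2) by auto
    then show ?thesis by (intro exI[of _ "\<not> 0 < x \<bullet> a"]) simp
  qed
  then obtain b where b: "p \<inter> hemisphere (\<not> b) x = {}" by blast
  have "p \<subseteq> hemisphere True x \<union> hemisphere False x"
    using p(1) unfolding hemisphere_Un by (auto simp: arc_def great_circle_def)
  with b have "p \<inter> hemisphere b x = p" by (cases b) auto
  with b that show ?thesis by blast
qed

lemma segment_hit:
  assumes p: "p \<subseteq> arc" "(\<bullet>) a ` p = {\<alpha>..\<beta>}" and poly: "random_polytope (borel :: (real^3) measure) (\<lambda>_. p)"
    and x: "x \<bullet> a \<noteq> 0" "great_circle x \<inter> p \<noteq> {}"
  shows "pos x \<in> {\<alpha>..\<beta>}" "p \<inter> hemisphere b x \<noteq> {}"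
    "len (p \<inter> hemisphere b x) =
      (if b \<longleftrightarrow> 0 < x \<bullet> a then measure pos_law {pos x..\<beta>} else measure pos_law {\<alpha>..pos x})"
proof -
  show q: "pos x \<in> {\<alpha>..\<beta>}" using hits_arc_iff[OF x(1) p(1)] x(2) p(2) by simp
  then have im: "(\<bullet>) a ` (p \<inter> hemisphere b x) = (if b \<longleftrightarrow> 0 < x \<bullet> a then {pos x..\<beta>} else {\<alpha>..pos x})"
    unfolding image_Int_hemisphere[OF x(1) p(1)] p(2) by auto
  then show "p \<inter> hemisphere b x \<noteq> {}" using q by (auto split: if_splits)
  have "random_polytope (borel :: (real^3) measure) (\<lambda>_. p \<inter> hemisphere b x)"
    using poly by (intro random_polytope_hemisphere) auto
  then show "len (p \<inter> hemisphere b x) =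
      (if b \<longleftrightarrow> 0 < x \<bullet> a then measure pos_law {pos x..\<beta>} else measure pos_law {\<alpha>..pos x})"
    using im p(1) by (auto intro!: len_interval split: if_splits)
qed

text \<open>The two pieces share only the crossing point, which has mass zero.\<close>

lemma len_split:
  assumes "segment p" "random_polytope (borel :: (real^3) measure) (\<lambda>_. p)" "x \<bullet> a \<noteq> 0"
  shows "len (p \<inter> hemisphere True x) + len (p \<inter> hemisphere False x) = len p"
proof (cases "great_circle x \<inter> p = {}")
  case True
  from segment_not_hit[OF assms(1,3) True] obtain b where
    "p \<inter> hemisphere b x = p" "p \<inter> hemisphere (\<not> b) x = {}" .
  then show ?thesis by (cases b) auto
next
  case False
  obtain \<alpha> \<beta> where p: "p \<subseteq> arc" "(\<bullet>) a ` p = {\<alpha>..\<beta>}" using assms by (auto simp: segment_def)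
  note h = segment_hit[OF p assms(2,3) False]
  have "measure pos_law {\<alpha>..\<beta>} = measure pos_law {\<alpha>..pos x} + measure pos_law {pos x<..\<beta>}"
    using h(1) by (subst pos_law.finite_measure_Union[symmetric]) (auto intro!: arg_cong[where f="measure pos_law"])
  moreover have "measure pos_law {pos x..\<beta>} = measure pos_law {pos x} + measure pos_law {pos x<..\<beta>}"
    using h(1) by (subst pos_law.finite_measure_Union[symmetric]) (auto intro!: arg_cong[where f="measure pos_law"])
  ultimately show ?thesis
    using h(3)[of True] h(3)[of False] len_interval[OF p assms(2)] pos_law_atomless by auto
qed

text \<open>The integral transform turns the length of the piece before the crossing point into
  Lebesgue measure on \<open>{0..len p}\<close>, and reflection gives the same for the other piece;
  hence the factor 2.\<close>

lemma nn_integral_segment_hit: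
  assumes "segment p" and poly: "random_polytope (borel :: (real^3) measure) (\<lambda>_. p)" and "p \<noteq> {}"
    and [measurable]: "G \<in> borel_measurable borel"
  shows "(\<integral>\<^sup>+x. (\<Sum>b\<in>UNIV. G (len (p \<inter> hemisphere b x))) * indicator {x. great_circle x \<inter> p \<noteq> {}} x \<partial>normal_law)
    = 2 * (\<integral>\<^sup>+u. G u * indicator {0..len p} u \<partial>lborel)"
proof -
  obtain \<alpha> \<beta> where p: "p \<subseteq> arc" "(\<bullet>) a ` p = {\<alpha>..\<beta>}" using assms by (auto simp: segment_def)
  then have ab: "\<alpha> \<le> \<beta>" using assms(3) by auto
  define \<mu> where "\<mu> = measure pos_law"
  have L: "len p = \<mu> {\<alpha>..\<beta>}" using len_interval[OF p poly] by (simp add: \<mu>_def)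
  have m1: "mono (\<lambda>q. \<mu> {\<alpha>..q})" unfolding \<mu>_def by (intro monoI pos_law.finite_measure_mono) auto
  have m2: "mono (\<lambda>q. - \<mu> {q..\<beta>})" unfolding \<mu>_def by (intro monoI le_imp_neg_le pos_law.finite_measure_mono) auto
  have [measurable]: "(\<lambda>q. \<mu> {\<alpha>..q}) \<in> borel_measurable borel" using borel_measurable_mono[OF m1] .
  have [measurable]: "(\<lambda>q. \<mu> {q..\<beta>}) \<in> borel_measurable borel" using borel_measurable_uminus[OF borel_measurable_mono[OF m2]] by simp
  have "(\<integral>\<^sup>+x. (\<Sum>b\<in>UNIV. G (len (p \<inter> hemisphere b x))) * indicator {x. great_circle x \<inter> p \<noteq> {}} x \<partial>normal_law)
    = (\<integral>\<^sup>+x. (G (\<mu> {\<alpha>..pos x}) + G (\<mu> {pos x..\<beta>})) * indicator {\<alpha>..\<beta>} (pos x) \<partial>normal_law)"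
  proof (rule nn_integral_cong_AE)
    show "AE x in normal_law. (\<Sum>b\<in>UNIV. G (len (p \<inter> hemisphere b x))) * indicator {x. great_circle x \<inter> p \<noteq> {}} x
      = (G (\<mu> {\<alpha>..pos x}) + G (\<mu> {pos x..\<beta>})) * indicator {\<alpha>..\<beta>} (pos x)"
      using AE_inner_a
    proof eventually_elim
      case (elim x)
      show ?case
      proof (cases "great_circle x \<inter> p = {}")
        case True
        then have "pos x \<notin> {\<alpha>..\<beta>}" using hits_arc_iff[OF elim p(1)] p(2) by simp
        with True show ?thesis by simp
      next
        case False
        note h = segment_hit[OF p poly elim False]
        show ?thesis using h(1) h(3)[of True] h(3)[of False] False by (auto simp: UNIV_bool \<mu>_def add.commute)
      qed
    qed
  qed
  also have "\<dots> = (\<integral>\<^sup>+q. (G (\<mu> {\<alpha>..q}) + G (\<mu> {q..\<beta>})) * indicator {\<alpha>..\<beta>} q \<partial>pos_law)"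
    unfolding pos_law_def by (subst nn_integral_distr) auto
  also have "\<dots> = (\<integral>\<^sup>+q. G (\<mu> {\<alpha>..q}) * indicator {\<alpha>..\<beta>} q \<partial>pos_law) + (\<integral>\<^sup>+q. G (\<mu> {q..\<beta>}) * indicator {\<alpha>..\<beta>} q \<partial>pos_law)"
    by (subst nn_integral_add[symmetric]) (auto simp: distrib_right)
  also have "(\<integral>\<^sup>+q. G (\<mu> {q..\<beta>}) * indicator {\<alpha>..\<beta>} q \<partial>pos_law) = (\<integral>\<^sup>+q. G (len p - \<mu> {\<alpha>..q}) * indicator {\<alpha>..\<beta>} q \<partial>pos_law)"
  proof (rule nn_integral_cong)
    fix q
    show "G (\<mu> {q..\<beta>}) * indicator {\<alpha>..\<beta>} q = G (len p - \<mu> {\<alpha>..q}) * indicator {\<alpha>..\<beta>} q"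
    proof (cases "q \<in> {\<alpha>..\<beta>}")
      case True
      have "\<mu> {\<alpha>..\<beta>} = \<mu> {\<alpha>..q} + \<mu> {q<..\<beta>}" unfolding \<mu>_def
        using True by (subst pos_law.finite_measure_Union[symmetric]) (auto intro!: arg_cong[where f="measure pos_law"])
      moreover have "\<mu> {q..\<beta>} = \<mu> {q} + \<mu> {q<..\<beta>}" unfolding \<mu>_def
        using True by (subst pos_law.finite_measure_Union[symmetric]) (auto intro!: arg_cong[where f="measure pos_law"])
      ultimately show ?thesis by (simp add: L) (simp add: \<mu>_def pos_law_atomless)
    qed simp
  qed
  also have "\<dots> = (\<integral>\<^sup>+u. G (len p - u) * indicator {0..len p} u \<partial>lborel)"
    using pos_law.nn_integral_interval_mass[OF pos_law_atomless ab, of "\<lambda>u. G (len p - u)"] by (simp add: L \<mu>_def)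
  also have "(\<integral>\<^sup>+q. G (\<mu> {\<alpha>..q}) * indicator {\<alpha>..\<beta>} q \<partial>pos_law) = (\<integral>\<^sup>+u. G u * indicator {0..len p} u \<partial>lborel)"
    using pos_law.nn_integral_interval_mass[OF pos_law_atomless ab, of G] by (simp add: L \<mu>_def)
  finally show ?thesis by (simp add: nn_integral_reflect_interval mult_2)
qed

lemma len_arc: "len arc = 1"
proof -
  have "AE x in normal_law. x \<in> {x. great_circle x \<inter> arc \<noteq> {}}"
    using AE_inner_a
  proof eventually_elim
    case (elim x)
    then show ?case using hits_arc_iff[OF elim order_refl] pos_bounds[OF elim] by (auto simp: image_arc)
  qed
  moreover have "random_polytope (borel :: (real^3) measure) (\<lambda>_. arc)"
  proof -
    have "arc = sphere2 \<inter> great_circle y \<inter> hemisphere True h" by (auto simp: arc_def great_circle_def)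
    then show ?thesis by (simp add: random_polytope_hemisphere random_polytope_great_circle del: Int_iff)
  qed
  ultimately show ?thesis unfolding len_def using hits_set by (simp add: normal_law.prob_eq_1)
qed

end

text \<open>Uniqueness of measures on an intersection-stable generator extends the conditional law
  of \<open>Y\<close> from rectangles to all jointly measurable integrands. \<open>U\<close> and
  \<open>V\<close> hold the factors of the other nodes before and after they are integrated out, so
  that one mark can be exchanged at a time.\<close>

lemma nn_integral_extend_rectangles:
  fixes G :: "'a measure" and Y :: "'a \<Rightarrow> real \<times> (real^3)" and L :: "(real \<times> (real^3)) measure"
  assumes sub: "subalgebra M G" and Y [measurable]: "Y \<in> measurable M (borel \<Otimes>\<^sub>M borel)"
    and sf: "sigma_finite_measure L" and setsL [measurable_cong]: "sets L = sets (borel \<Otimes>\<^sub>M borel)"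
    and q: "(\<lambda>(\<omega>, y). q \<omega> y) \<in> borel_measurable (G \<Otimes>\<^sub>M (borel \<Otimes>\<^sub>M borel))"
    and U [measurable]: "U \<in> borel_measurable M" and V [measurable]: "V \<in> borel_measurable M"
    and finite: "(\<integral>\<^sup>+\<omega>. U \<omega> \<partial>M) \<noteq> \<infinity>"
    and rect: "\<And>A B D. A \<in> sets G \<Longrightarrow> B \<in> sets borel \<Longrightarrow> D \<in> sets borel \<Longrightarrow>
      (\<integral>\<^sup>+\<omega>. indicator A \<omega> * U \<omega> * indicator (B \<times> D) (Y \<omega>) \<partial>M) =
      (\<integral>\<^sup>+\<omega>. indicator A \<omega> * V \<omega> * (\<integral>\<^sup>+y. q \<omega> y * indicator (B \<times> D) y \<partial>L) \<partial>M)"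
    and g: "(\<lambda>(\<omega>, y). g \<omega> y) \<in> borel_measurable (G \<Otimes>\<^sub>M (borel \<Otimes>\<^sub>M borel))"
  shows "(\<integral>\<^sup>+\<omega>. U \<omega> * g \<omega> (Y \<omega>) \<partial>M) = (\<integral>\<^sup>+\<omega>. V \<omega> * (\<integral>\<^sup>+y. q \<omega> y * g \<omega> y \<partial>L) \<partial>M)"
proof -
  interpret L: sigma_finite_measure L by (rule sf)
  define P where "P = (borel \<Otimes>\<^sub>M borel :: (real \<times> (real^3)) measure)"
  have space: "space G = space M" and GM: "sets G \<subseteq> sets M" using sub by (auto simp: subalgebra_def)
  have idG [measurable]: "(\<lambda>x. x) \<in> measurable M G"
    using measurable_from_subalg[OF sub measurable_ident] by (simp add: id_def)
  have [measurable]: "(\<lambda>z. z) \<in> measurable (M \<Otimes>\<^sub>M L) (G \<Otimes>\<^sub>M P)"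
  proof -
    have "(\<lambda>z. (fst z, snd z)) \<in> measurable (M \<Otimes>\<^sub>M L) (G \<Otimes>\<^sub>M P)"
      unfolding P_def by (intro measurable_Pair measurable_compose[OF measurable_fst idG]) measurable
    then show ?thesis by simp
  qed
  have qG [measurable]: "(\<lambda>z. q (fst z) (snd z)) \<in> borel_measurable (G \<Otimes>\<^sub>M P)"
    and gG [measurable]: "(\<lambda>z. g (fst z) (snd z)) \<in> borel_measurable (G \<Otimes>\<^sub>M P)"
    using q g by (simp_all add: case_prod_unfold P_def)
  have qM [measurable]: "(\<lambda>z. q (fst z) (snd z)) \<in> borel_measurable (M \<Otimes>\<^sub>M L)"
    by (rule measurable_compose[OF _ qG]) measurable
  have gM [measurable]: "(\<lambda>z. g (fst z) (snd z)) \<in> borel_measurable (M \<Otimes>\<^sub>M L)"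
    by (rule measurable_compose[OF _ gG]) measurable
  have YP [measurable]: "(\<lambda>\<omega>. (\<omega>, Y \<omega>)) \<in> measurable M (G \<Otimes>\<^sub>M P)"
    unfolding P_def by measurable
  define M1 where "M1 = distr (density M U) (G \<Otimes>\<^sub>M P) (\<lambda>\<omega>. (\<omega>, Y \<omega>))"
  define M2 where "M2 = distr (density (M \<Otimes>\<^sub>M L) (\<lambda>z. V (fst z) * q (fst z) (snd z))) (G \<Otimes>\<^sub>M P) (\<lambda>z. z)"
  have i1: "(\<integral>\<^sup>+z. f z \<partial>M1) = (\<integral>\<^sup>+\<omega>. U \<omega> * f (\<omega>, Y \<omega>) \<partial>M)" if [measurable]: "f \<in> borel_measurable (G \<Otimes>\<^sub>M P)" for f
    unfolding M1_def by (subst nn_integral_distr) (auto simp: nn_integral_density)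
  have i2: "(\<integral>\<^sup>+z. f z \<partial>M2) = (\<integral>\<^sup>+\<omega>. V \<omega> * (\<integral>\<^sup>+y. q \<omega> y * f (\<omega>, y) \<partial>L) \<partial>M)" if f [measurable]: "f \<in> borel_measurable (G \<Otimes>\<^sub>M P)" for f
  proof -
    have fM [measurable]: "f \<in> borel_measurable (M \<Otimes>\<^sub>M L)"
      using measurable_compose[OF _ f, of "\<lambda>z. z" "M \<Otimes>\<^sub>M L"] by simp
    have "(\<integral>\<^sup>+z. f z \<partial>M2) = (\<integral>\<^sup>+z. V (fst z) * q (fst z) (snd z) * f z \<partial>(M \<Otimes>\<^sub>M L))"
      unfolding M2_def by (subst nn_integral_distr) (auto simp: nn_integral_density)
    also have "\<dots> = (\<integral>\<^sup>+\<omega>. \<integral>\<^sup>+y. V \<omega> * q \<omega> y * f (\<omega>, y) \<partial>L \<partial>M)"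
      by (subst L.nn_integral_fst[symmetric]) auto
    also have "\<dots> = (\<integral>\<^sup>+\<omega>. V \<omega> * (\<integral>\<^sup>+y. q \<omega> y * f (\<omega>, y) \<partial>L) \<partial>M)"
    proof (rule nn_integral_cong)
      fix \<omega> assume [measurable]: "\<omega> \<in> space M"
      have [measurable]: "(\<lambda>y. (\<omega>, y)) \<in> measurable L (M \<Otimes>\<^sub>M L)" by measurable
      have "(\<lambda>y. q \<omega> y * f (\<omega>, y)) \<in> borel_measurable L"
        using measurable_compose[OF \<open>(\<lambda>y. (\<omega>, y)) \<in> _\<close>, of "\<lambda>z. q (fst z) (snd z) * f z" borel] by simp
      then show "(\<integral>\<^sup>+y. V \<omega> * q \<omega> y * f (\<omega>, y) \<partial>L) = V \<omega> * (\<integral>\<^sup>+y. q \<omega> y * f (\<omega>, y) \<partial>L)"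
        by (simp add: mult.assoc nn_integral_cmult)
    qed
    finally show ?thesis .
  qed
  let ?R = "{B \<times> D | B D. B \<in> sets (borel :: real measure) \<and> D \<in> sets (borel :: (real^3) measure)}"
  let ?E = "{A \<times> R | A R. A \<in> sets G \<and> R \<in> ?R}"
  have setsP: "sets P = sigma_sets (space P) ?R"
    unfolding P_def by (simp add: sets_pair_measure space_pair_measure)
  have "sets (G \<Otimes>\<^sub>M P) = sets (sigma (space G \<times> space P) ?E)"
  proof (rule sets_pair_eq)
    show "sets G \<subseteq> Pow (space G)" by (rule sets.space_closed)
    show "sets G = sigma_sets (space G) (sets G)" by (simp add: sets.sigma_sets_eq)
    show "countable {space G}" "{space G} \<subseteq> sets G" "\<Union>{space G} = space G" by auto
    show "?R \<subseteq> Pow (space P)" by (auto simp: P_def space_pair_measure)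
    show "sets P = sigma_sets (space P) ?R" by (rule setsP)
    show "countable {space P}" "\<Union>{space P} = space P" by auto
    show "{space P} \<subseteq> ?R" by (auto simp: P_def space_pair_measure intro!: exI[of _ UNIV])
  qed
  also have "\<dots> = sigma_sets (space G \<times> space P) ?E"
    by (rule sets_measure_of) (use sets.sets_into_space in \<open>fastforce simp: P_def space_pair_measure\<close>)
  finally have gen: "sets (G \<Otimes>\<^sub>M P) = sigma_sets (space G \<times> space P) ?E" .
  have "M1 = M2"
  proof (rule measure_eqI_generator_eq)
    show "Int_stable ?E"
    proof (rule Int_stableI)
      fix a b assume "a \<in> ?E" "b \<in> ?E"
      then obtain A B D A' B' D' where *: "a = A \<times> (B \<times> D)" "b = A' \<times> (B' \<times> D')"
        "A \<in> sets G" "A' \<in> sets G" "B \<in> sets borel" "B' \<in> sets borel" "D \<in> sets borel" "D' \<in> sets borel" by auto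
      have "a \<inter> b = (A \<inter> A') \<times> ((B \<inter> B') \<times> (D \<inter> D'))" using * by auto
      then show "a \<inter> b \<in> ?E" using * by blast
    qed
    show "?E \<subseteq> Pow (space G \<times> space P)"
      using sets.sets_into_space by (fastforce simp: P_def space_pair_measure)
    show "sets M1 = sigma_sets (space G \<times> space P) ?E" "sets M2 = sigma_sets (space G \<times> space P) ?E"
      using gen by (simp_all add: M1_def M2_def)
    show "range (\<lambda>_::nat. space G \<times> space P) \<subseteq> ?E"
    proof -
      have "space P = UNIV \<times> UNIV" by (simp add: P_def space_pair_measure)
      then have "space G \<times> space P \<in> ?E"
        by (intro CollectI exI[of _ "space G"] exI[of _ "space P"]) (auto intro!: exI[of _ UNIV])
      then show ?thesis by (simp only: image_constant_conv) simp
    qed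
    show "(\<Union>i::nat. space G \<times> space P) = space G \<times> space P" by simp
    show "emeasure M1 (space G \<times> space P) \<noteq> \<infinity>"
    proof -
      have "emeasure M1 (space G \<times> space P) = (\<integral>\<^sup>+z. 1 \<partial>M1)" by (simp add: M1_def space_pair_measure)
      also have "\<dots> = (\<integral>\<^sup>+\<omega>. U \<omega> \<partial>M)" by (subst i1) auto
      finally show ?thesis using finite by simp
    qed
    fix X assume "X \<in> ?E"
    then obtain A B D where X: "X = A \<times> (B \<times> D)" "A \<in> sets G" "B \<in> sets borel" "D \<in> sets borel" by auto
    have XG [measurable]: "X \<in> sets (G \<Otimes>\<^sub>M P)" using X by (auto simp: P_def)
    have "emeasure M1 X = (\<integral>\<^sup>+z. indicator X z \<partial>M1)" using XG by (simp add: M1_def)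
    also have "\<dots> = (\<integral>\<^sup>+\<omega>. indicator A \<omega> * U \<omega> * indicator (B \<times> D) (Y \<omega>) \<partial>M)"
      by (subst i1, measurable) (auto intro!: nn_integral_cong simp: X indicator_def)
    also have "\<dots> = (\<integral>\<^sup>+\<omega>. indicator A \<omega> * V \<omega> * (\<integral>\<^sup>+y. q \<omega> y * indicator (B \<times> D) y \<partial>L) \<partial>M)"
      by (rule rect) (use X in auto)
    also have "\<dots> = (\<integral>\<^sup>+\<omega>. V \<omega> * (\<integral>\<^sup>+y. q \<omega> y * indicator X (\<omega>, y) \<partial>L) \<partial>M)"
      by (rule nn_integral_cong) (auto simp: X indicator_def intro!: arg_cong2[where f="(*)"] nn_integral_cong)
    also have "\<dots> = emeasure M2 X" by (subst i2[symmetric]) (use XG in \<open>auto simp: M2_def\<close>)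
    finally show "emeasure M1 X = emeasure M2 X" .
  qed
  then have "(\<integral>\<^sup>+z. g (fst z) (snd z) \<partial>M1) = (\<integral>\<^sup>+z. g (fst z) (snd z) \<partial>M2)" by simp
  then show ?thesis by (simp add: i1 i2)
qed

section \<open>The law of one generation\<close>

lemma finite_words: "finite {w :: bool list. length w = k}"
  using finite_lists_length_eq[of "UNIV :: bool set" k] by simp

lemma split_time_eq_birth_time: "split_time s w = birth_time s (b # w)"
  by (simp add: split_time_def)

lemma nn_integral_exponential_tail:
  assumes "0 < \<Lambda>"
  shows "(\<integral>\<^sup>+T. ennreal (exp (- (\<Lambda> * T))) * indicator {0..} T \<partial>lborel) = ennreal (1 / \<Lambda>)"
proof -
  have "filterlim (\<lambda>T. \<Lambda> * T) at_top at_top"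
    by (rule filterlim_tendsto_pos_mult_at_top[OF tendsto_const assms filterlim_ident])
  then have "filterlim (\<lambda>T. - (\<Lambda> * T)) at_bot at_top"
    by (simp add: filterlim_uminus_at_top)
  from tendsto_divide[OF tendsto_minus[OF filterlim_compose[OF exp_at_bot this]] tendsto_const[of \<Lambda>]] assms
  have "((\<lambda>T. - exp (- (\<Lambda> * T)) / \<Lambda>) \<longlongrightarrow> 0) at_top" by simp
  then have "(\<integral>\<^sup>+T. ennreal (exp (- (\<Lambda> * T))) * indicator {0..} T \<partial>lborel) = ennreal (0 - (- exp (- (\<Lambda> * 0)) / \<Lambda>))"
    using assms by (intro nn_integral_FTC_atLeast) (auto intro!: derivative_eq_intros)
  then show ?thesis by simp
qed

context splitting_process
begin

abbreviation past :: "nat \<Rightarrow> 'a measure" where "past k \<equiv> history \<Omega> \<tau> N k"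

abbreviation C :: "bool list \<Rightarrow> 'a \<Rightarrow> (real^3) set" where "C w \<omega> \<equiv> cell (\<lambda>v. N v \<omega>) w"

abbreviation birth :: "bool list \<Rightarrow> 'a \<Rightarrow> real" where "birth w \<omega> \<equiv> birth_time (\<lambda>v. \<tau> v \<omega>) w"

abbreviation split :: "bool list \<Rightarrow> 'a \<Rightarrow> real" where "split w \<omega> \<equiv> split_time (\<lambda>v. \<tau> v \<omega>) w"

text \<open>The law of the process determines the splitting circle but not which of its two normals
  occurs, so the mark keeps only the representative.\<close>

definition mark :: "bool list \<Rightarrow> 'a \<Rightarrow> real \<times> (real^3)"
  where "mark w \<omega> = (\<tau> w \<omega>, representative (N w \<omega>))"

text \<open>The density with respect to \<open>base\<close> of lifetime and normal given the past.
  The rate \<Lambda> in the exponential density cancels the normalisation 1 / \<Lambda> of the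
  restricted circle law.\<close>

definition mark_density :: "bool list \<Rightarrow> 'a \<Rightarrow> real \<times> (real^3) \<Rightarrow> ennreal"
  where "mark_density w \<omega> = (\<lambda>(T, x).
    ennreal (exp (- len (C w \<omega>) * T)) * indicator {0..} T * indicator {x. great_circle x \<inter> C w \<omega> \<noteq> {}} x)"

definition base :: "(real \<times> (real^3)) measure" where "base = lborel \<Otimes>\<^sub>M normal_law"

lemma sets_base [simp, measurable_cong]: "sets base = sets (borel \<Otimes>\<^sub>M borel)"
  unfolding base_def by (rule sets_pair_measure_cong[OF sets_lborel sets_normal_law])

lemma sigma_finite_base: "sigma_finite_measure base"
proof -
  interpret pair_sigma_finite lborel normal_law ..
  show ?thesis unfolding base_def by unfold_locales
qed

sublocale base: sigma_finite_measure base by (rule sigma_finite_base)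

lemma measurable_mark [measurable]: "mark w \<in> measurable \<Omega> (borel \<Otimes>\<^sub>M borel)"
  using lifetime_measurable normal_measurable unfolding mark_def by measurable

lemma space_past [simp]: "space (past k) = space \<Omega>"
  by (simp add: history_def)

lemma subalgebra_past: "subalgebra \<Omega> (past k)"
  unfolding subalgebra_def
proof
  show "sets (past k) \<subseteq> sets \<Omega>" unfolding history_def
  proof (rule sets_image_in_sets)
    have "(\<lambda>\<omega>. (\<tau> v \<omega>, N v \<omega>)) \<in> borel_measurable \<Omega>" for v
      using lifetime_measurable normal_measurable by (intro borel_measurable_Pair) 
    then show "(\<lambda>\<omega>. \<lambda>v\<in>{v. length v < k}. (\<tau> v \<omega>, N v \<omega>)) \<in> measurable \<Omega> (\<Pi>\<^sub>M v\<in>{v. length v < k}. borel)"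
      by (intro measurable_restrict)
  qed simp
qed simp

lemma past_pair_measurable: "length v < k \<Longrightarrow> (\<lambda>\<omega>. (\<tau> v \<omega>, N v \<omega>)) \<in> borel_measurable (past k)"
proof -
  assume v: "length v < k"
  have "(\<lambda>\<omega>. \<lambda>v\<in>{v. length v < k}. (\<tau> v \<omega>, N v \<omega>)) \<in> measurable (past k) (\<Pi>\<^sub>M v\<in>{v. length v < k}. borel)"
    unfolding history_def by (rule measurable_vimage_algebra1) (auto simp: space_PiM)
  from measurable_compose[OF this measurable_component_singleton[of v]] v show ?thesis by simp
qed

lemma past_lifetime: "length v < k \<Longrightarrow> \<tau> v \<in> borel_measurable (past k)"
  using measurable_compose[OF past_pair_measurable borel_measurable_continuous_onI[OF continuous_on_fst[OF continuous_on_id]]]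
  by simp

lemma past_normal: "length v < k \<Longrightarrow> N v \<in> borel_measurable (past k)"
  using measurable_compose[OF past_pair_measurable borel_measurable_continuous_onI[OF continuous_on_snd[OF continuous_on_id]]]
  by simp

lemma past_cell: "length w \<le> k \<Longrightarrow> random_polytope (past k) (C w)"
  by (induction w) (auto intro!: random_polytope_hemisphere past_normal)

lemma past_birth: "length w \<le> k \<Longrightarrow> birth w \<in> borel_measurable (past k)"
  by (induction w) (auto intro!: borel_measurable_add past_lifetime)

lemma past_split: "length w < k \<Longrightarrow> split w \<in> borel_measurable (past k)"
  unfolding split_time_def by (intro borel_measurable_add past_lifetime past_birth) auto

lemma past_len: "length w \<le> k \<Longrightarrow> (\<lambda>\<omega>. len (C w \<omega>)) \<in> borel_measurable (past k)"
  by (rule len_measurable[OF past_cell])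

lemma const_cell: "\<omega> \<in> space \<Omega> \<Longrightarrow> random_polytope M (\<lambda>_. C w \<omega>)"
  using random_polytope_const[OF past_cell[OF order_refl, of w], of \<omega>] by simp

lemma measurable_past: "f \<in> measurable (past k) M \<Longrightarrow> f \<in> measurable \<Omega> M"
  by (rule measurable_from_subalg[OF subalgebra_past])

lemma mark_density_measurable:
  assumes "length w \<le> k"
  shows "(\<lambda>(\<omega>, y). mark_density w \<omega> y) \<in> borel_measurable (past k \<Otimes>\<^sub>M (borel \<Otimes>\<^sub>M borel))"
proof -
  note [measurable] = past_len[OF assms]
  have [measurable]: "Measurable.pred (past k \<Otimes>\<^sub>M (borel \<Otimes>\<^sub>M borel)) (\<lambda>z. great_circle (snd (snd z)) \<inter> C w (fst z) \<noteq> {})"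
    by (intro random_polytope_hits random_polytope_compose[OF past_cell[OF assms]]) measurable
  have "(\<lambda>z. ennreal (exp (- len (C w (fst z)) * fst (snd z))) * indicator {0..} (fst (snd z)) *
      indicator {z \<in> space (past k \<Otimes>\<^sub>M (borel \<Otimes>\<^sub>M borel)). great_circle (snd (snd z)) \<inter> C w (fst z) \<noteq> {}} z)
    \<in> borel_measurable (past k \<Otimes>\<^sub>M (borel \<Otimes>\<^sub>M borel))" by measurable
  also have "?this \<longleftrightarrow> ?thesis"
    by (rule measurable_cong) (simp add: mark_density_def case_prod_unfold indicator_def)
  finally show ?thesis .
qed

lemma mark_density_measurable_section:
  assumes "\<omega> \<in> space \<Omega>"
  shows "mark_density w \<omega> \<in> borel_measurable (borel \<Otimes>\<^sub>M borel)"
proof -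
  have "(\<lambda>y. (\<omega>, y)) \<in> measurable (borel \<Otimes>\<^sub>M borel) (past (length w) \<Otimes>\<^sub>M (borel \<Otimes>\<^sub>M borel))"
    by (rule measurable_Pair1') (use assms in simp)
  from measurable_compose[OF this mark_density_measurable[OF order_refl]] show ?thesis by simp
qed

lemma nn_integral_mark_density:
  assumes \<omega>: "\<omega> \<in> space \<Omega>" and g [measurable]: "g \<in> borel_measurable (borel \<Otimes>\<^sub>M borel)"
  shows "(\<integral>\<^sup>+y. mark_density w \<omega> y * g y \<partial>base) =
    (\<integral>\<^sup>+T. ennreal (exp (- len (C w \<omega>) * T)) * indicator {0..} T *
      (\<integral>\<^sup>+x. indicator {x. great_circle x \<inter> C w \<omega> \<noteq> {}} x * g (T, x) \<partial>normal_law) \<partial>lborel)"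
proof -
  note [measurable] = mark_density_measurable_section[OF \<omega>] hits_set[OF const_cell[OF \<omega>]]
  have "(\<integral>\<^sup>+y. mark_density w \<omega> y * g y \<partial>base) =
    (\<integral>\<^sup>+T. \<integral>\<^sup>+x. mark_density w \<omega> (T, x) * g (T, x) \<partial>normal_law \<partial>lborel)"
    unfolding base_def by (subst normal_law.nn_integral_fst[symmetric]) auto
  also have "\<dots> = (\<integral>\<^sup>+T. ennreal (exp (- len (C w \<omega>) * T)) * indicator {0..} T *
      (\<integral>\<^sup>+x. indicator {x. great_circle x \<inter> C w \<omega> \<noteq> {}} x * g (T, x) \<partial>normal_law) \<partial>lborel)"
    by (rule nn_integral_cong, subst nn_integral_cmult[symmetric])
      (auto simp: mark_density_def mult.assoc)
  finally show ?thesis .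
qed

text \<open>A cell of rate zero gets total mass 0 instead of 1. This defect is what later rules such
  cells out (\<open>AE_len_pos\<close>).\<close>

lemma mark_density_total:
  assumes \<omega>: "\<omega> \<in> space \<Omega>"
  shows "(\<integral>\<^sup>+y. mark_density w \<omega> y \<partial>base) = (if len (C w \<omega>) = 0 then 0 else 1)"
proof -
  have "(\<integral>\<^sup>+y. mark_density w \<omega> y \<partial>base) = (\<integral>\<^sup>+T. ennreal (exp (- len (C w \<omega>) * T)) * indicator {0..} T * ennreal (len (C w \<omega>)) \<partial>lborel)"
    using nn_integral_mark_density[OF \<omega>, of "\<lambda>_. 1" w] hits_set[OF const_cell[OF \<omega>]]
    by (simp add: emeasure_hits)
  also have "\<dots> = (\<integral>\<^sup>+T. ennreal (exp (- len (C w \<omega>) * T)) * indicator {0..} T \<partial>lborel) * ennreal (len (C w \<omega>))"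
    by (rule nn_integral_multc) measurable
  also have "\<dots> = (if len (C w \<omega>) = 0 then 0 else 1)"
  proof (cases "len (C w \<omega>) = 0")
    case False
    then have "0 < len (C w \<omega>)" using len_nonneg[of "C w \<omega>"] by (simp only: less_le) simp
    from nn_integral_exponential_tail[OF this] this show ?thesis by (simp add: ennreal_mult[symmetric])
  qed simp
  finally show ?thesis .
qed

lemma mark_density_le_1:
  assumes \<omega>: "\<omega> \<in> space \<Omega>" and "\<And>y. g y \<le> 1"
  shows "(\<integral>\<^sup>+y. mark_density w \<omega> y * g y \<partial>base) \<le> 1"
proof -
  have "(\<integral>\<^sup>+y. mark_density w \<omega> y * g y \<partial>base) \<le> (\<integral>\<^sup>+y. mark_density w \<omega> y \<partial>base)"
    by (intro nn_integral_mono) (use assms(2) mult_left_mono[of "g _" 1] in auto)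
  then show ?thesis using mark_density_total[OF \<omega>, of w] by (auto split: if_splits)
qed

text \<open>Links \<open>mark_density\<close> to the factors appearing in
  \<open>conditional_law\<close>.\<close>

lemma mark_density_rectangle:
  assumes \<omega>: "\<omega> \<in> space \<Omega>" and [measurable]: "B \<in> sets borel" "D \<in> sets borel"
  shows "(\<integral>\<^sup>+y. mark_density w \<omega> y * indicator (B \<times> D) y \<partial>base) =
    ennreal (let H = hitting (C w \<omega>)
       in measure (density lborel (exponential_density (measure \<kappa> H))) B
          * (measure \<kappa> ((pole -` D \<inter> great_circles) \<inter> H) / measure \<kappa> H))"
proof -
  define \<Lambda> where "\<Lambda> = len (C w \<omega>)"
  define \<delta> where "\<delta> = measure normal_law (D \<inter> {x. great_circle x \<inter> C w \<omega> \<noteq> {}})"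
  note [measurable] = hits_set[OF const_cell[OF \<omega>]]
  have \<delta>: "measure \<kappa> ((pole -` D \<inter> great_circles) \<inter> hitting (C w \<omega>)) = \<delta>"
    using emeasure_kappa_hitting[OF const_cell[OF \<omega>]] by (simp add: measure_def \<delta>_def)
  have \<Lambda>: "measure \<kappa> (hitting (C w \<omega>)) = \<Lambda>"
    using measure_hitting[OF const_cell[OF \<omega>]] by (simp add: \<Lambda>_def)
  have le: "\<delta> \<le> \<Lambda>" unfolding \<delta>_def \<Lambda>_def len_def by (intro normal_law.finite_measure_mono) auto
  have \<delta>0: "0 \<le> \<delta>" by (simp add: \<delta>_def)
  have "(\<integral>\<^sup>+y. mark_density w \<omega> y * indicator (B \<times> D) y \<partial>base) =
    (\<integral>\<^sup>+T. ennreal (exp (- \<Lambda> * T)) * indicator {0..} T * (indicator B T * ennreal \<delta>) \<partial>lborel)"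
  proof (subst nn_integral_mark_density[OF \<omega>])
    have "(\<integral>\<^sup>+x. indicator {x. great_circle x \<inter> C w \<omega> \<noteq> {}} x * indicator (B \<times> D) (T, x) \<partial>normal_law)
      = (\<integral>\<^sup>+x. indicator B T * indicator (D \<inter> {x. great_circle x \<inter> C w \<omega> \<noteq> {}}) x \<partial>normal_law)" for T
      by (intro nn_integral_cong) (auto simp: indicator_def)
    also have "\<dots> T = indicator B T * ennreal \<delta>" for T
      by (subst nn_integral_cmult) (auto simp: \<delta>_def normal_law.emeasure_eq_measure)
    finally show "(\<integral>\<^sup>+T. ennreal (exp (- len (C w \<omega>) * T)) * indicator {0..} T *
         (\<integral>\<^sup>+x. indicator {x. great_circle x \<inter> C w \<omega> \<noteq> {}} x * indicator (B \<times> D) (T, x) \<partial>normal_law) \<partial>lborel) =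
      (\<integral>\<^sup>+T. ennreal (exp (- \<Lambda> * T)) * indicator {0..} T * (indicator B T * ennreal \<delta>) \<partial>lborel)"
      by (simp add: \<Lambda>_def)
  qed measurable
  also have "\<dots> = (\<integral>\<^sup>+T. ennreal (exp (- \<Lambda> * T)) * indicator {0..} T * indicator B T \<partial>lborel) * ennreal \<delta>"
    by (subst nn_integral_multc[symmetric]) (auto simp: mult.assoc)
  also have "\<dots> = ennreal (measure (density lborel (exponential_density \<Lambda>)) B * (\<delta> / \<Lambda>))"
  proof (cases "\<Lambda> = 0")
    \<comment> \<open>Both sides vanish: \<delta> is at most \<Lambda>, and the quotient \<delta> /
      \<Lambda> is zero by convention.\<close>
    case True
    then have "\<delta> = 0" using le \<delta>0 by simp
    then show ?thesis by simp
  next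
    case False
    then have pos: "0 < \<Lambda>" using len_nonneg[of "C w \<omega>"] by (metis \<Lambda>_def less_le)
    interpret E: prob_space "density lborel (exponential_density \<Lambda>)"
      by (rule prob_space_exponential_density[OF pos])
    have "ennreal (measure (density lborel (exponential_density \<Lambda>)) B) = emeasure (density lborel (exponential_density \<Lambda>)) B"
      by (simp add: E.emeasure_eq_measure)
    also have "\<dots> = (\<integral>\<^sup>+T. ennreal \<Lambda> * (ennreal (exp (- \<Lambda> * T)) * indicator {0..} T * indicator B T) \<partial>lborel)"
      by (subst emeasure_density) (use pos in \<open>auto intro!: nn_integral_cong simp: exponential_density_def indicator_def ennreal_mult[symmetric] mult.commute\<close>)
    also have "\<dots> = ennreal \<Lambda> * (\<integral>\<^sup>+T. ennreal (exp (- \<Lambda> * T)) * indicator {0..} T * indicator B T \<partial>lborel)"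
      by (rule nn_integral_cmult) measurable
    finally have "ennreal (measure (density lborel (exponential_density \<Lambda>)) B) * ennreal (\<delta> / \<Lambda>) =
      (\<integral>\<^sup>+T. ennreal (exp (- \<Lambda> * T)) * indicator {0..} T * indicator B T \<partial>lborel) * (ennreal \<Lambda> * ennreal (\<delta> / \<Lambda>))"
      by (simp add: ac_simps)
    also have "ennreal \<Lambda> * ennreal (\<delta> / \<Lambda>) = ennreal \<delta>" using pos \<delta>0 by (simp add: ennreal_mult[symmetric])
    finally have F: "ennreal (measure (density lborel (exponential_density \<Lambda>)) B) * ennreal (\<delta> / \<Lambda>) =
      (\<integral>\<^sup>+T. ennreal (exp (- \<Lambda> * T)) * indicator {0..} T * indicator B T \<partial>lborel) * ennreal \<delta>" .
    have "ennreal (measure (density lborel (exponential_density \<Lambda>)) B * (\<delta> / \<Lambda>)) =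
      ennreal (measure (density lborel (exponential_density \<Lambda>)) B) * ennreal (\<delta> / \<Lambda>)"
      by (rule ennreal_mult) (use \<delta>0 pos in auto)
    with F show ?thesis by (simp only:)
  qed
  finally show ?thesis by (simp add: \<Lambda> \<delta>)
qed

text \<open>Testing with indicators of past events removes the conditional expectation from
  \<open>conditional_law\<close> and leaves an identity of integrals.\<close>

lemma rectangle_law:
  assumes A: "A \<in> sets (past k)"
    and [measurable]: "\<And>w. B w \<in> sets borel" "\<And>w. D w \<in> sets borel"
  shows "(\<integral>\<^sup>+\<omega>. indicator A \<omega> * (\<Prod>w | length w = k. indicator (B w \<times> D w) (mark w \<omega>)) \<partial>\<Omega>) =
    (\<integral>\<^sup>+\<omega>. indicator A \<omega> * (\<Prod>w | length w = k. \<integral>\<^sup>+y. mark_density w \<omega> y * indicator (B w \<times> D w) y \<partial>base) \<partial>\<Omega>)"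
proof -
  interpret fs: finite_measure_subalgebra \<Omega> "past k"
    by unfold_locales (rule subalgebra_past)
  have [measurable]: "A \<in> sets \<Omega>" using A subalgebra_past by (auto simp: subalgebra_def)
  note [measurable] = lifetime_measurable normal_measurable
  let ?D = "\<lambda>w. pole -` D w \<inter> great_circles"
  define E where "E = {\<omega> \<in> space \<Omega>. \<forall>w. length w = k \<longrightarrow> \<tau> w \<omega> \<in> B w \<and> great_circle (N w \<omega>) \<in> ?D w}"
  define r where "r w \<omega> = enn2real (\<integral>\<^sup>+y. mark_density w \<omega> y * indicator (B w \<times> D w) y \<partial>base)" for w \<omega>
  have r1: "0 \<le> r w \<omega> \<and> ennreal (r w \<omega>) = (\<integral>\<^sup>+y. mark_density w \<omega> y * indicator (B w \<times> D w) y \<partial>base) \<and> r w \<omega> \<le> 1"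
    if "\<omega> \<in> space \<Omega>" for w \<omega>
  proof -
    have le: "(\<integral>\<^sup>+y. mark_density w \<omega> y * indicator (B w \<times> D w) y \<partial>base) \<le> 1"
      by (rule mark_density_le_1[OF that]) (auto simp: indicator_def)
    then have "ennreal (r w \<omega>) = (\<integral>\<^sup>+y. mark_density w \<omega> y * indicator (B w \<times> D w) y \<partial>base)"
      unfolding r_def by (intro ennreal_enn2real) (auto simp: top_unique less_top[symmetric] dest: order_trans)
    then show ?thesis using le by (auto simp: r_def) (metis enn2real_leI ennreal_1 r_def zero_le_one)
  qed
  have rm [measurable]: "r w \<in> borel_measurable \<Omega>" if "length w = k" for w
  proof -
    have [measurable]: "(\<lambda>z. mark_density w (fst z) (snd z)) \<in> borel_measurable (past k \<Otimes>\<^sub>M base)"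
      using mark_density_measurable[of w k] that by (simp add: case_prod_unfold cong: measurable_cong_sets sets_pair_measure_cong)
    have "(\<lambda>\<omega>. enn2real (\<integral>\<^sup>+y. mark_density w (fst (\<omega>, y)) (snd (\<omega>, y)) * indicator (B w \<times> D w) (snd (\<omega>, y)) \<partial>base)) \<in> borel_measurable (past k)"
      by measurable
    then show ?thesis unfolding r_def by (intro measurable_past[of _ k]) simp
  qed
  have ind: "(\<Prod>w | length w = k. indicator (B w \<times> D w) (mark w \<omega>)) = (indicator E \<omega> :: ennreal)"
    if \<omega>: "\<omega> \<in> space \<Omega>" for \<omega>
  proof -
    have "(mark w \<omega> \<in> B w \<times> D w) \<longleftrightarrow> (\<tau> w \<omega> \<in> B w \<and> great_circle (N w \<omega>) \<in> ?D w)" for w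
      using normal_in_sphere[OF \<omega>, of w] by (auto simp: mark_def pole_great_circle great_circles_def)
    then show ?thesis using \<omega> finite_words[of k] by (auto simp: E_def indicator_def prod_zero_iff)
  qed
  have Em [measurable]: "E \<in> sets \<Omega>"
  proof -
    have "E = {\<omega> \<in> space \<Omega>. \<forall>w\<in>{w. length w = k}. mark w \<omega> \<in> B w \<times> D w}"
      using normal_in_sphere by (auto simp: E_def mark_def pole_great_circle great_circles_def)
    also have "\<dots> \<in> sets \<Omega>"
      using finite_words[of k] by (intro sets.sets_Collect_finite_All) (auto intro!: measurable_sets_Collect[OF measurable_mark])
    finally show ?thesis .
  qed
  have AEq: "AE \<omega> in \<Omega>. real_cond_exp \<Omega> (past k) (indicator E) \<omega> = (\<Prod>w | length w = k. r w \<omega>)"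
    using conditional_law[of k B ?D, folded E_def]
  proof (rule AE_mp)
    show "B w \<in> sets borel \<and> ?D w \<in> sets great_circle_space" for w
      using measurable_sets[OF pole_measurable, of "D w"] by simp
    show "AE \<omega> in \<Omega>. real_cond_exp \<Omega> (past k) (indicator E) \<omega> =
          (\<Prod>w | length w = k. let H = hitting (C w \<omega>)
             in measure (density lborel (exponential_density (measure \<kappa> H))) (B w)
                * (measure \<kappa> (?D w \<inter> H) / measure \<kappa> H)) \<longrightarrow>
        real_cond_exp \<Omega> (past k) (indicator E) \<omega> = (\<Prod>w | length w = k. r w \<omega>)"
    proof (intro AE_I2 impI)
      fix \<omega> assume \<omega>: "\<omega> \<in> space \<Omega>"
      have "r w \<omega> = (let H = hitting (C w \<omega>)
             in measure (density lborel (exponential_density (measure \<kappa> H))) (B w)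
                * (measure \<kappa> (?D w \<inter> H) / measure \<kappa> H))" for w
        unfolding r_def mark_density_rectangle[OF \<omega> \<open>B w \<in> _\<close> \<open>D w \<in> _\<close>]
        by (simp add: Let_def)
      moreover assume "real_cond_exp \<Omega> (past k) (indicator E) \<omega> =
          (\<Prod>w | length w = k. let H = hitting (C w \<omega>)
             in measure (density lborel (exponential_density (measure \<kappa> H))) (B w)
                * (measure \<kappa> (?D w \<inter> H) / measure \<kappa> H))"
      ultimately show "real_cond_exp \<Omega> (past k) (indicator E) \<omega> = (\<Prod>w | length w = k. r w \<omega>)" by simp
    qed
  qed
  have Rm [measurable]: "(\<lambda>\<omega>. \<Prod>w | length w = k. r w \<omega>) \<in> borel_measurable \<Omega>"
    by (intro borel_measurable_prod) auto
  have R01: "0 \<le> (\<Prod>w | length w = k. r w \<omega>)" "(\<Prod>w | length w = k. r w \<omega>) \<le> 1" if "\<omega> \<in> space \<Omega>" for \<omega>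
    using r1[OF that] by (auto intro!: prod_nonneg prod_le_1)
  have "(\<integral>\<^sup>+\<omega>. indicator A \<omega> * (\<Prod>w | length w = k. indicator (B w \<times> D w) (mark w \<omega>)) \<partial>\<Omega>)
    = (\<integral>\<^sup>+\<omega>. ennreal (indicator A \<omega> * indicator E \<omega>) \<partial>\<Omega>)"
    by (intro nn_integral_cong) (simp add: ind, auto simp: indicator_def)
  also have "\<dots> = ennreal (\<integral>\<omega>. indicator A \<omega> * indicator E \<omega> \<partial>\<Omega>)"
    by (rule nn_integral_eq_integral) (auto intro!: \<Omega>.integrable_const_bound[where B=1] simp: indicator_def)
  also have "(\<integral>\<omega>. indicator A \<omega> * indicator E \<omega> \<partial>\<Omega>) = (\<integral>\<omega>. indicator A \<omega> * real_cond_exp \<Omega> (past k) (indicator E) \<omega> \<partial>\<Omega>)"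
  proof -
    have "integrable \<Omega> (indicator E :: 'a \<Rightarrow> real)"
      by (rule \<Omega>.integrable_const_bound[where B=1]) (auto simp: indicator_def)
    from fs.real_cond_exp_intA[OF this A] show ?thesis by (simp add: set_lebesgue_integral_def)
  qed
  also have "\<dots> = (\<integral>\<omega>. indicator A \<omega> * (\<Prod>w | length w = k. r w \<omega>) \<partial>\<Omega>)"
    by (rule integral_cong_AE) (use AEq in auto)
  also have "ennreal \<dots> = (\<integral>\<^sup>+\<omega>. ennreal (indicator A \<omega> * (\<Prod>w | length w = k. r w \<omega>)) \<partial>\<Omega>)"
    using R01 by (intro nn_integral_eq_integral[symmetric]) (auto intro!: \<Omega>.integrable_const_bound[where B=1] AE_I2 simp: indicator_def)
  also have "\<dots> = (\<integral>\<^sup>+\<omega>. indicator A \<omega> * (\<Prod>w | length w = k. \<integral>\<^sup>+y. mark_density w \<omega> y * indicator (B w \<times> D w) y \<partial>base) \<partial>\<Omega>)"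
  proof (rule nn_integral_cong)
    fix \<omega> assume \<omega>: "\<omega> \<in> space \<Omega>"
    have "ennreal (\<Prod>w | length w = k. r w \<omega>) = (\<Prod>w | length w = k. ennreal (r w \<omega>))"
      using r1[OF \<omega>] by (intro prod_ennreal[symmetric]) auto
    then show "ennreal (indicator A \<omega> * (\<Prod>w | length w = k. r w \<omega>)) =
      indicator A \<omega> * (\<Prod>w | length w = k. \<integral>\<^sup>+y. mark_density w \<omega> y * indicator (B w \<times> D w) y \<partial>base)"
      using r1[OF \<omega>] by (simp add: indicator_def)
  qed
  finally show ?thesis .
qed

lemma mark_density_integral_measurable:
  assumes w: "length w \<le> k" and g: "(\<lambda>(\<omega>, y). g \<omega> y) \<in> borel_measurable (past k \<Otimes>\<^sub>M (borel \<Otimes>\<^sub>M borel))"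
  shows "(\<lambda>\<omega>. \<integral>\<^sup>+y. mark_density w \<omega> y * g \<omega> y \<partial>base) \<in> borel_measurable (past k)"
proof -
  have [measurable]: "(\<lambda>z. mark_density w (fst z) (snd z)) \<in> borel_measurable (past k \<Otimes>\<^sub>M base)"
    using mark_density_measurable[OF w] by (simp add: case_prod_unfold cong: measurable_cong_sets sets_pair_measure_cong)
  have [measurable]: "(\<lambda>z. g (fst z) (snd z)) \<in> borel_measurable (past k \<Otimes>\<^sub>M base)"
    using g by (simp add: case_prod_unfold cong: measurable_cong_sets sets_pair_measure_cong)
  have "(\<lambda>\<omega>. \<integral>\<^sup>+y. mark_density w (fst (\<omega>, y)) (snd (\<omega>, y)) * g (fst (\<omega>, y)) (snd (\<omega>, y)) \<partial>base) \<in> borel_measurable (past k)"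
    by measurable
  then show ?thesis by simp
qed

lemma mark_compose_measurable:
  assumes g: "(\<lambda>(\<omega>, y). g \<omega> y) \<in> borel_measurable (past k \<Otimes>\<^sub>M (borel \<Otimes>\<^sub>M borel))"
  shows "(\<lambda>\<omega>. g \<omega> (mark w \<omega>)) \<in> borel_measurable \<Omega>"
proof -
  have "(\<lambda>\<omega>. (\<omega>, mark w \<omega>)) \<in> measurable \<Omega> (past k \<Otimes>\<^sub>M (borel \<Otimes>\<^sub>M borel))"
    using measurable_from_subalg[OF subalgebra_past measurable_ident, of k] by (intro measurable_Pair) (auto simp: id_def)
  from measurable_compose[OF this g] show ?thesis by simp
qed

text \<open>The marks of one generation are exchanged for their conditional laws one at a time.\<close>

lemma generation_law:
  assumes A: "A \<in> sets (past k)"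
    and g: "\<And>w. length w = k \<Longrightarrow> (\<lambda>(\<omega>, y). g w \<omega> y) \<in> borel_measurable (past k \<Otimes>\<^sub>M (borel \<Otimes>\<^sub>M borel))"
    and g1: "\<And>w \<omega> y. g w \<omega> y \<le> (1 :: ennreal)"
  shows "(\<integral>\<^sup>+\<omega>. indicator A \<omega> * (\<Prod>w | length w = k. g w \<omega> (mark w \<omega>)) \<partial>\<Omega>) =
    (\<integral>\<^sup>+\<omega>. indicator A \<omega> * (\<Prod>w | length w = k. \<integral>\<^sup>+y. mark_density w \<omega> y * g w \<omega> y \<partial>base) \<partial>\<Omega>)"
proof -
  let ?W = "{w :: bool list. length w = k}"
  \<comment> \<open>Nodes in \<open>W\<close> already carry the general function, the others still
    the indicator of a rectangle.\<close>
  define sel where "sel W B D w \<omega> y = (if w \<in> W then g w \<omega> y else indicator (B w \<times> D w) y)"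
    for W and B :: "bool list \<Rightarrow> real set" and D :: "bool list \<Rightarrow> (real^3) set" and w \<omega> y
  have "\<forall>A\<in>sets (past k). \<forall>B D. (\<forall>w. B w \<in> sets borel \<and> D w \<in> sets borel) \<longrightarrow>
    (\<integral>\<^sup>+\<omega>. indicator A \<omega> * (\<Prod>w\<in>?W. sel W B D w \<omega> (mark w \<omega>)) \<partial>\<Omega>) =
    (\<integral>\<^sup>+\<omega>. indicator A \<omega> * (\<Prod>w\<in>?W. \<integral>\<^sup>+y. mark_density w \<omega> y * sel W B D w \<omega> y \<partial>base) \<partial>\<Omega>)"
    if "finite W" "W \<subseteq> ?W" for W
    using that
  proof (induction W rule: finite_induct)
    case empty
    then show ?case using rectangle_law by (auto simp: sel_def)
  next
    case (insert u W)
    have u: "length u = k" "u \<in> ?W" and IH: "\<And>A B D. A \<in> sets (past k) \<Longrightarrow> (\<And>w. B w \<in> sets borel) \<Longrightarrow> (\<And>w. D w \<in> sets borel) \<Longrightarrow>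
      (\<integral>\<^sup>+\<omega>. indicator A \<omega> * (\<Prod>w\<in>?W. sel W B D w \<omega> (mark w \<omega>)) \<partial>\<Omega>) =
      (\<integral>\<^sup>+\<omega>. indicator A \<omega> * (\<Prod>w\<in>?W. \<integral>\<^sup>+y. mark_density w \<omega> y * sel W B D w \<omega> y \<partial>base) \<partial>\<Omega>)"
      using insert by auto
    show ?case
    proof (intro ballI allI impI)
      fix A and B :: "bool list \<Rightarrow> real set" and D :: "bool list \<Rightarrow> (real^3) set"
      assume A: "A \<in> sets (past k)" and "\<forall>w. B w \<in> sets (borel :: real measure) \<and> D w \<in> sets (borel :: (real^3) measure)"
      then have BD: "\<And>w. B w \<in> sets borel" "\<And>w. D w \<in> sets borel" by auto
      have A\<Omega> [measurable]: "A \<in> sets \<Omega>" using A subalgebra_past by (auto simp: subalgebra_def)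
      have selm: "(\<lambda>(\<omega>, y). sel W' B' D' w \<omega> y) \<in> borel_measurable (past k \<Otimes>\<^sub>M (borel \<Otimes>\<^sub>M borel))"
        if w: "length w = k" and [measurable]: "B' w \<in> sets borel" "D' w \<in> sets borel" for W' B' D' w
        using g[OF w] by (cases "w \<in> W'") (simp_all add: sel_def)
      have sel1: "sel W' B' D' w \<omega> y \<le> 1" for W' B' D' w \<omega> y using g1 by (simp add: sel_def indicator_def)
      define R where "R = ?W - {u}"
      have R: "finite R" "?W = insert u R" "u \<notin> R" "\<And>w. w \<in> R \<Longrightarrow> length w = k" using u finite_words[of k] by (auto simp: R_def)
      define U where "U \<omega> = indicator A \<omega> * (\<Prod>w\<in>R. sel W B D w \<omega> (mark w \<omega>))" for \<omega>
      define V where "V \<omega> = indicator A \<omega> * (\<Prod>w\<in>R. \<integral>\<^sup>+y. mark_density w \<omega> y * sel W B D w \<omega> y \<partial>base)" for \<omega>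
      have "(\<lambda>\<omega>. sel W B D w \<omega> (mark w \<omega>)) \<in> borel_measurable \<Omega>" if "w \<in> R" for w
        by (rule mark_compose_measurable[OF selm[OF R(4)[OF that] BD]])
      then have [measurable]: "U \<in> borel_measurable \<Omega>" unfolding U_def
        by (intro borel_measurable_times_ennreal borel_measurable_prod_ennreal borel_measurable_indicator A\<Omega>)
      have [measurable]: "V \<in> borel_measurable \<Omega>" unfolding V_def
        by (intro borel_measurable_times_ennreal borel_measurable_prod_ennreal measurable_past[OF mark_density_integral_measurable[of _ k]] selm borel_measurable_indicator A\<Omega> R BD)
          (use R in auto)
      have U1: "U \<omega> \<le> 1" for \<omega>
        unfolding U_def using sel1 by (intro mult_le_one prod_le_1) (auto simp: indicator_def)
      have ext: "(\<integral>\<^sup>+\<omega>. U \<omega> * g u \<omega> (mark u \<omega>) \<partial>\<Omega>) = (\<integral>\<^sup>+\<omega>. V \<omega> * (\<integral>\<^sup>+y. mark_density u \<omega> y * g u \<omega> y \<partial>base) \<partial>\<Omega>)"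
      proof (rule nn_integral_extend_rectangles[OF subalgebra_past measurable_mark sigma_finite_base sets_base])
        show "(\<lambda>(\<omega>, y). mark_density u \<omega> y) \<in> borel_measurable (past k \<Otimes>\<^sub>M borel \<Otimes>\<^sub>M borel)"
          using mark_density_measurable u by simp
        show "(\<lambda>(\<omega>, y). g u \<omega> y) \<in> borel_measurable (past k \<Otimes>\<^sub>M borel \<Otimes>\<^sub>M borel)" using g u by simp
        have "(\<integral>\<^sup>+\<omega>. U \<omega> \<partial>\<Omega>) \<le> (\<integral>\<^sup>+\<omega>. 1 \<partial>\<Omega>)" using U1 by (intro nn_integral_mono) auto
        then show "(\<integral>\<^sup>+\<omega>. U \<omega> \<partial>\<Omega>) \<noteq> \<infinity>" by (auto simp: \<Omega>.emeasure_space_1 top_unique)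
        fix A' B' D' assume A': "A' \<in> sets (past k)" and B': "B' \<in> sets (borel :: real measure)" and D': "D' \<in> sets (borel :: (real^3) measure)"
        \<comment> \<open>The test rectangle at \<open>u\<close> is absorbed into the families of
          sets; this is why the induction hypothesis ranges over all of them.\<close>
        let ?B = "B(u := B')" and ?D = "D(u := D')"
        have same: "sel W ?B ?D w = sel W B D w" if "w \<in> R" for w using that R(3) by (auto simp: sel_def fun_eq_iff)
        have atu: "sel W ?B ?D u = (\<lambda>\<omega>. indicator (B' \<times> D'))" using insert.hyps(2) by (simp add: sel_def fun_eq_iff)
        have "(\<integral>\<^sup>+\<omega>. indicator A' \<omega> * U \<omega> * indicator (B' \<times> D') (mark u \<omega>) \<partial>\<Omega>)
          = (\<integral>\<^sup>+\<omega>. indicator (A' \<inter> A) \<omega> * (\<Prod>w\<in>?W. sel W ?B ?D w \<omega> (mark w \<omega>)) \<partial>\<Omega>)"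
          unfolding R(2) prod.insert[OF R(1,3)] atu U_def
          by (intro nn_integral_cong) (simp add: same indicator_inter_arith ac_simps cong: prod.cong)
        also have "\<dots> = (\<integral>\<^sup>+\<omega>. indicator (A' \<inter> A) \<omega> * (\<Prod>w\<in>?W. \<integral>\<^sup>+y. mark_density w \<omega> y * sel W ?B ?D w \<omega> y \<partial>base) \<partial>\<Omega>)"
          by (rule IH) (use A A' B' D' BD in auto)
        also have "\<dots> = (\<integral>\<^sup>+\<omega>. indicator A' \<omega> * V \<omega> * (\<integral>\<^sup>+y. mark_density u \<omega> y * indicator (B' \<times> D') y \<partial>base) \<partial>\<Omega>)"
          unfolding R(2) prod.insert[OF R(1,3)] atu V_def
          by (intro nn_integral_cong) (simp add: same indicator_inter_arith ac_simps cong: prod.cong)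
        finally show "(\<integral>\<^sup>+\<omega>. indicator A' \<omega> * U \<omega> * indicator (B' \<times> D') (mark u \<omega>) \<partial>\<Omega>) =
          (\<integral>\<^sup>+\<omega>. indicator A' \<omega> * V \<omega> * (\<integral>\<^sup>+y. mark_density u \<omega> y * indicator (B' \<times> D') y \<partial>base) \<partial>\<Omega>)" .
      qed measurable
      have same: "sel (insert u W) B D w = sel W B D w" if "w \<in> R" for w using that R(3) by (auto simp: sel_def fun_eq_iff)
      have atu: "sel (insert u W) B D u = g u" by (simp add: sel_def fun_eq_iff)
      have "(\<integral>\<^sup>+\<omega>. indicator A \<omega> * (\<Prod>w\<in>?W. sel (insert u W) B D w \<omega> (mark w \<omega>)) \<partial>\<Omega>) = (\<integral>\<^sup>+\<omega>. U \<omega> * g u \<omega> (mark u \<omega>) \<partial>\<Omega>)"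
        unfolding R(2) prod.insert[OF R(1,3)] atu U_def
        by (intro nn_integral_cong) (simp add: same ac_simps cong: prod.cong)
      also note ext
      also have "(\<integral>\<^sup>+\<omega>. V \<omega> * (\<integral>\<^sup>+y. mark_density u \<omega> y * g u \<omega> y \<partial>base) \<partial>\<Omega>) =
        (\<integral>\<^sup>+\<omega>. indicator A \<omega> * (\<Prod>w\<in>?W. \<integral>\<^sup>+y. mark_density w \<omega> y * sel (insert u W) B D w \<omega> y \<partial>base) \<partial>\<Omega>)"
        unfolding R(2) prod.insert[OF R(1,3)] atu V_def
        by (intro nn_integral_cong) (simp add: same ac_simps cong: prod.cong)
      finally show "(\<integral>\<^sup>+\<omega>. indicator A \<omega> * (\<Prod>w\<in>?W. sel (insert u W) B D w \<omega> (mark w \<omega>)) \<partial>\<Omega>) =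
        (\<integral>\<^sup>+\<omega>. indicator A \<omega> * (\<Prod>w\<in>?W. \<integral>\<^sup>+y. mark_density w \<omega> y * sel (insert u W) B D w \<omega> y \<partial>base) \<partial>\<Omega>)" .
    qed
  qed
  from this[OF finite_words order_refl, rule_format, OF A, of "\<lambda>_. UNIV" "\<lambda>_. UNIV"] have
    "(\<integral>\<^sup>+\<omega>. indicator A \<omega> * (\<Prod>w\<in>?W. sel ?W (\<lambda>_. UNIV) (\<lambda>_. UNIV) w \<omega> (mark w \<omega>)) \<partial>\<Omega>) =
    (\<integral>\<^sup>+\<omega>. indicator A \<omega> * (\<Prod>w\<in>?W. \<integral>\<^sup>+y. mark_density w \<omega> y * sel ?W (\<lambda>_. UNIV) (\<lambda>_. UNIV) w \<omega> y \<partial>base) \<partial>\<Omega>)"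
    by simp
  moreover have "(\<Prod>w\<in>?W. sel ?W (\<lambda>_. UNIV) (\<lambda>_. UNIV) w \<omega> (mark w \<omega>)) = (\<Prod>w\<in>?W. g w \<omega> (mark w \<omega>))" for \<omega>
    by (rule prod.cong) (auto simp: sel_def)
  moreover have "(\<Prod>w\<in>?W. \<integral>\<^sup>+y. mark_density w \<omega> y * sel ?W (\<lambda>_. UNIV) (\<lambda>_. UNIV) w \<omega> y \<partial>base) =
      (\<Prod>w\<in>?W. \<integral>\<^sup>+y. mark_density w \<omega> y * g w \<omega> y \<partial>base)" for \<omega>
    by (rule prod.cong) (auto simp: sel_def)
  ultimately show ?thesis by simp
qed

text \<open>With constant functions, \<open>generation_law\<close> says that the product of the
  total masses over a generation has expectation one. Each factor is 0 or 1, so almost surely none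
  of them is 0.\<close>

lemma AE_len_pos: "AE \<omega> in \<Omega>. 0 < len (C w \<omega>)"
proof -
  define k where "k = length w"
  define P where "P \<omega> = (\<Prod>w | length w = k. \<integral>\<^sup>+y. mark_density w \<omega> y \<partial>base)" for \<omega>
  have tot: "\<omega> \<in> space \<Omega> \<Longrightarrow> (\<integral>\<^sup>+y. mark_density w \<omega> y \<partial>base) = (if len (C w \<omega>) = 0 then 0 else 1)" for w \<omega>
    using mark_density_total by blast
  have P1: "P \<omega> \<le> 1" if "\<omega> \<in> space \<Omega>" for \<omega> unfolding P_def by (intro prod_le_1) (auto simp: tot[OF that])
  have [measurable]: "P \<in> borel_measurable \<Omega>"
  proof -
    have "(\<lambda>\<omega>. \<integral>\<^sup>+y. mark_density v \<omega> y * 1 \<partial>base) \<in> borel_measurable (past k)" if "length v = k" for v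
      by (rule mark_density_integral_measurable) (use that in auto)
    note m = this[unfolded mult_1_right]
    have "P \<in> borel_measurable (past k)" unfolding P_def by (intro borel_measurable_prod_ennreal m) simp
    then show ?thesis by (rule measurable_past)
  qed
  have "(\<integral>\<^sup>+\<omega>. P \<omega> \<partial>\<Omega>) = (\<integral>\<^sup>+\<omega>. indicator (space \<Omega>) \<omega> * P \<omega> \<partial>\<Omega>)"
    by (rule nn_integral_cong) simp
  also have "\<dots> = 1"
    using generation_law[of "space \<Omega>" k "\<lambda>_ _ _. 1"] sets.top[of "past k"]
    by (simp add: P_def[symmetric] \<Omega>.emeasure_space_1)
  finally have "(\<integral>\<^sup>+\<omega>. (1 - P \<omega>) \<partial>\<Omega>) = 0"
    using P1 by (subst nn_integral_diff) (auto simp: \<Omega>.emeasure_space_1 intro!: AE_I2)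
  then have "AE \<omega> in \<Omega>. 1 - P \<omega> = 0" by (subst (asm) nn_integral_0_iff_AE) auto
  then show ?thesis
  proof (rule AE_mp, intro AE_I2 impI)
    fix \<omega> assume \<omega>: "\<omega> \<in> space \<Omega>" and "1 - P \<omega> = 0"
    then have "P \<omega> \<noteq> 0" by auto
    then have "(\<integral>\<^sup>+y. mark_density w \<omega> y \<partial>base) \<noteq> 0" using finite_words[of k] by (auto simp: P_def k_def)
    then show "0 < len (C w \<omega>)" using tot[OF \<omega>, of w] len_nonneg[of "C w \<omega>"] by (auto split: if_splits simp: less_le)
  qed
qed

lemma AE_mark_density_total: "AE \<omega> in \<Omega>. (\<integral>\<^sup>+y. mark_density w \<omega> y \<partial>base) = 1"
  using AE_len_pos[of w] by (rule AE_mp) (auto intro!: AE_I2 simp: mark_density_total)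

text \<open>The other nodes of the generation carry the constant one, which almost surely integrates
  to one.\<close>

lemma mark_law:
  assumes w: "length w \<le> k" "k = length w"
    and g: "(\<lambda>(\<omega>, y). g \<omega> y) \<in> borel_measurable (past k \<Otimes>\<^sub>M (borel \<Otimes>\<^sub>M borel))"
  shows "(\<integral>\<^sup>+\<omega>. g \<omega> (mark w \<omega>) \<partial>\<Omega>) = (\<integral>\<^sup>+\<omega>. \<integral>\<^sup>+y. mark_density w \<omega> y * g \<omega> y \<partial>base \<partial>\<Omega>)"
proof -
  have "(\<integral>\<^sup>+\<omega>. 1 * g \<omega> (mark w \<omega>) \<partial>\<Omega>) = (\<integral>\<^sup>+\<omega>. 1 * (\<integral>\<^sup>+y. mark_density w \<omega> y * g \<omega> y \<partial>base) \<partial>\<Omega>)"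
  proof (rule nn_integral_extend_rectangles[OF subalgebra_past measurable_mark sigma_finite_base sets_base _ _ _ _ _ g])
    show "(\<lambda>(\<omega>, y). mark_density w \<omega> y) \<in> borel_measurable (past k \<Otimes>\<^sub>M borel \<Otimes>\<^sub>M borel)"
      using mark_density_measurable w by simp
    fix A B D assume A: "A \<in> sets (past k)" and [measurable]: "B \<in> sets (borel :: real measure)" "D \<in> sets (borel :: (real^3) measure)"
    define h where "h v = (if v = w then (\<lambda>(\<omega>::'a). indicator (B \<times> D)) else (\<lambda>\<omega> y. 1 :: ennreal))" for v
    have W: "{v. length v = k} = insert w ({v. length v = k} - {w})" using w by auto
    have fin: "finite ({v. length v = k} - {w})" using finite_words[of k] by simp
    have "(\<integral>\<^sup>+\<omega>. indicator A \<omega> * 1 * indicator (B \<times> D) (mark w \<omega>) \<partial>\<Omega>) =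
      (\<integral>\<^sup>+\<omega>. indicator A \<omega> * (\<Prod>v | length v = k. h v \<omega> (mark v \<omega>)) \<partial>\<Omega>)"
      by (subst W, subst prod.insert) (use fin in \<open>auto simp: h_def\<close>)
    also have "\<dots> = (\<integral>\<^sup>+\<omega>. indicator A \<omega> * (\<Prod>v | length v = k. \<integral>\<^sup>+y. mark_density v \<omega> y * h v \<omega> y \<partial>base) \<partial>\<Omega>)"
      by (rule generation_law[OF A]) (auto simp: h_def indicator_def)
    also have "\<dots> = (\<integral>\<^sup>+\<omega>. indicator A \<omega> * 1 * (\<integral>\<^sup>+y. mark_density w \<omega> y * indicator (B \<times> D) y \<partial>base) \<partial>\<Omega>)"
    proof (rule nn_integral_cong_AE)
      have "AE \<omega> in \<Omega>. \<forall>v\<in>{v. length v = k}. (\<integral>\<^sup>+y. mark_density v \<omega> y \<partial>base) = 1"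
        using finite_words[of k] AE_mark_density_total by (intro AE_finite_allI) auto
      then show "AE \<omega> in \<Omega>. indicator A \<omega> * (\<Prod>v | length v = k. \<integral>\<^sup>+y. mark_density v \<omega> y * h v \<omega> y \<partial>base)
        = indicator A \<omega> * 1 * (\<integral>\<^sup>+y. mark_density w \<omega> y * indicator (B \<times> D) y \<partial>base)"
      proof eventually_elim
        case (elim \<omega>)
        then have "(\<Prod>v\<in>{v. length v = k} - {w}. \<integral>\<^sup>+y. mark_density v \<omega> y * h v \<omega> y \<partial>base) = 1"
          by (intro prod.neutral) (auto simp: h_def)
        then show ?case by (subst W, subst prod.insert) (use fin in \<open>auto simp: h_def\<close>)
      qed
    qed
    finally show "(\<integral>\<^sup>+\<omega>. indicator A \<omega> * 1 * indicator (B \<times> D) (mark w \<omega>) \<partial>\<Omega>) =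
      (\<integral>\<^sup>+\<omega>. indicator A \<omega> * 1 * (\<integral>\<^sup>+y. mark_density w \<omega> y * indicator (B \<times> D) y \<partial>base) \<partial>\<Omega>)" .
  qed (auto simp: \<Omega>.emeasure_space_1)
  then show ?thesis by simp
qed

end

section \<open>Fragmentation of an interval\<close>

text \<open>\<open>edge_count \<theta> r l\<close> is the expected sum of \<open>exp (- \<theta> * m)\<close> over the lengths \<open>m\<close> of the pieces
  into which a segment of length \<open>l\<close> has been cut after time \<open>r\<close>.\<close>

definition ratio :: "real \<Rightarrow> real \<Rightarrow> real" where "ratio \<theta> r = (if \<theta> = 0 then 1 else r / (r + \<theta>))"

definition edge_count :: "real \<Rightarrow> real \<Rightarrow> real \<Rightarrow> real"
  where "edge_count \<theta> r l = 1 - (1 - ratio \<theta> r)\<^sup>2 * (1 - exp (- ((r + \<theta>) * l))) + r * ratio \<theta> r * l"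

text \<open>For \<theta> = 0 the value of \<open>ratio\<close> is 1, which removes the bracket
  divided by \<open>r + \<theta>\<close>; the point \<open>r = \<theta> = 0\<close> therefore needs
  no case of its own.\<close>

definition edge_count_primitive :: "real \<Rightarrow> real \<Rightarrow> real \<Rightarrow> real"
  where "edge_count_primitive \<theta> r l =
    l - (1 - ratio \<theta> r)\<^sup>2 * (l - (1 - exp (- ((r + \<theta>) * l))) / (r + \<theta>)) + r * ratio \<theta> r * l\<^sup>2 / 2"

lemma ratio_bounds: "0 \<le> \<theta> \<Longrightarrow> 0 \<le> r \<Longrightarrow> 0 \<le> ratio \<theta> r \<and> ratio \<theta> r \<le> 1"
  by (auto simp: ratio_def)

lemma ratio_measurable [measurable]: "(\<lambda>r. ratio \<theta> r) \<in> borel_measurable borel"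
  unfolding ratio_def by measurable

lemma edge_count_measurable [measurable]:
  "(\<lambda>(r, l). edge_count \<theta> r l) \<in> borel_measurable (borel \<Otimes>\<^sub>M borel)"
  unfolding edge_count_def by measurable

lemma edge_count_0: "edge_count \<theta> 0 l = exp (- (\<theta> * l))"
  by (simp add: edge_count_def ratio_def)

text \<open>The third bound isolates the term that grows with time; the remainder stays below one
  and is lost after division by \<open>t\<^sup>2\<close>.\<close>

lemma edge_count_bounds:
  assumes "0 \<le> \<theta>" "0 \<le> r" "0 \<le> l"
  shows "0 \<le> edge_count \<theta> r l" "edge_count \<theta> r l \<le> 1 + r * l"
    "\<bar>edge_count \<theta> r l - r * ratio \<theta> r * l\<bar> \<le> 1"
proof -
  define q where "q = ratio \<theta> r"
  define e where "e = 1 - exp (- ((r + \<theta>) * l))"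
  have q: "0 \<le> q" "q \<le> 1" using ratio_bounds assms by (auto simp: q_def)
  have e: "0 \<le> e" "e \<le> 1" using assms by (auto simp: e_def)
  have "(1 - q)\<^sup>2 \<le> 1" using q by (simp add: abs_square_le_1)
  then have m: "0 \<le> (1 - q)\<^sup>2 * e" "(1 - q)\<^sup>2 * e \<le> 1" using e by (auto intro: mult_le_one)
  have r: "0 \<le> r * q * l" "r * q * l \<le> r * l" using q assms by (auto intro!: mult_right_mono mult_left_le)
  have F: "edge_count \<theta> r l = 1 - (1 - q)\<^sup>2 * e + r * q * l" by (simp add: edge_count_def q_def e_def)
  show "0 \<le> edge_count \<theta> r l" "edge_count \<theta> r l \<le> 1 + r * l"
    "\<bar>edge_count \<theta> r l - r * ratio \<theta> r * l\<bar> \<le> 1"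
    using m r F by (auto simp: q_def)
qed

lemma DERIV_edge_count_primitive:
  assumes "0 \<le> \<theta>" "0 \<le> r"
  shows "((\<lambda>l. edge_count_primitive \<theta> r l) has_real_derivative edge_count \<theta> r l) (at l)"
proof (cases "\<theta> = 0")
  case True
  then show ?thesis unfolding edge_count_primitive_def edge_count_def ratio_def
    by (auto intro!: derivative_eq_intros)
next
  case False
  then have a: "r + \<theta> \<noteq> 0" using assms by linarith
  define c where "c = (1 - ratio \<theta> r)\<^sup>2"
  define k where "k = r * ratio \<theta> r"
  have "((\<lambda>l. l - c * (l - (1 - exp (- (a * l))) / a) + k * l\<^sup>2 / 2) has_real_derivative
      1 - c * (1 - exp (- (a * l))) + k * l) (at l)" if "a \<noteq> 0" for a
    using that by (auto intro!: derivative_eq_intros simp: algebra_simps)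
  from this[OF a] show ?thesis unfolding edge_count_primitive_def edge_count_def c_def[symmetric] k_def[symmetric] .
qed

lemma nn_integral_edge_count:
  assumes "0 \<le> \<theta>" "0 \<le> r" "0 \<le> l"
  shows "(\<integral>\<^sup>+u. ennreal (edge_count \<theta> r u) * indicator {0..l} u \<partial>lborel) = ennreal (edge_count_primitive \<theta> r l)"
proof -
  have "(\<integral>\<^sup>+u. ennreal (edge_count \<theta> r u) * indicator {0..l} u \<partial>lborel) =
    ennreal (edge_count_primitive \<theta> r l - edge_count_primitive \<theta> r 0)"
  proof (rule nn_integral_FTC_Icc)
    show "edge_count \<theta> r \<in> borel_measurable borel" unfolding edge_count_def by measurable
  qed (use assms in \<open>auto intro: DERIV_edge_count_primitive edge_count_bounds\<close>)
  then show ?thesis by (simp add: edge_count_primitive_def)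
qed

lemma edge_count_primitive_nonneg:
  assumes "0 \<le> \<theta>" "0 \<le> r" "0 \<le> l"
  shows "0 \<le> edge_count_primitive \<theta> r l"
proof -
  have "edge_count_primitive \<theta> r 0 \<le> edge_count_primitive \<theta> r l"
    by (rule DERIV_nonneg_imp_nondecreasing[OF assms(3)])
      (use assms DERIV_edge_count_primitive edge_count_bounds(1) in blast)
  then show ?thesis by (simp add: edge_count_primitive_def)
qed

text \<open>The fragmentation equation: a segment of length \<open>l\<close> is cut at rate
  \<open>l\<close>, and each of its two pieces then has length uniform below \<open>l\<close>, which
  turns rate times mean into \<open>edge_count_primitive\<close>.\<close>

lemma DERIV_edge_count:
  assumes "0 \<le> \<theta>" "0 \<le> r"
  shows "((\<lambda>r. edge_count \<theta> r l) has_real_derivative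
    - l * edge_count \<theta> r l + 2 * edge_count_primitive \<theta> r l) (at r)"
proof (cases "\<theta> = 0")
  case True
  then show ?thesis unfolding edge_count_primitive_def edge_count_def ratio_def
    by (auto intro!: derivative_eq_intros simp: algebra_simps power2_eq_square)
next
  case False
  then have a: "r + \<theta> \<noteq> 0" using assms by linarith
  define a where "a = r + \<theta>"
  define E where "E = exp (- (a * l))"
  have a0: "a \<noteq> 0" using a by (simp add: a_def)
  have "((\<lambda>r. 1 - (\<theta> / (r + \<theta>))\<^sup>2 * (1 - exp (- ((r + \<theta>) * l))) + r * (r / (r + \<theta>)) * l) has_real_derivative
    - (2 * (\<theta> / a) * (- \<theta> / (a * a)) * (1 - E) + (\<theta> / a)\<^sup>2 * (l * E)) + (r / a + r * ((a - r) / (a * a))) * l) (at r)"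
    by (rule derivative_eq_intros refl | (use a in simp; fail))+
      (simp add: a_def[symmetric] E_def[symmetric], use a0 in \<open>simp add: field_simps power2_eq_square\<close>)
  moreover have "- (2 * (\<theta> / a) * (- \<theta> / (a * a)) * (1 - E) + (\<theta> / a)\<^sup>2 * (l * E)) + (r / a + r * ((a - r) / (a * a))) * l
    = - l * edge_count \<theta> r l + 2 * edge_count_primitive \<theta> r l"
  proof -
    have q: "ratio \<theta> r = r / a" using False by (simp add: ratio_def a_def)
    have th: "\<theta> = a - r" by (simp add: a_def)
    show ?thesis unfolding edge_count_def edge_count_primitive_def q
      unfolding a_def[symmetric] unfolding E_def[symmetric] unfolding th using a0 by (simp add: field_simps power2_eq_square)
  qed
  \<comment> \<open>The closed form that was differentiated agrees with \<open>edge_count\<close>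
    away from \<open>r' = - \<theta>\<close>, so the comparison is made on a neighbourhood of
    \<open>r\<close>.\<close>
  moreover have "eventually (\<lambda>r'. edge_count \<theta> r' l = 1 - (\<theta> / (r' + \<theta>))\<^sup>2 * (1 - exp (- ((r' + \<theta>) * l))) + r' * (r' / (r' + \<theta>)) * l) (nhds r)"
  proof -
    have "0 < r + \<theta>" using a assms by linarith
    then have "eventually (\<lambda>r'. r' \<in> {- \<theta><..}) (nhds r)" by (intro eventually_nhds_in_open) auto
    then show ?thesis
    proof eventually_elim
      case (elim r')
      then have "1 - ratio \<theta> r' = \<theta> / (r' + \<theta>)" using False by (simp add: ratio_def field_simps)
      then show ?case using False by (simp add: edge_count_def ratio_def)
    qed
  qed
  ultimately show ?thesis by (subst DERIV_cong_ev[OF refl _ refl]) auto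
qed

text \<open>Duhamel form of the fragmentation equation for a segment of length \<open>l\<close> in a
  cell of rate \<Lambda>: the split of the cell leaves the segment whole with rate
  \<open>\<Lambda> - l\<close> or cuts it, and the last summand is survival of the cell up to
  \<open>R\<close>. The integrand is the derivative of
  \<open>- exp (- \<Lambda> * T) * edge_count \<theta> (R - T) l\<close>, so \<Lambda> drops out of
  the result.\<close>

lemma nn_integral_edge_count_step:
  assumes \<theta>: "0 \<le> \<theta>" and R: "0 \<le> R" and l: "0 \<le> l" "l \<le> \<Lambda>"
  shows "(\<integral>\<^sup>+T. ennreal (exp (- \<Lambda> * T) * ((\<Lambda> - l) * edge_count \<theta> (R - T) l + 2 * edge_count_primitive \<theta> (R - T) l))
      * indicator {0..R} T \<partial>lborel) + ennreal (exp (- \<Lambda> * R) * exp (- (\<theta> * l))) = ennreal (edge_count \<theta> R l)"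
proof -
  have nonneg: "0 \<le> exp (- \<Lambda> * T) * ((\<Lambda> - l) * edge_count \<theta> (R - T) l + 2 * edge_count_primitive \<theta> (R - T) l)"
    if "0 \<le> T" "T \<le> R" for T
    using edge_count_bounds(1)[OF \<theta> _ l(1), of "R - T"] edge_count_primitive_nonneg[OF \<theta> _ l(1), of "R - T"] that l
    by auto
  have D: "((\<lambda>T. - exp (- \<Lambda> * T) * edge_count \<theta> (R - T) l) has_real_derivative
      exp (- \<Lambda> * T) * ((\<Lambda> - l) * edge_count \<theta> (R - T) l + 2 * edge_count_primitive \<theta> (R - T) l)) (at T)"
    if "0 \<le> T" "T \<le> R" for T
  proof -
    have "((\<lambda>T. edge_count \<theta> (R - T) l) has_real_derivative
      (- l * edge_count \<theta> (R - T) l + 2 * edge_count_primitive \<theta> (R - T) l) * (0 - 1)) (at T)"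
      by (rule DERIV_chain2[OF DERIV_edge_count[OF \<theta>]]) (use that in \<open>auto intro!: derivative_eq_intros\<close>)
    from DERIV_mult[OF DERIV_minus[OF DERIV_chain2[OF DERIV_exp DERIV_cmult[OF DERIV_ident, of "- \<Lambda>"]]] this]
    show ?thesis by (rule DERIV_cong) (simp add: algebra_simps)
  qed
  have "(\<integral>\<^sup>+T. ennreal (exp (- \<Lambda> * T) * ((\<Lambda> - l) * edge_count \<theta> (R - T) l + 2 * edge_count_primitive \<theta> (R - T) l))
      * indicator {0..R} T \<partial>lborel) = ennreal (- exp (- \<Lambda> * R) * edge_count \<theta> (R - R) l - (- exp (- \<Lambda> * 0) * edge_count \<theta> (R - 0) l))"
    by (rule nn_integral_FTC_Icc[OF _ D nonneg R])
      (auto simp: edge_count_def edge_count_primitive_def)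
  also have "\<dots> = ennreal (edge_count \<theta> R l - exp (- \<Lambda> * R) * exp (- (\<theta> * l)))" by (simp add: edge_count_0)
  finally have I: "(\<integral>\<^sup>+T. ennreal (exp (- \<Lambda> * T) * ((\<Lambda> - l) * edge_count \<theta> (R - T) l + 2 * edge_count_primitive \<theta> (R - T) l))
      * indicator {0..R} T \<partial>lborel) = \<dots>" .
  have "- exp (- \<Lambda> * 0) * edge_count \<theta> (R - 0) l \<le> - exp (- \<Lambda> * R) * edge_count \<theta> (R - R) l"
    by (rule DERIV_nonneg_imp_nondecreasing[OF R]) (use D nonneg in blast)
  then have "0 \<le> edge_count \<theta> R l - exp (- \<Lambda> * R) * exp (- (\<theta> * l))" by (simp add: edge_count_0)
  then show ?thesis unfolding I by (subst ennreal_plus[symmetric]) auto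
qed

lemma nn_integral_exponential_tail_from:
  assumes "0 < \<Lambda>"
  shows "(\<integral>\<^sup>+T. ennreal (\<Lambda> * exp (- (\<Lambda> * T))) * indicator {R<..} T \<partial>lborel) = ennreal (exp (- (\<Lambda> * R)))"
proof -
  have "filterlim (\<lambda>T. \<Lambda> * T) at_top at_top"
    by (rule filterlim_tendsto_pos_mult_at_top[OF tendsto_const assms filterlim_ident])
  then have "filterlim (\<lambda>T. - (\<Lambda> * T)) at_bot at_top"
    by (simp add: filterlim_uminus_at_top)
  from tendsto_minus[OF filterlim_compose[OF exp_at_bot this]]
  have "((\<lambda>T. - exp (- (\<Lambda> * T))) \<longlongrightarrow> 0) at_top" by simp
  then have "(\<integral>\<^sup>+T. ennreal (\<Lambda> * exp (- (\<Lambda> * T))) * indicator {R..} T \<partial>lborel) = ennreal (0 - (- exp (- (\<Lambda> * R))))"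
    using assms by (intro nn_integral_FTC_atLeast) (auto intro!: derivative_eq_intros)
  moreover have "(\<integral>\<^sup>+T. ennreal (\<Lambda> * exp (- (\<Lambda> * T))) * indicator {R<..} T \<partial>lborel) =
    (\<integral>\<^sup>+T. ennreal (\<Lambda> * exp (- (\<Lambda> * T))) * indicator {R..} T \<partial>lborel)"
    by (rule nn_integral_cong_AE, rule AE_mp[OF AE_lborel_singleton[of R]]) (auto intro!: AE_I2 simp: indicator_def)
  ultimately show ?thesis by simp
qed

text \<open>\<open>exp (- (\<zeta> * R * l))\<close> is reproduced by the first split. With
  \<open>z = 1 - \<zeta>\<close>, a split before \<open>R\<close> misses the segment with weight 1
  and rate \<open>\<Lambda> - l\<close> or hits it with weight \<open>z\<close> and rate
  \<open>l\<close>, which add up to \<open>\<Lambda> - \<zeta> * l\<close>; the pieces keep the same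
  exponential since their lengths sum to \<open>l\<close>. After \<open>R\<close> nothing is
  counted.\<close>

lemma nn_integral_incidence_step:
  assumes \<zeta>: "0 \<le> \<zeta>" "\<zeta> \<le> 1" and R: "0 \<le> R" and l: "0 \<le> l" "l \<le> \<Lambda>" "0 < \<Lambda>"
  shows "(\<integral>\<^sup>+T. ennreal (exp (- (\<Lambda> * T))) * indicator {0..} T *
      (if T \<le> R then ennreal ((\<Lambda> - \<zeta> * l) * exp (- (\<zeta> * (R - T) * l))) else ennreal \<Lambda>) \<partial>lborel) = ennreal (exp (- (\<zeta> * R * l)))"
proof -
  have z: "\<zeta> * l \<le> \<Lambda>" using \<zeta> l by (meson mult_left_le_one_le order_trans)
  have e: "exp (- (\<Lambda> * T)) * ((\<Lambda> - \<zeta> * l) * exp (- (\<zeta> * (R - T) * l))) =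
      exp (- (\<Lambda> * T) - \<zeta> * (R - T) * l) * (\<Lambda> - \<zeta> * l)" for T
  proof -
    have "exp (- (\<Lambda> * T) - \<zeta> * (R - T) * l) = exp (- (\<Lambda> * T)) * exp (- (\<zeta> * (R - T) * l))"
      by (simp add: mult_exp_exp)
    then show ?thesis by simp
  qed
  have "(\<integral>\<^sup>+T. ennreal (exp (- (\<Lambda> * T)) * ((\<Lambda> - \<zeta> * l) * exp (- (\<zeta> * (R - T) * l)))) * indicator {0..R} T \<partial>lborel) =
    ennreal (- exp (- (\<Lambda> * R) - \<zeta> * (R - R) * l) - (- exp (- (\<Lambda> * 0) - \<zeta> * (R - 0) * l)))"
    unfolding e
    by (rule nn_integral_FTC_Icc) (use R z in \<open>auto intro!: derivative_eq_intros simp: algebra_simps\<close>)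
  then have 1: "(\<integral>\<^sup>+T. ennreal (exp (- (\<Lambda> * T)) * ((\<Lambda> - \<zeta> * l) * exp (- (\<zeta> * (R - T) * l)))) * indicator {0..R} T \<partial>lborel) =
    ennreal (exp (- (\<zeta> * R * l)) - exp (- (\<Lambda> * R)))" by simp
  have "\<zeta> * R * l \<le> \<Lambda> * R" using mult_right_mono[OF z R] by (simp add: ac_simps)
  then have le: "exp (- (\<Lambda> * R)) \<le> exp (- (\<zeta> * R * l))" by simp
  have "(\<integral>\<^sup>+T. ennreal (exp (- (\<Lambda> * T))) * indicator {0..} T *
      (if T \<le> R then ennreal ((\<Lambda> - \<zeta> * l) * exp (- (\<zeta> * (R - T) * l))) else ennreal \<Lambda>) \<partial>lborel) =
    (\<integral>\<^sup>+T. ennreal (exp (- (\<Lambda> * T)) * ((\<Lambda> - \<zeta> * l) * exp (- (\<zeta> * (R - T) * l)))) * indicator {0..R} T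
      + ennreal (\<Lambda> * exp (- (\<Lambda> * T))) * indicator {R<..} T \<partial>lborel)"
    using R l z by (intro nn_integral_cong) (auto simp: indicator_def ennreal_mult[symmetric] mult.commute)
  also have "\<dots> = ennreal (exp (- (\<zeta> * R * l)) - exp (- (\<Lambda> * R))) + ennreal (exp (- (\<Lambda> * R)))"
    by (subst nn_integral_add) (auto simp: 1 nn_integral_exponential_tail_from[OF l(3)])
  also have "\<dots> = ennreal (exp (- (\<zeta> * R * l)))" using le by (subst ennreal_plus[symmetric]) auto
  finally show ?thesis .
qed

section \<open>General position\<close>

text \<open>Only nodes of different generations are compared. This is enough because the arguments
  on edges run along chains of ancestors, where all lengths differ. The last clause leaves finitely
  many splits before any given time.\<close>

definition general_position :: "(bool list \<Rightarrow> real) \<Rightarrow> (bool list \<Rightarrow> real^3) \<Rightarrow> bool"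
  where "general_position s f \<longleftrightarrow>
    (\<forall>w. f w \<in> sphere2 \<and> 0 < s w \<and> cell f w \<inter> great_circle (f w) \<noteq> {}) \<and>
    (\<forall>v w. length v < length w \<longrightarrow> great_circle (f w) \<noteq> great_circle (f v)) \<and>
    (\<forall>u v w. length u < length v \<longrightarrow> length v < length w \<longrightarrow>
      great_circle (f w) \<inter> great_circle (f v) \<inter> great_circle (f u) = {}) \<and>
    (\<forall>n::nat. \<exists>k. \<forall>w. k \<le> length w \<longrightarrow> real n < birth_time s w)"

context splitting_process
begin

text \<open>The indicator of failure integrates to zero against \<open>mark_density\<close>.
  Lifetime zero can be left out as a Lebesgue null set, which also yields that lifetimes are
  positive.\<close>

lemma AE_markI:
  assumes meas: "Measurable.pred (past (length w) \<Otimes>\<^sub>M (borel \<Otimes>\<^sub>M borel)) (\<lambda>z. P (fst z) (snd z))"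
    and AE: "AE \<omega> in \<Omega>. \<forall>T>0. AE x in normal_law. great_circle x \<inter> C w \<omega> \<noteq> {} \<longrightarrow> P \<omega> (T, x)"
  shows "AE \<omega> in \<Omega>. P \<omega> (mark w \<omega>)"
proof -
  let ?S = "past (length w) \<Otimes>\<^sub>M (borel \<Otimes>\<^sub>M borel)"
  define g where "g \<omega> y = (indicator {z \<in> space ?S. \<not> P (fst z) (snd z)} (\<omega>, y) :: ennreal)" for \<omega> y
  have sp: "(\<omega>, y) \<in> space ?S" if "\<omega> \<in> space \<Omega>" for \<omega> y using that by (simp add: space_pair_measure)
  have gm: "(\<lambda>(\<omega>, y). g \<omega> y) \<in> borel_measurable ?S"
  proof -
    have "indicator {z \<in> space ?S. \<not> P (fst z) (snd z)} \<in> borel_measurable ?S" using meas by measurable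
    then show ?thesis by (simp add: g_def case_prod_unfold)
  qed
  have "(\<integral>\<^sup>+\<omega>. g \<omega> (mark w \<omega>) \<partial>\<Omega>) = (\<integral>\<^sup>+\<omega>. \<integral>\<^sup>+y. mark_density w \<omega> y * g \<omega> y \<partial>base \<partial>\<Omega>)"
    by (rule mark_law) (use gm in auto)
  also have "\<dots> = (\<integral>\<^sup>+\<omega>. 0 \<partial>\<Omega>)"
  proof (rule nn_integral_cong_AE)
    show "AE \<omega> in \<Omega>. (\<integral>\<^sup>+y. mark_density w \<omega> y * g \<omega> y \<partial>base) = 0"
      using AE
    proof (rule AE_mp, intro AE_I2 impI)
      fix \<omega> assume \<omega>: "\<omega> \<in> space \<Omega>" and *: "\<forall>T>0. AE x in normal_law. great_circle x \<inter> C w \<omega> \<noteq> {} \<longrightarrow> P \<omega> (T, x)"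
      have "(\<lambda>y. (\<omega>, y)) \<in> measurable (borel \<Otimes>\<^sub>M borel) ?S" by (rule measurable_Pair1') (use \<omega> in simp)
      from measurable_compose[OF this gm] have gy: "g \<omega> \<in> borel_measurable (borel \<Otimes>\<^sub>M borel)" by simp
      have "(\<integral>\<^sup>+y. mark_density w \<omega> y * g \<omega> y \<partial>base) = (\<integral>\<^sup>+T. 0 \<partial>(lborel :: real measure))"
        unfolding nn_integral_mark_density[OF \<omega> gy]
      proof (rule nn_integral_cong_AE, rule AE_mp[OF AE_lborel_singleton[of 0]], intro AE_I2 impI)
        fix T :: real assume "T \<noteq> 0"
        show "ennreal (exp (- len (C w \<omega>) * T)) * indicator {0..} T *
          (\<integral>\<^sup>+x. indicator {x. great_circle x \<inter> C w \<omega> \<noteq> {}} x * g \<omega> (T, x) \<partial>normal_law) = 0"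
        proof (cases "0 < T")
          case True
          from *[rule_format, OF True]
          have "AE x in normal_law. indicator {x. great_circle x \<inter> C w \<omega> \<noteq> {}} x * g \<omega> (T, x) = 0"
            by eventually_elim (simp add: g_def indicator_def, blast)
          then have "(\<integral>\<^sup>+x. indicator {x. great_circle x \<inter> C w \<omega> \<noteq> {}} x * g \<omega> (T, x) \<partial>normal_law) = (\<integral>\<^sup>+x. 0 \<partial>normal_law)"
            by (rule nn_integral_cong_AE)
          then show ?thesis by simp
        next
          case False
          then show ?thesis using \<open>T \<noteq> 0\<close> by simp
        qed
      qed
      then show "(\<integral>\<^sup>+y. mark_density w \<omega> y * g \<omega> y \<partial>base) = 0" by simp
    qed
  qed
  finally have "AE \<omega> in \<Omega>. g \<omega> (mark w \<omega>) = 0"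
    using mark_compose_measurable[OF gm, of w] by (simp add: nn_integral_0_iff_AE)
  then show ?thesis
    by (rule AE_mp) (auto intro!: AE_I2 simp: g_def sp indicator_def split: if_splits)
qed

lemma AE_lifetime_pos: "AE \<omega> in \<Omega>. 0 < \<tau> w \<omega>"
proof -
  have "AE \<omega> in \<Omega>. 0 < fst (mark w \<omega>)"
    by (rule AE_markI[where w=w and P="\<lambda>\<omega> y. 0 < fst y"]) auto
  then show ?thesis by (simp add: mark_def)
qed

lemma AE_edge_nonempty: "AE \<omega> in \<Omega>. C w \<omega> \<inter> great_circle (N w \<omega>) \<noteq> {}"
proof -
  have "AE \<omega> in \<Omega>. great_circle (snd (mark w \<omega>)) \<inter> C w \<omega> \<noteq> {}"
    by (rule AE_markI[where w=w and P="\<lambda>\<omega> y. great_circle (snd y) \<inter> C w \<omega> \<noteq> {}"])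
      (auto intro!: random_polytope_hits random_polytope_compose[OF past_cell])
  then show ?thesis by (simp add: mark_def Int_commute)
qed

lemma AE_normal_neq:
  assumes y: "y \<in> borel_measurable (past (length w))" "\<And>\<omega>. \<omega> \<in> space \<Omega> \<Longrightarrow> y \<omega> \<in> sphere2"
  shows "AE \<omega> in \<Omega>. great_circle (N w \<omega>) \<noteq> great_circle (y \<omega>)"
proof -
  note [measurable] = y(1)
  have "AE \<omega> in \<Omega>. snd (mark w \<omega>) \<noteq> y \<omega> \<and> snd (mark w \<omega>) \<noteq> - y \<omega>"
  proof (rule AE_markI[where w=w and P="\<lambda>\<omega> z. snd z \<noteq> y \<omega> \<and> snd z \<noteq> - y \<omega>"])
    show "AE \<omega> in \<Omega>. \<forall>T>(0::real). AE x in normal_law. great_circle x \<inter> C w \<omega> \<noteq> {} \<longrightarrow> snd (T, x) \<noteq> y \<omega> \<and> snd (T, x) \<noteq> - y \<omega>"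
    proof (rule AE_I2, intro allI impI)
      fix \<omega> and T :: real assume "\<omega> \<in> space \<Omega>"
      from AE_great_circle_neq[OF y(2)[OF this]]
      show "AE x in normal_law. great_circle x \<inter> C w \<omega> \<noteq> {} \<longrightarrow> snd (T, x) \<noteq> y \<omega> \<and> snd (T, x) \<noteq> - y \<omega>"
        by eventually_elim (metis great_circle_minus snd_conv)
    qed
  qed measurable
  then show ?thesis
  proof (rule AE_mp, intro AE_I2 impI)
    fix \<omega> assume \<omega>: "\<omega> \<in> space \<Omega>" and *: "snd (mark w \<omega>) \<noteq> y \<omega> \<and> snd (mark w \<omega>) \<noteq> - y \<omega>"
    have "snd (mark w \<omega>) \<in> sphere2" using normal_in_sphere[OF \<omega>, of w] by (simp add: mark_def)
    then have "great_circle (y \<omega>) \<noteq> great_circle (snd (mark w \<omega>))"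
      using * great_circle_eq_iff[OF y(2)[OF \<omega>]] by blast
    then show "great_circle (N w \<omega>) \<noteq> great_circle (y \<omega>)" by (simp add: mark_def)
  qed
qed

lemma AE_triple_empty:
  assumes y: "y \<in> borel_measurable (past (length w))" "\<And>\<omega>. \<omega> \<in> space \<Omega> \<Longrightarrow> y \<omega> \<in> sphere2"
    and h: "h \<in> borel_measurable (past (length w))" "\<And>\<omega>. \<omega> \<in> space \<Omega> \<Longrightarrow> h \<omega> \<in> sphere2"
    and neq: "AE \<omega> in \<Omega>. great_circle (y \<omega>) \<noteq> great_circle (h \<omega>)"
  shows "AE \<omega> in \<Omega>. great_circle (N w \<omega>) \<inter> great_circle (y \<omega>) \<inter> great_circle (h \<omega>) = {}"
proof -
  \<comment> \<open>\<open>sphere2\<close> is inserted to bring the intersection into the form of a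
    random polytope.\<close>
  have "AE \<omega> in \<Omega>. \<not> (great_circle (snd (mark w \<omega>)) \<inter> (sphere2 \<inter> great_circle (y \<omega>) \<inter> great_circle (h \<omega>)) \<noteq> {})"
  proof (rule AE_markI[where w=w and P="\<lambda>\<omega> z. \<not> (great_circle (snd z) \<inter> (sphere2 \<inter> great_circle (y \<omega>) \<inter> great_circle (h \<omega>)) \<noteq> {})"])
    show "Measurable.pred (past (length w) \<Otimes>\<^sub>M borel \<Otimes>\<^sub>M borel)
        (\<lambda>z. \<not> (great_circle (snd (snd z)) \<inter> (sphere2 \<inter> great_circle (y (fst z)) \<inter> great_circle (h (fst z))) \<noteq> {}))"
      by (intro pred_intros_logic random_polytope_hits random_polytope_great_circle random_polytope_sphere
          measurable_compose[OF measurable_fst y(1)] measurable_compose[OF measurable_fst h(1)]) measurable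
    show "AE \<omega> in \<Omega>. \<forall>T>(0::real). AE x in normal_law. great_circle x \<inter> C w \<omega> \<noteq> {} \<longrightarrow>
        \<not> (great_circle (snd (T, x)) \<inter> (sphere2 \<inter> great_circle (y \<omega>) \<inter> great_circle (h \<omega>)) \<noteq> {})"
      using neq
    proof (rule AE_mp)
      show "AE \<omega> in \<Omega>. great_circle (y \<omega>) \<noteq> great_circle (h \<omega>) \<longrightarrow> (\<forall>T>(0::real). AE x in normal_law. great_circle x \<inter> C w \<omega> \<noteq> {} \<longrightarrow>
        \<not> (great_circle (snd (T, x)) \<inter> (sphere2 \<inter> great_circle (y \<omega>) \<inter> great_circle (h \<omega>)) \<noteq> {}))"
      proof (rule AE_I2, intro impI allI)
      fix \<omega> and T :: real assume "\<omega> \<in> space \<Omega>" "great_circle (y \<omega>) \<noteq> great_circle (h \<omega>)"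
      from AE_great_circle_triple[OF y(2)[OF this(1)] h(2)[OF this(1)] this(2)]
      show "AE x in normal_law. great_circle x \<inter> C w \<omega> \<noteq> {} \<longrightarrow>
        \<not> (great_circle (snd (T, x)) \<inter> (sphere2 \<inter> great_circle (y \<omega>) \<inter> great_circle (h \<omega>)) \<noteq> {})"
        by eventually_elim auto
      qed
    qed
  qed
  then show ?thesis
  proof (rule AE_mp, intro AE_I2 impI)
    fix \<omega> assume "\<not> (great_circle (snd (mark w \<omega>)) \<inter> (sphere2 \<inter> great_circle (y \<omega>) \<inter> great_circle (h \<omega>)) \<noteq> {})"
    moreover have "great_circle (y \<omega>) \<subseteq> sphere2" by (auto simp: great_circle_def)
    ultimately show "great_circle (N w \<omega>) \<inter> great_circle (y \<omega>) \<inter> great_circle (h \<omega>) = {}"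
      by (simp add: mark_def) blast
  qed
qed

text \<open>The Laplace transform at 3 of a lifetime of rate \<Lambda> is
  \<open>\<Lambda> / (\<Lambda> + 3)\<close>, at most 1/4 because \<open>\<Lambda> \<le> 1\<close>.
  The argument 3 is chosen so that the factor 1/4 beats the doubling of the number of words per
  generation.\<close>

lemma nn_integral_birth_laplace:
  "(\<integral>\<^sup>+\<omega>. ennreal (exp (- 3 * birth w \<omega>)) \<partial>\<Omega>) \<le> ennreal ((1 / 4) ^ length w)"
proof (induction w)
  case Nil
  then show ?case by (simp add: \<Omega>.emeasure_space_1)
next
  case (Cons b w)
  note [measurable] = past_birth[OF order_refl, of w]
  have "(\<integral>\<^sup>+\<omega>. ennreal (exp (- 3 * birth (b # w) \<omega>)) \<partial>\<Omega>) = (\<integral>\<^sup>+\<omega>. ennreal (exp (- 3 * (birth w \<omega> + fst (mark w \<omega>)))) \<partial>\<Omega>)"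
    by (simp add: mark_def)
  also have "\<dots> = (\<integral>\<^sup>+\<omega>. \<integral>\<^sup>+y. mark_density w \<omega> y * ennreal (exp (- 3 * (birth w \<omega> + fst y))) \<partial>base \<partial>\<Omega>)"
    by (rule mark_law[of w _ "\<lambda>\<omega> y. ennreal (exp (- 3 * (birth w \<omega> + fst y)))"]) (auto simp: case_prod_unfold)
  also have "\<dots> \<le> (\<integral>\<^sup>+\<omega>. ennreal (1/4) * ennreal (exp (- 3 * birth w \<omega>)) \<partial>\<Omega>)"
  proof (rule nn_integral_mono)
    fix \<omega> assume \<omega>: "\<omega> \<in> space \<Omega>"
    define \<Lambda> where "\<Lambda> = len (C w \<omega>)"
    have \<Lambda>: "0 \<le> \<Lambda>" "\<Lambda> \<le> 1" by (simp_all add: \<Lambda>_def)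
    note [measurable] = hits_set[OF const_cell[OF \<omega>]]
    have "(\<integral>\<^sup>+y. mark_density w \<omega> y * ennreal (exp (- 3 * (birth w \<omega> + fst y))) \<partial>base) =
      (\<integral>\<^sup>+T. ennreal (exp (- \<Lambda> * T)) * indicator {0..} T * (ennreal \<Lambda> * ennreal (exp (- 3 * (birth w \<omega> + T)))) \<partial>lborel)"
      by (subst nn_integral_mark_density[OF \<omega>], measurable)
        (auto intro!: nn_integral_cong simp: nn_integral_multc emeasure_hits \<Lambda>_def)
    also have "\<dots> = (\<integral>\<^sup>+T. ennreal (\<Lambda> * exp (- 3 * birth w \<omega>)) * (ennreal (exp (- ((\<Lambda> + 3) * T))) * indicator {0..} T) \<partial>lborel)"
    proof (rule nn_integral_cong)
      fix T :: real
      have "exp (- \<Lambda> * T) * (\<Lambda> * exp (- 3 * (birth w \<omega> + T))) = (\<Lambda> * exp (- 3 * birth w \<omega>)) * exp (- ((\<Lambda> + 3) * T))"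
        by (simp add: algebra_simps exp_add exp_minus exp_diff field_simps)
      then show "ennreal (exp (- \<Lambda> * T)) * indicator {0..} T * (ennreal \<Lambda> * ennreal (exp (- 3 * (birth w \<omega> + T)))) =
        ennreal (\<Lambda> * exp (- 3 * birth w \<omega>)) * (ennreal (exp (- ((\<Lambda> + 3) * T))) * indicator {0..} T)"
        using \<Lambda> by (simp add: indicator_def ennreal_mult[symmetric])
    qed
    also have "\<dots> = ennreal (\<Lambda> * exp (- 3 * birth w \<omega>)) * ennreal (1 / (\<Lambda> + 3))"
      using \<Lambda> by (subst nn_integral_cmult) (auto simp: nn_integral_exponential_tail)
    also have "\<dots> \<le> ennreal (1/4) * ennreal (exp (- 3 * birth w \<omega>))"
    proof -
      have "\<Lambda> / (\<Lambda> + 3) \<le> 1 / 4" using \<Lambda> by (simp add: field_simps)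
      from mult_right_mono[OF this, of "exp (- 3 * birth w \<omega>)"]
      have "\<Lambda> * exp (- 3 * birth w \<omega>) * (1 / (\<Lambda> + 3)) \<le> 1/4 * exp (- 3 * birth w \<omega>)" by (simp add: field_simps)
      then show ?thesis using \<Lambda> by (simp add: ennreal_mult[symmetric] del: ennreal_mult')
    qed
    finally show "(\<integral>\<^sup>+y. mark_density w \<omega> y * ennreal (exp (- 3 * (birth w \<omega> + fst y))) \<partial>base)
      \<le> ennreal (1/4) * ennreal (exp (- 3 * birth w \<omega>))" .
  qed
  also have "\<dots> = ennreal (1/4) * (\<integral>\<^sup>+\<omega>. ennreal (exp (- 3 * birth w \<omega>)) \<partial>\<Omega>)"
    by (rule nn_integral_cmult) (use measurable_past[OF past_birth[OF order_refl, of w]] in measurable)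
  also have "\<dots> \<le> ennreal (1/4) * ennreal ((1 / 4) ^ length w)"
    by (rule mult_left_mono[OF Cons.IH]) simp
  finally show ?case by (simp add: ennreal_mult[symmetric])
qed

lemma birth_measurable [measurable]: "birth w \<in> borel_measurable \<Omega>"
  by (rule measurable_past[OF past_birth[OF order_refl]])

text \<open>Markov's inequality for \<open>exp (- 3 * birth w \<omega>)\<close>.\<close>

lemma emeasure_birth_le:
  "emeasure \<Omega> {\<omega> \<in> space \<Omega>. birth w \<omega> \<le> t} \<le> ennreal (exp (3 * t) * (1 / 4) ^ length w)"
proof -
  have "emeasure \<Omega> {\<omega> \<in> space \<Omega>. birth w \<omega> \<le> t} = (\<integral>\<^sup>+\<omega>. indicator {\<omega> \<in> space \<Omega>. birth w \<omega> \<le> t} \<omega> \<partial>\<Omega>)"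
    by (rule nn_integral_indicator[symmetric]) measurable
  also have "\<dots> \<le> (\<integral>\<^sup>+\<omega>. ennreal (exp (3 * t)) * ennreal (exp (- 3 * birth w \<omega>)) \<partial>\<Omega>)"
    by (rule nn_integral_mono) (auto simp: indicator_def ennreal_mult[symmetric] mult_exp_exp)
  also have "\<dots> = ennreal (exp (3 * t)) * (\<integral>\<^sup>+\<omega>. ennreal (exp (- 3 * birth w \<omega>)) \<partial>\<Omega>)"
    by (rule nn_integral_cmult) measurable
  also have "\<dots> \<le> ennreal (exp (3 * t)) * ennreal ((1 / 4) ^ length w)"
    by (rule mult_left_mono[OF nn_integral_birth_laplace]) simp
  finally show ?thesis by (simp add: ennreal_mult[symmetric])
qed

lemma card_words: "card {w :: bool list. length w = k} = 2 ^ k"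
  using card_lists_length_eq[of "UNIV :: bool set" k] by (simp add: card_UNIV_bool)

lemma sum_emeasure_birth_le:
  "(\<Sum>w | length w = k. emeasure \<Omega> {\<omega> \<in> space \<Omega>. birth w \<omega> \<le> t}) \<le> ennreal (exp (3 * t) * (1 / 2) ^ k)"
proof -
  have "(\<Sum>w | length w = k. emeasure \<Omega> {\<omega> \<in> space \<Omega>. birth w \<omega> \<le> t}) \<le>
    (\<Sum>w :: bool list | length w = k. ennreal (exp (3 * t) * (1 / 4) ^ k))"
    by (intro sum_mono) (use emeasure_birth_le in auto)
  also have "\<dots> = ennreal (2 ^ k * (exp (3 * t) * (1 / 4) ^ k))"
    by (simp add: card_words ennreal_mult ennreal_power[symmetric])
  also have "2 ^ k * (exp (3 * t) * (1 / 4 :: real) ^ k) = exp (3 * t) * (1 / 2) ^ k"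
    by (simp add: power_divide field_simps flip: power_mult_distrib)
  finally show ?thesis .
qed

text \<open>Borel-Cantelli: the probability of a birth before \<open>t\<close> in generation
  \<open>k\<close> is at most \<open>exp (3 * t) * (1 / 2) ^ k\<close>, which is summable.\<close>

lemma AE_births_late: "AE \<omega> in \<Omega>. \<exists>k. \<forall>w. k \<le> length w \<longrightarrow> t < birth w \<omega>"
proof -
  define E where "E k = (\<Union>w\<in>{w. length w = k}. {\<omega> \<in> space \<Omega>. birth w \<omega> \<le> t})" for k
  have Em [measurable]: "E k \<in> sets \<Omega>" for k unfolding E_def
    by (intro sets.finite_UN finite_words) measurable
  have "emeasure \<Omega> (E k) \<le> (\<Sum>w | length w = k. emeasure \<Omega> {\<omega> \<in> space \<Omega>. birth w \<omega> \<le> t})" for k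
    unfolding E_def by (intro emeasure_subadditive_finite finite_words) auto
  then have le: "ennreal (measure \<Omega> (E k)) \<le> ennreal (exp (3 * t) * (1 / 2) ^ k)" for k
    unfolding \<Omega>.emeasure_eq_measure[symmetric] by (rule order_trans[OF _ sum_emeasure_birth_le])
  have le2: "measure \<Omega> (E k) \<le> exp (3 * t) * (1 / 2) ^ k" for k
    using le[of k] by (subst ennreal_le_iff[symmetric]) auto
  have "summable (\<lambda>k. measure \<Omega> (E k))"
  proof (rule summable_comparison_test'[where N=0])
    show "summable (\<lambda>k. exp (3 * t) * (1 / 2) ^ k)" by (intro summable_mult summable_geometric) simp
  qed (use le2 in simp)
  then have "AE \<omega> in \<Omega>. eventually (\<lambda>k. \<omega> \<in> space \<Omega> - E k) sequentially"
    by (intro borel_cantelli_AE1 Em) (simp_all add: \<Omega>.emeasure_eq_measure)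
  then show ?thesis
  proof (rule AE_mp, intro AE_I2 impI)
    fix \<omega> assume "\<omega> \<in> space \<Omega>" "eventually (\<lambda>k. \<omega> \<in> space \<Omega> - E k) sequentially"
    then show "\<exists>k. \<forall>w. k \<le> length w \<longrightarrow> t < birth w \<omega>"
      unfolding eventually_sequentially E_def by (auto simp: not_le)
  qed
qed

lemma AE_general_position: "AE \<omega> in \<Omega>. general_position (\<lambda>w. \<tau> w \<omega>) (\<lambda>w. N w \<omega>)"
proof -
  have 1: "AE \<omega> in \<Omega>. \<forall>w. 0 < \<tau> w \<omega>" unfolding AE_all_countable using AE_lifetime_pos by blast
  have 2: "AE \<omega> in \<Omega>. \<forall>w. C w \<omega> \<inter> great_circle (N w \<omega>) \<noteq> {}" unfolding AE_all_countable using AE_edge_nonempty by blast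
  have neq: "AE \<omega> in \<Omega>. great_circle (N w \<omega>) \<noteq> great_circle (N v \<omega>)" if "length v < length w" for v w
    using that by (intro AE_normal_neq past_normal normal_in_sphere)
  have 3: "AE \<omega> in \<Omega>. \<forall>v w. length v < length w \<longrightarrow> great_circle (N w \<omega>) \<noteq> great_circle (N v \<omega>)"
    unfolding AE_all_countable using neq by (auto intro: AE_impI)
  have tri: "AE \<omega> in \<Omega>. great_circle (N w \<omega>) \<inter> great_circle (N v \<omega>) \<inter> great_circle (N u \<omega>) = {}"
    if "length u < length v" "length v < length w" for u v w
    using that neq[of u v] by (intro AE_triple_empty past_normal normal_in_sphere) auto
  have 4: "AE \<omega> in \<Omega>. \<forall>u v w. length u < length v \<longrightarrow> length v < length w \<longrightarrow>
      great_circle (N w \<omega>) \<inter> great_circle (N v \<omega>) \<inter> great_circle (N u \<omega>) = {}"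
    unfolding AE_all_countable using tri by (auto intro: AE_impI)
  have 5: "AE \<omega> in \<Omega>. \<forall>n::nat. \<exists>k. \<forall>w. k \<le> length w \<longrightarrow> real n < birth w \<omega>"
    unfolding AE_all_countable using AE_births_late by blast
  from AE_space 1 2 3 4 5 show ?thesis
    by eventually_elim (use normal_in_sphere in \<open>auto simp: general_position_def\<close>)
qed

end

text \<open>Words grow at the front, so ancestors are proper suffixes; the letter in front of
  \<open>w\<close> tells on which side of the circle of \<open>w\<close> the descendant
  lies.\<close>

definition descends :: "bool list \<Rightarrow> bool list \<Rightarrow> bool"
  where "descends v w \<longleftrightarrow> (\<exists>u b. v = u @ b # w)"

definition edge :: "(bool list \<Rightarrow> real^3) \<Rightarrow> bool list \<Rightarrow> (real^3) set"
  where "edge f w = cell f w \<inter> great_circle (f w)"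

lemma descends_length: "descends v w \<Longrightarrow> length w < length v"
  by (auto simp: descends_def)

lemma descends_Cons: "descends (b # v) w \<longleftrightarrow> v = w \<or> descends v w"
  by (auto simp: descends_def Cons_eq_append_conv)

text \<open>The longest common suffix \<open>u\<close> is the last common ancestor, and the two
  words lie on opposite sides of its circle. Suffixes being shared, the induction runs from the end
  of the words.\<close>

lemma incomparable_words:
  "v \<noteq> w \<Longrightarrow> \<not> descends v w \<Longrightarrow> \<not> descends w v \<Longrightarrow> \<exists>u v' w' b. v = v' @ b # u \<and> w = w' @ (\<not> b) # u"
proof (induction v arbitrary: w rule: rev_induct)
  case Nil
  then show ?case by (cases w rule: rev_cases) (auto simp: descends_def)
next
  case (snoc c v)
  show ?case
  proof (cases w rule: rev_cases)
    case Nil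
    then show ?thesis using snoc.prems by (auto simp: descends_def)
  next
    case (snoc w0 d)
    show ?thesis
    proof (cases "c = d")
      case True
      have "\<not> descends v w0" "\<not> descends w0 v" "v \<noteq> w0"
        using snoc.prems True \<open>w = w0 @ [d]\<close> by (auto simp: descends_def)
      from snoc.IH[OF this(3,1,2)] obtain u v' w' b where "v = v' @ b # u" "w0 = w' @ (\<not> b) # u" by blast
      then show ?thesis using True snoc by (intro exI[of _ "u @ [d]"] exI[of _ v'] exI[of _ w'] exI[of _ b]) simp
    next
      case False
      then have "d = (\<not> c)" by auto
      then show ?thesis using snoc by (intro exI[of _ "[]"] exI[of _ v] exI[of _ w0] exI[of _ c]) auto
    qed
  qed
qed

lemma cell_append_subset: "cell f (u @ w) \<subseteq> cell f w"
  by (induction u) auto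

lemma cell_descends: "descends v w \<Longrightarrow> cell f v \<subseteq> cell f w"
proof -
  assume "descends v w"
  then obtain u b where "v = u @ b # w" by (auto simp: descends_def)
  then show ?thesis using cell_append_subset[of f "u @ [b]" w] by simp
qed

lemma cell_append_hemisphere: "cell f (u @ b # w) \<subseteq> hemisphere b (f w)"
  using cell_append_subset[of f u "b # w"] by auto

lemma cell_memI:
  assumes "y \<in> sphere2" "\<And>u b i. w = u @ b # i \<Longrightarrow> y \<in> hemisphere b (f i)"
  shows "y \<in> cell f w"
  using assms(2)
proof (induction w)
  case (Cons b w)
  have "y \<in> cell f w" by (rule Cons.IH) (use Cons.prems[of "b # _"] in auto)
  moreover have "y \<in> hemisphere b (f w)" using Cons.prems[of "[]" b w] by simp
  ultimately show ?case by simp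
qed (use assms(1) in simp)

section \<open>Deterministic geometry of edges in general position\<close>

locale generic_splitting =
  fixes s :: "bool list \<Rightarrow> real" and f :: "bool list \<Rightarrow> real^3"
  assumes gp: "general_position s f"
begin

lemma in_sphere: "f w \<in> sphere2" and lifetime_pos: "0 < s w" and edge_nonempty: "edge f w \<noteq> {}"
  and circle_neq: "length v < length w \<Longrightarrow> great_circle (f w) \<noteq> great_circle (f v)"
  and triple: "length u < length v \<Longrightarrow> length v < length w \<Longrightarrow>
      great_circle (f w) \<inter> great_circle (f v) \<inter> great_circle (f u) = {}"
  and late: "\<exists>k. \<forall>w. k \<le> length w \<longrightarrow> real n < birth_time s w"
  using gp unfolding general_position_def edge_def by blast+

lemma birth_mono: "birth_time s w \<le> birth_time s (u @ w)"
proof (induction u)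
  case (Cons b u)
  then show ?case using less_imp_le[OF lifetime_pos[of "u @ w"]] by simp
qed simp

lemma split_less: "descends v w \<Longrightarrow> split_time s w < split_time s v"
proof -
  assume "descends v w"
  then obtain u b where v: "v = u @ b # w" by (auto simp: descends_def)
  have "split_time s w \<le> birth_time s v"
    using birth_mono[of "b # w" u] by (simp add: v split_time_def)
  then show ?thesis using lifetime_pos[of v] by (simp add: split_time_def)
qed

lemma finite_split: "finite {w. split_time s w \<le> t}"
proof -
  obtain n :: nat where n: "t < real n" using reals_Archimedean2 by blast
  obtain k where k: "\<And>w. k \<le> length w \<Longrightarrow> real n < birth_time s w" using late[of n] by blast
  have "{w. split_time s w \<le> t} \<subseteq> (\<Union>j<k. {w. length w = j})"
  proof
    fix w assume "w \<in> {w. split_time s w \<le> t}"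
    then have "birth_time s w \<le> t" using lifetime_pos[of w] by (simp add: split_time_def)
    then have "length w < k" using k[of w] n by linarith
    then show "w \<in> (\<Union>j<k. {w. length w = j})" by simp
  qed
  then show ?thesis by (rule finite_subset) (simp add: finite_words)
qed

text \<open>\<open>y\<close> is an end of the edge. By general position it lies on no other ancestor
  circle, so every other constraint is strict there, and moving along the circle of \<open>w\<close>
  into the hemisphere of \<open>i\<close> stays in the edge for a while.\<close>

lemma boundary_point:
  assumes y: "y \<in> edge f w" and w: "w = u @ b # i" and 0: "f i \<bullet> y = 0"
  obtains d where "norm d = 1" "f w \<bullet> d = 0" "y \<bullet> d = 0"
    "if b then 0 < f i \<bullet> d else f i \<bullet> d < 0"
    "eventually (\<lambda>\<epsilon>. cos \<epsilon> *\<^sub>R y + sin \<epsilon> *\<^sub>R d \<in> edge f w) (at_right 0)"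
proof -
  define n where "n = (if b then f i else - f i)"
  have n: "n \<in> sphere2" "great_circle n = great_circle (f i)" using in_sphere[of i] by (auto simp: n_def)
  have y1: "norm y = 1" "f w \<bullet> y = 0" "y \<in> cell f w" using y by (auto simp: edge_def great_circle_def)
  have neq: "great_circle (f w) \<noteq> great_circle n" unfolding n(2) by (rule circle_neq) (simp add: w)
  obtain a d where "half_circle (f w) n a d" and a: "great_circle (f w) \<inter> great_circle n = {a, - a}"
    using half_circle_exists[OF in_sphere n(1) neq] by blast
  then interpret half_circle "f w" n a d by blast
  have "y \<in> great_circle (f w) \<inter> great_circle n" using y1 0 by (auto simp: great_circle_def n_def)
  then have ya: "y = a \<or> y = - a" using a by blast
  then have yd: "y \<bullet> d = 0" by auto
  have nd: "if b then 0 < f i \<bullet> d else f i \<bullet> d < 0" using border(2) by (auto simp: n_def)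
  define z where "z \<epsilon> = cos \<epsilon> *\<^sub>R y + sin \<epsilon> *\<^sub>R d" for \<epsilon>
  have z1: "norm (z \<epsilon>) = 1" for \<epsilon>
  proof -
    have "z \<epsilon> \<bullet> z \<epsilon> = (cos \<epsilon>)\<^sup>2 + (sin \<epsilon>)\<^sup>2"
      using y1 yd by (simp add: z_def inner_add_left inner_add_right inner_commute norm_eq_1 power2_eq_square)
    then show ?thesis by (simp add: norm_eq_1)
  qed
  have zw: "f w \<bullet> z \<epsilon> = 0" for \<epsilon> using y1 by (simp add: z_def inner_add_right)
  have lim: "((\<lambda>\<epsilon>. f j \<bullet> z \<epsilon>) \<longlongrightarrow> f j \<bullet> y) (at_right 0)" for j
  proof -
    have "((\<lambda>\<epsilon>. f j \<bullet> z \<epsilon>) \<longlongrightarrow> f j \<bullet> (cos 0 *\<^sub>R y + sin 0 *\<^sub>R d)) (at_right 0)"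
      unfolding z_def by (intro tendsto_intros)
    then show ?thesis by simp
  qed
  \<comment> \<open>The constraints that define the cell: each decomposition of \<open>w\<close>
    names an ancestor and a side. There are finitely many, as the length of the prefix determines
    the decomposition.\<close>
  define A where "A = {(u', b', j). w = u' @ b' # j}"
  have "inj_on (\<lambda>(u', b', j). length u') A" by (auto simp: inj_on_def A_def)
  moreover have "(\<lambda>(u', b', j). length u') ` A \<subseteq> {..length w}" by (auto simp: A_def)
  ultimately have finA: "finite A" by (meson finite_atMost finite_imageD finite_subset)
  have ev: "eventually (\<lambda>\<epsilon>. z \<epsilon> \<in> hemisphere b' (f j)) (at_right 0)" if A: "w = u' @ b' # j" for u' b' j
  proof (cases "f j \<bullet> y = 0")
    case True
    \<comment> \<open>A second ancestor circle through \<open>y\<close> would give three circles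
      through one point.\<close>
    have "j = i"
    proof (rule ccontr)
      assume "j \<noteq> i"
      have "length j \<noteq> length i"
      proof
        assume "length j = length i"
        then have "length u' = length u" using A w by auto
        then show False using A w \<open>j \<noteq> i\<close> by auto
      qed
      moreover have "length j < length w" using A by simp
      moreover have "length i < length w" using w by simp
      moreover have "y \<in> great_circle (f w) \<inter> great_circle (f i) \<inter> great_circle (f j)"
        using y1 0 True by (auto simp: great_circle_def)
      ultimately show False using triple[of i j w] triple[of j i w] by (metis Int_commute Int_left_commute empty_iff linorder_neqE_nat)
    qed
    then have "b' = b" using A w by auto
    have "eventually (\<lambda>\<epsilon>::real. \<epsilon> \<in> {0<..<pi}) (at_right 0)"
      by (rule eventually_at_right_real) simp
    then show ?thesis
    proof eventually_elim
      case (elim \<epsilon>)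
      then have "0 < sin \<epsilon>" by (intro sin_gt_zero) auto
      moreover have "f i \<bullet> z \<epsilon> = sin \<epsilon> * (f i \<bullet> d)" using 0 by (simp add: z_def inner_add_right)
      ultimately show ?case using nd z1[of \<epsilon>] \<open>j = i\<close> \<open>b' = b\<close>
        by (auto simp: hemisphere_def mult_nonneg_nonneg mult_nonneg_nonpos less_imp_le split: if_splits)
    qed
  next
    case False
    have "y \<in> hemisphere b' (f j)" using y1(3) cell_append_hemisphere[of f u' b' j] A by auto
    then have "if b' then 0 < f j \<bullet> y else f j \<bullet> y < 0" using False by (auto simp: hemisphere_def split: if_splits)
    then have "eventually (\<lambda>\<epsilon>. if b' then 0 < f j \<bullet> z \<epsilon> else f j \<bullet> z \<epsilon> < 0) (at_right 0)"
      using order_tendstoD[OF lim[of j]] by (cases b') auto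
    then show ?thesis by eventually_elim (use z1 in \<open>auto simp: hemisphere_def split: if_splits\<close>)
  qed
  have "eventually (\<lambda>\<epsilon>. \<forall>(u', b', j)\<in>A. z \<epsilon> \<in> hemisphere b' (f j)) (at_right 0)"
    using finA ev by (intro eventually_ball_finite) (auto simp: A_def)
  then have "eventually (\<lambda>\<epsilon>. z \<epsilon> \<in> edge f w) (at_right 0)"
  proof eventually_elim
    case (elim \<epsilon>)
    have "z \<epsilon> \<in> cell f w" by (rule cell_memI) (use z1 elim in \<open>auto simp: A_def\<close>)
    then show ?case using z1 zw by (simp add: edge_def great_circle_def)
  qed
  then show ?thesis using that[of d] unit orth yd nd by (simp add: z_def)
qed

text \<open>At a point on an ancestor circle the edge continues in one direction, while the mirrored
  points stay on the spanned circle but leave the cell. At all other points the constraints are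
  strict and persist on a neighbourhood.\<close>

lemma relint_edge: "relint (edge f w) = {y \<in> edge f w. \<forall>i. descends w i \<longrightarrow> f i \<bullet> y \<noteq> 0}"
proof (intro equalityI subsetI)
  fix y assume "y \<in> relint (edge f w)"
  then obtain T where T: "openin (top_of_set (sphere2 \<inter> span (edge f w))) T" "y \<in> T" "T \<subseteq> edge f w"
    by (auto simp: relint_def interior_of_def)
  then obtain U where U: "open U" "T = sphere2 \<inter> span (edge f w) \<inter> U" by (auto simp: openin_open)
  have ye: "y \<in> edge f w" using T by auto
  have "f i \<bullet> y \<noteq> 0" if wi: "descends w i" for i
  proof
    assume 0: "f i \<bullet> y = 0"
    obtain u b where w: "w = u @ b # i" using wi by (auto simp: descends_def)
    obtain d where d: "norm d = 1" "f w \<bullet> d = 0" "y \<bullet> d = 0" "if b then 0 < f i \<bullet> d else f i \<bullet> d < 0"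
      "eventually (\<lambda>\<epsilon>. cos \<epsilon> *\<^sub>R y + sin \<epsilon> *\<^sub>R d \<in> edge f w) (at_right 0)"
      using boundary_point[OF ye w 0] by blast
    have pi: "eventually (\<lambda>\<epsilon>::real. \<epsilon> \<in> {0<..<pi}) (at_right 0)" by (rule eventually_at_right_real) simp
    have "eventually (\<lambda>\<epsilon>. cos \<epsilon> *\<^sub>R y - sin \<epsilon> *\<^sub>R d \<in> U) (at_right 0)"
    proof -
      have "((\<lambda>\<epsilon>. cos \<epsilon> *\<^sub>R y - sin \<epsilon> *\<^sub>R d) \<longlongrightarrow> cos 0 *\<^sub>R y - sin 0 *\<^sub>R d) (at_right 0)" by (intro tendsto_intros)
      then show ?thesis using U T(2) by (auto intro: topological_tendstoD)
    qed
    then have "eventually (\<lambda>\<epsilon>::real. False) (at_right 0)"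
      using d(5) pi
    proof eventually_elim
      case (elim \<epsilon>)
      have s: "0 < sin \<epsilon>" using elim(3) by (intro sin_gt_zero) auto
      \<comment> \<open>The edge contains \<open>y\<close> and a point tilted towards
        \<open>d\<close>, so \<open>d\<close> lies in its span. The mirrored point thus belongs to
        the space in which the interior is taken.\<close>
      have yspan: "y \<in> span (edge f w)" using ye by (rule span_base)
      have "(cos \<epsilon> *\<^sub>R y + sin \<epsilon> *\<^sub>R d) - cos \<epsilon> *\<^sub>R y \<in> span (edge f w)"
        by (intro span_diff span_base[OF elim(2)] span_scale yspan)
      then have "sin \<epsilon> *\<^sub>R d \<in> span (edge f w)" by simp
      then have zs: "cos \<epsilon> *\<^sub>R y - sin \<epsilon> *\<^sub>R d \<in> span (edge f w)" by (intro span_diff[OF span_scale[OF yspan]])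
      have "norm y = 1" using ye by (auto simp: edge_def great_circle_def)
      have "(cos \<epsilon> *\<^sub>R y - sin \<epsilon> *\<^sub>R d) \<bullet> (cos \<epsilon> *\<^sub>R y - sin \<epsilon> *\<^sub>R d) = (cos \<epsilon>)\<^sup>2 + (sin \<epsilon>)\<^sup>2"
        using d \<open>norm y = 1\<close> by (simp add: inner_diff_left inner_diff_right inner_commute norm_eq_1 power2_eq_square)
      then have "norm (cos \<epsilon> *\<^sub>R y - sin \<epsilon> *\<^sub>R d) = 1" by (simp add: norm_eq_1)
      then have "cos \<epsilon> *\<^sub>R y - sin \<epsilon> *\<^sub>R d \<in> edge f w" using T(3) U(2) zs elim(1) by auto
      then have "cos \<epsilon> *\<^sub>R y - sin \<epsilon> *\<^sub>R d \<in> hemisphere b (f i)"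
        using cell_append_hemisphere[of f u b i] by (auto simp: edge_def w)
      moreover have "f i \<bullet> (cos \<epsilon> *\<^sub>R y - sin \<epsilon> *\<^sub>R d) = - sin \<epsilon> * (f i \<bullet> d)" using 0 by (simp add: inner_diff_right)
      ultimately show ?case using d(4) s
        by (auto simp: hemisphere_def zero_le_mult_iff mult_le_0_iff split: if_splits)
    qed
    then show False by simp
  qed
  with ye show "y \<in> {y \<in> edge f w. \<forall>i. descends w i \<longrightarrow> f i \<bullet> y \<noteq> 0}" by blast
next
  fix y assume "y \<in> {y \<in> edge f w. \<forall>i. descends w i \<longrightarrow> f i \<bullet> y \<noteq> 0}"
  then have y: "y \<in> edge f w" "\<And>i. descends w i \<Longrightarrow> f i \<bullet> y \<noteq> 0" by auto
  define A where "A = {(u', b', j). w = u' @ b' # j}"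
  have "inj_on (\<lambda>(u', b', j). length u') A" by (auto simp: inj_on_def A_def)
  moreover have "(\<lambda>(u', b', j). length u') ` A \<subseteq> {..length w}" by (auto simp: A_def)
  ultimately have finA: "finite A" by (meson finite_atMost finite_imageD finite_subset)
  define U where "U = (\<Inter>(u', b', j)\<in>A. {z. if b' then 0 < f j \<bullet> z else f j \<bullet> z < 0})"
  have "open U" unfolding U_def
  proof (intro open_INT finA ballI)
    fix x assume "x \<in> A"
    obtain u' b' j where "x = (u', b', j)" by (cases x)
    then show "open (case x of (u', b', j) \<Rightarrow> {z. if b' then 0 < f j \<bullet> z else f j \<bullet> z < 0})"
      by (cases b') (auto intro!: open_Collect_less continuous_intros)
  qed
  have "y \<in> U"
  proof -
    have "if b' then 0 < f j \<bullet> y else f j \<bullet> y < 0" if "w = u' @ b' # j" for u' b' j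
    proof -
      have "y \<in> hemisphere b' (f j)" using y(1) cell_append_hemisphere[of f u' b' j] that by (auto simp: edge_def)
      moreover have "f j \<bullet> y \<noteq> 0" using y(2)[of j] that by (auto simp: descends_def)
      ultimately show ?thesis by (auto simp: hemisphere_def split: if_splits)
    qed
    then show ?thesis by (auto simp: U_def A_def)
  qed
  let ?S = "sphere2 \<inter> span (edge f w)"
  have "span (edge f w) \<subseteq> {z. f w \<bullet> z = 0}"
    by (rule span_minimal) (auto simp: edge_def great_circle_def subspace_hyperplane)
  then have sub: "?S \<inter> U \<subseteq> edge f w"
  proof (intro subsetI)
    fix z assume "span (edge f w) \<subseteq> {z. f w \<bullet> z = 0}" and z: "z \<in> ?S \<inter> U"
    then have "z \<in> great_circle (f w)" by (auto simp: great_circle_def)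
    moreover have "z \<in> cell f w"
    proof (rule cell_memI)
      fix u' b' j assume "w = u' @ b' # j"
      then show "z \<in> hemisphere b' (f j)" using z by (force simp: U_def A_def hemisphere_def split: if_splits)
    qed (use z in auto)
    ultimately show "z \<in> edge f w" by (simp add: edge_def)
  qed
  have "y \<in> ?S" using y(1) by (auto simp: edge_def great_circle_def span_base)
  then show "y \<in> relint (edge f w)"
    unfolding relint_def interior_of_def using \<open>open U\<close> \<open>y \<in> U\<close> sub by (auto intro!: exI[of _ "?S \<inter> U"] openin_open_Int)
qed

text \<open>Lets pairs of edge and birth time be counted by words. A descendant splits strictly
  later. Incomparable words lie on opposite sides of a common ancestor circle, so an edge shared by
  them would lie on that circle, whereas \<open>boundary_point\<close> makes it leave the circle at
  once.\<close>

lemma edge_birth_inj: "inj (\<lambda>w. (edge f w, split_time s w))"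
proof (rule injI)
  fix v w assume eq: "(edge f v, split_time s v) = (edge f w, split_time s w)"
  show "v = w"
  proof (rule ccontr)
    assume neq: "v \<noteq> w"
    have "\<not> descends v w" "\<not> descends w v" using split_less[of v w] split_less[of w v] eq by auto
    then obtain u v' w' b where vw: "v = v' @ b # u" "w = w' @ (\<not> b) # u" using incomparable_words neq by blast
    have 0: "f u \<bullet> y = 0" if "y \<in> edge f w" for y
    proof -
      have "y \<in> hemisphere b (f u)" "y \<in> hemisphere (\<not> b) (f u)"
        using that eq cell_append_hemisphere[of f v' b u] cell_append_hemisphere[of f w' "\<not> b" u] vw by (auto simp: edge_def)
      then show ?thesis by (cases b) (auto simp: hemisphere_def)
    qed
    obtain y where y: "y \<in> edge f w" using edge_nonempty by blast
    obtain d where d: "if \<not> b then 0 < f u \<bullet> d else f u \<bullet> d < 0"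
      "eventually (\<lambda>\<epsilon>. cos \<epsilon> *\<^sub>R y + sin \<epsilon> *\<^sub>R d \<in> edge f w) (at_right 0)"
      using boundary_point[OF y vw(2) 0[OF y]] by blast
    have pi: "eventually (\<lambda>\<epsilon>::real. \<epsilon> \<in> {0<..<pi}) (at_right 0)" by (rule eventually_at_right_real) simp
    from d(2) pi have "eventually (\<lambda>\<epsilon>::real. False) (at_right 0)"
    proof eventually_elim
      case (elim \<epsilon>)
      have "0 < sin \<epsilon>" using elim(2) by (intro sin_gt_zero) auto
      moreover have "f u \<bullet> (cos \<epsilon> *\<^sub>R y + sin \<epsilon> *\<^sub>R d) = sin \<epsilon> * (f u \<bullet> d)" using 0[OF y] by (simp add: inner_add_right)
      ultimately show ?case using 0[OF elim(1)] d(1) by (auto split: if_splits)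
    qed
    then show False by simp
  qed
qed

text \<open>Edges of incomparable words can meet only on the circle of their last common ancestor,
  and \<open>relint_edge\<close> excludes such points. For a descendant \<open>v\<close>, general
  position keeps the meeting points off the ancestor circles of \<open>w\<close>.\<close>

lemma edge_meets_relint_iff:
  assumes "split_time s w < split_time s v"
  shows "edge f v \<inter> relint (edge f w) \<noteq> {} \<longleftrightarrow>
    descends v w \<and> great_circle (f v) \<inter> (cell f v \<inter> great_circle (f w)) \<noteq> {}"
proof (rule iffI)
  assume "edge f v \<inter> relint (edge f w) \<noteq> {}"
  then obtain y where y: "y \<in> edge f v" "y \<in> relint (edge f w)" by blast
  then have yw: "y \<in> edge f w" "\<And>i. descends w i \<Longrightarrow> f i \<bullet> y \<noteq> 0" by (auto simp: relint_edge)
  have "v \<noteq> w" "\<not> descends w v" using assms split_less[of w v] by auto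
  moreover have "\<not> (\<exists>u v' w' b. v = v' @ b # u \<and> w = w' @ (\<not> b) # u)"
  proof safe
    fix u v' w' b assume vw: "v = v' @ b # u" "w = w' @ (\<not> b) # u"
    have "y \<in> hemisphere b (f u)" "y \<in> hemisphere (\<not> b) (f u)"
      using y(1) yw(1) cell_append_hemisphere[of f v' b u] cell_append_hemisphere[of f w' "\<not> b" u] vw by (auto simp: edge_def)
    then have "f u \<bullet> y = 0" by (cases b) (auto simp: hemisphere_def)
    moreover have "descends w u" using vw by (auto simp: descends_def)
    ultimately show False using yw(2) by blast
  qed
  ultimately have "descends v w" using incomparable_words by blast
  moreover have "y \<in> great_circle (f v) \<inter> (cell f v \<inter> great_circle (f w))" using y(1) yw(1) by (auto simp: edge_def)
  ultimately show "descends v w \<and> great_circle (f v) \<inter> (cell f v \<inter> great_circle (f w)) \<noteq> {}" by blast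
next
  assume "descends v w \<and> great_circle (f v) \<inter> (cell f v \<inter> great_circle (f w)) \<noteq> {}"
  then obtain y where d: "descends v w" and y: "y \<in> great_circle (f v)" "y \<in> cell f v" "y \<in> great_circle (f w)" by blast
  have "f i \<bullet> y \<noteq> 0" if "descends w i" for i
  proof
    assume "f i \<bullet> y = 0"
    then have "y \<in> great_circle (f v) \<inter> great_circle (f w) \<inter> great_circle (f i)" using y by (auto simp: great_circle_def)
    then show False using triple[of i w v] descends_length[OF d] descends_length[OF that] by blast
  qed
  moreover have "y \<in> edge f w" using y cell_descends[OF d] by (auto simp: edge_def)
  ultimately have "y \<in> relint (edge f w)" unfolding relint_edge by blast
  then have "y \<in> edge f v \<inter> relint (edge f w)" using y by (simp add: edge_def)
  then show "edge f v \<inter> relint (edge f w) \<noteq> {}" by blast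
qed

lemma maximal_edges_eq: "maximal_edges s f t = (\<lambda>w. (edge f w, split_time s w)) ` {w. split_time s w \<le> t}"
  by (auto simp: maximal_edges_def edge_def)

lemma card_maximal_edges: "card (maximal_edges s f t) = card {w. split_time s w \<le> t}"
  unfolding maximal_edges_eq by (intro card_image inj_on_subset[OF edge_birth_inj]) auto

lemma internal_incidences_eq:
  "internal_incidences (edge f w) (split_time s w) (maximal_edges s f t) =
    card {v. descends v w \<and> split_time s v \<le> t \<and> great_circle (f v) \<inter> (cell f v \<inter> great_circle (f w)) \<noteq> {}}"
    (is "_ = card ?J")
proof -
  have "{(e, u) \<in> maximal_edges s f t. u > split_time s w \<and> e \<inter> relint (edge f w) \<noteq> {}} =
    (\<lambda>v. (edge f v, split_time s v)) ` ?J"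
    unfolding maximal_edges_eq using edge_meets_relint_iff[of w] split_less[of _ w] by auto
  moreover have "card ((\<lambda>v. (edge f v, split_time s v)) ` ?J) = card ?J"
    by (intro card_image inj_on_subset[OF edge_birth_inj]) auto
  ultimately show ?thesis by (simp add: internal_incidences_def)
qed

lemma sum_maximal_edges:
  "(\<Sum>(e, r)\<in>maximal_edges s f t. g e r) = (\<Sum>w | split_time s w \<le> t. g (edge f w) (split_time s w))"
  unfolding maximal_edges_eq by (subst sum.reindex) (auto intro: inj_on_subset[OF edge_birth_inj])

end

section \<open>One split of a cell, seen on a fixed circle\<close>

context half_circle_law
begin

text \<open>Circles that hit \<open>c\<close> but miss \<open>p\<close> have mass
  \<open>len c - len p\<close> and leave \<open>p\<close> whole in one half. The other half is then
  empty and must count zero, since \<open>G (len {})\<close> need not vanish.\<close>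

lemma nn_integral_segment_step:
  assumes seg: "segment p" and poly: "random_polytope (borel :: (real^3) measure) (\<lambda>_. p)"
    and polyc: "random_polytope (borel :: (real^3) measure) (\<lambda>_. c)" and sub: "p \<subseteq> c" and ne: "p \<noteq> {}"
    and [measurable]: "G \<in> borel_measurable borel"
  shows "(\<integral>\<^sup>+x. indicator {x. great_circle x \<inter> c \<noteq> {}} x *
      (\<Sum>b\<in>UNIV. if p \<inter> hemisphere b x = {} then 0 else G (len (p \<inter> hemisphere b x))) \<partial>normal_law) =
    ennreal (len c - len p) * G (len p) + 2 * (\<integral>\<^sup>+u. G u * indicator {0..len p} u \<partial>lborel)"
proof -
  let ?Hp = "{x. great_circle x \<inter> p \<noteq> {}}" and ?Hc = "{x. great_circle x \<inter> c \<noteq> {}}"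
  note [measurable] = hits_set[OF poly] hits_set[OF polyc]
  have [measurable]: "(\<lambda>x. len (p \<inter> hemisphere b x)) \<in> borel_measurable normal_law" for b
    by (rule len_measurable, rule random_polytope_hemisphere, rule random_polytope_compose[OF poly, of "\<lambda>x. x"]) auto
  have HpHc: "?Hp \<subseteq> ?Hc" using sub by blast
  have "(\<integral>\<^sup>+x. indicator ?Hc x * (\<Sum>b\<in>UNIV. if p \<inter> hemisphere b x = {} then 0 else G (len (p \<inter> hemisphere b x))) \<partial>normal_law)
    = (\<integral>\<^sup>+x. indicator (?Hc - ?Hp) x * G (len p) + (\<Sum>b\<in>UNIV. G (len (p \<inter> hemisphere b x))) * indicator ?Hp x \<partial>normal_law)"
  proof (rule nn_integral_cong_AE)
    show "AE x in normal_law. indicator ?Hc x * (\<Sum>b\<in>UNIV. if p \<inter> hemisphere b x = {} then 0 else G (len (p \<inter> hemisphere b x)))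
      = indicator (?Hc - ?Hp) x * G (len p) + (\<Sum>b\<in>UNIV. G (len (p \<inter> hemisphere b x))) * indicator ?Hp x"
      using AE_inner_a
    proof eventually_elim
      case (elim x)
      show ?case
      proof (cases "x \<in> ?Hp")
        case True
        obtain \<alpha> \<beta> where p: "p \<subseteq> arc" "(\<bullet>) a ` p = {\<alpha>..\<beta>}" using seg by (auto simp: segment_def)
        have "p \<inter> hemisphere b x \<noteq> {}" for b using segment_hit(2)[OF p poly elim] True by blast
        moreover have "x \<in> ?Hc" using True HpHc by blast
        ultimately show ?thesis using True by (simp add: indicator_def)
      next
        case False
        then have "great_circle x \<inter> p = {}" by simp
        from segment_not_hit[OF seg elim this] obtain b where b: "p \<inter> hemisphere b x = p" "p \<inter> hemisphere (\<not> b) x = {}" .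
        have "(\<Sum>b\<in>UNIV. if p \<inter> hemisphere b x = {} then 0 else G (len (p \<inter> hemisphere b x))) = G (len p)"
          using b ne by (cases b) (simp_all add: UNIV_bool)
        then show ?thesis using False by (simp add: indicator_def)
      qed
    qed
  qed
  also have "\<dots> = emeasure normal_law (?Hc - ?Hp) * G (len p) + 2 * (\<integral>\<^sup>+u. G u * indicator {0..len p} u \<partial>lborel)"
    by (subst nn_integral_add) (auto simp: nn_integral_segment_hit[OF seg poly ne] nn_integral_multc)
  also have "emeasure normal_law (?Hc - ?Hp) = ennreal (len c - len p)"
    using normal_law.finite_measure_Diff[of ?Hc ?Hp] HpHc by (simp add: normal_law.emeasure_eq_measure len_def)
  finally show ?thesis .
qed

text \<open>The oldest letter \<open>b\<close> cuts out the half circle. Each later cut keeps an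
  interval because its circle does not pass through the ends \<open>a\<close> and
  \<open>- a\<close>; a circle equal to that of \<open>y\<close> leaves the segment as it
  is.\<close>

lemma segment_cell:
  assumes h: "h = (if b then f [] else - f [])"
    and gen: "\<And>i. descends (v @ [b]) i \<Longrightarrow> i \<noteq> [] \<Longrightarrow>
      great_circle (f i) = great_circle y \<or> great_circle (f i) \<inter> great_circle (f []) \<inter> great_circle y = {}"
  shows "segment (cell f (v @ [b]) \<inter> great_circle y)"
  using gen
proof (induction v)
  case Nil
  have "cell f ([] @ [b]) \<inter> great_circle y = arc"
    unfolding arc_def by (cases b) (auto simp: h great_circle_def hemisphere_def)
  then show ?case using segment_arc by simp
next
  case (Cons b' v)
  let ?i = "v @ [b]" and ?p = "cell f (v @ [b]) \<inter> great_circle y"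
  have seg: "segment ?p"
    by (rule Cons.IH) (use Cons.prems in \<open>auto simp: descends_Cons\<close>)
  have eq: "cell f ((b' # v) @ [b]) \<inter> great_circle y = ?p \<inter> hemisphere b' (f ?i)" by auto
  from Cons.prems[of ?i] consider "great_circle (f ?i) = great_circle y" |
    "great_circle (f ?i) \<inter> great_circle (f []) \<inter> great_circle y = {}" by (auto simp: descends_Cons)
  then show ?case
  proof cases
    case 1
    have "great_circle (f ?i) \<subseteq> hemisphere b' (f ?i)" by (auto simp: great_circle_def hemisphere_def)
    with 1 have "?p \<inter> hemisphere b' (f ?i) = ?p" by auto
    with seg show ?thesis unfolding eq by simp
  next
    case 2
    have "f ?i \<bullet> a \<noteq> 0"
    proof
      assume "f ?i \<bullet> a = 0"
      then have "a \<in> great_circle (f ?i) \<inter> great_circle (f []) \<inter> great_circle y"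
        using unit orth border h by (auto simp: great_circle_def split: if_splits)
      with 2 show False by blast
    qed
    with segment_Int_hemisphere[OF seg] show ?thesis unfolding eq by blast
  qed
qed

end

section \<open>The intensity of edges\<close>

text \<open>Ensures that the ancestors of \<open>w\<close> cut the circle of \<open>y\<close> like
  an interval. Equality of circles is allowed because \<open>y\<close> may itself be the normal of
  an ancestor, as happens when incidences on an edge are counted.\<close>

definition splits_generically :: "(bool list \<Rightarrow> real^3) \<Rightarrow> bool list \<Rightarrow> real^3 \<Rightarrow> bool"
  where "splits_generically f w y \<longleftrightarrow> y \<in> sphere2 \<and> f [] \<in> sphere2 \<and> great_circle y \<noteq> great_circle (f []) \<and>
    (\<forall>i. descends w i \<longrightarrow> i \<noteq> [] \<longrightarrow>
      great_circle (f i) = great_circle y \<or> great_circle (f i) \<inter> great_circle (f []) \<inter> great_circle y = {})"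

context isotropic_measure
begin

text \<open>The half circle is taken on the side of the root circle where the cell lies. Restating
  the results of \<open>half_circle_law\<close> here frees them from the parameters
  \<open>h\<close>, \<open>a\<close> and \<open>d\<close>.\<close>

lemma
  assumes gen: "splits_generically f w y" and w: "w \<noteq> []"
    and poly: "random_polytope (borel :: (real^3) measure) (\<lambda>_. cell f w)"
  shows nn_integral_cell_step:
    "cell f w \<inter> great_circle y \<noteq> {} \<Longrightarrow> G \<in> borel_measurable borel \<Longrightarrow>
    (\<integral>\<^sup>+x. indicator {x. great_circle x \<inter> cell f w \<noteq> {}} x *
      (\<Sum>b\<in>UNIV. if cell f w \<inter> great_circle y \<inter> hemisphere b x = {} then 0 else G (len (cell f w \<inter> great_circle y \<inter> hemisphere b x))) \<partial>normal_law) =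
    ennreal (len (cell f w) - len (cell f w \<inter> great_circle y)) * G (len (cell f w \<inter> great_circle y)) +
      2 * (\<integral>\<^sup>+u. G u * indicator {0..len (cell f w \<inter> great_circle y)} u \<partial>lborel)"
    (is "_ \<Longrightarrow> _ \<Longrightarrow> ?step")
    and AE_len_split: "AE x in normal_law. len (cell f w \<inter> great_circle y \<inter> hemisphere True x) +
      len (cell f w \<inter> great_circle y \<inter> hemisphere False x) = len (cell f w \<inter> great_circle y)" (is ?AE)
    and len_half_circle: "length w = 1 \<Longrightarrow> len (cell f w \<inter> great_circle y) = 1 \<and> cell f w \<inter> great_circle y \<noteq> {}"
      (is "_ \<Longrightarrow> ?len")
proof -
  obtain v b where wv: "w = v @ [b]" using w by (cases w rule: rev_cases) auto
  define h where "h = (if b then f [] else - f [])"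
  have h: "h \<in> sphere2" "great_circle h = great_circle (f [])" "y \<in> sphere2" "great_circle y \<noteq> great_circle (f [])"
    using gen by (auto simp: h_def splits_generically_def)
  then obtain a d where "half_circle y h a d" using half_circle_exists[OF h(3,1)] by metis
  then interpret half_circle_law \<kappa> y h a d
    using isotropic_measure_axioms by (simp add: half_circle_law_def)
  have seg: "segment (cell f w \<inter> great_circle y)"
    unfolding wv by (rule segment_cell[where f=f and b=b and v=v, OF h_def]) (use gen in \<open>auto simp: splits_generically_def wv\<close>)
  have polyp: "random_polytope (borel :: (real^3) measure) (\<lambda>_. cell f w \<inter> great_circle y)"
    by (rule random_polytope_great_circle[OF poly]) simp
  show ?step if "cell f w \<inter> great_circle y \<noteq> {}" "G \<in> borel_measurable borel"
    by (rule nn_integral_segment_step[OF seg polyp poly _ that]) simp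
  show ?AE using AE_inner_a by eventually_elim (rule len_split[OF seg polyp])
  show ?len if "length w = 1"
  proof -
    have "v = []" using that wv by simp
    then have "cell f w \<inter> great_circle y = arc"
      unfolding arc_def by (cases b) (auto simp: h_def wv great_circle_def hemisphere_def)
    moreover have "arc \<noteq> {}" using image_arc by auto
    ultimately show ?thesis using len_arc by simp
  qed
qed

lemma len_sphere: "len sphere2 = 1"
proof -
  have "AE x in normal_law. x \<in> {x. great_circle x \<inter> sphere2 \<noteq> {}}"
    using AE_normal_in_sphere
  proof eventually_elim
    case (elim x)
    obtain q where q: "q \<noteq> 0" "orthogonal x q"
      using orthogonal_to_vector_exists[of x] by auto
    then have "q /\<^sub>R norm q \<in> great_circle x \<inter> sphere2" by (auto simp: great_circle_def orthogonal_def)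
    then show ?case by blast
  qed
  moreover have "{x. great_circle x \<inter> sphere2 \<noteq> {}} \<in> sets borel" by (rule hits_set) simp
  ultimately show ?thesis unfolding len_def by (simp add: normal_law.prob_eq_1)
qed

end

context splitting_process
begin

text \<open>The expected weight at time \<open>s\<close> of all pieces of the circle of
  \<open>y\<close> that stem from this cell, given the past up to its birth.\<close>

definition alive :: "real \<Rightarrow> real^3 \<Rightarrow> real \<Rightarrow> bool list \<Rightarrow> 'a \<Rightarrow> ennreal"
  where "alive \<theta> y s w \<omega> = (if birth w \<omega> \<le> s \<and> C w \<omega> \<inter> great_circle y \<noteq> {}
    then ennreal (edge_count \<theta> (s - birth w \<omega>) (len (C w \<omega> \<inter> great_circle y))) else 0)"

text \<open>This has two readings: the expected weight of the piece when the cell must still be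
  uncut at time \<open>s\<close>, and the weighted intensity with respect to \<open>base\<close>
  that the cell is split at time \<open>s\<close> along the circle of \<open>y\<close> (see
  \<open>edge_weight\<close>). In the second reading the rate of the cell cancels as in
  \<open>mark_density\<close>.\<close>

definition dying :: "real \<Rightarrow> real^3 \<Rightarrow> real \<Rightarrow> bool list \<Rightarrow> 'a \<Rightarrow> ennreal"
  where "dying \<theta> y s w \<omega> = (if birth w \<omega> \<le> s \<and> C w \<omega> \<inter> great_circle y \<noteq> {}
    then ennreal (exp (- len (C w \<omega>) * (s - birth w \<omega>)) * exp (- (\<theta> * len (C w \<omega> \<inter> great_circle y)))) else 0)"

lemma past_cut:
  assumes "length w \<le> k"
  shows "random_polytope (past k) (\<lambda>\<omega>. C w \<omega> \<inter> great_circle y)"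
  by (rule random_polytope_great_circle[OF past_cell[OF assms]]) simp

lemma alive_measurable [measurable]: "alive \<theta> y s w \<in> borel_measurable \<Omega>"
proof -
  note [measurable] = past_birth[OF order_refl, of w] len_measurable[OF past_cut[OF order_refl], of w y]
    random_polytope_nonempty[OF past_cut[OF order_refl], of w y]
  have [measurable]: "(\<lambda>\<omega>. edge_count \<theta> (s - birth w \<omega>) (len (C w \<omega> \<inter> great_circle y))) \<in> borel_measurable (past (length w))"
    unfolding edge_count_def by measurable
  have "alive \<theta> y s w \<in> borel_measurable (past (length w))" unfolding alive_def by measurable
  then show ?thesis by (rule measurable_past)
qed

lemma AE_splits_generically:
  assumes y: "y \<in> sphere2"
  shows "AE \<omega> in \<Omega>. \<forall>w. splits_generically (\<lambda>v. N v \<omega>) w y"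
proof -
  have neq: "AE \<omega> in \<Omega>. great_circle (N w \<omega>) \<noteq> great_circle y" for w
    using y by (intro AE_normal_neq) auto
  have "AE \<omega> in \<Omega>. great_circle (N i \<omega>) \<inter> great_circle (N [] \<omega>) \<inter> great_circle y = {}" if "i \<noteq> []" for i
    using that y by (intro AE_triple_empty past_normal normal_in_sphere neq) auto
  then have "AE \<omega> in \<Omega>. \<forall>i. i \<noteq> [] \<longrightarrow> great_circle (N i \<omega>) \<inter> great_circle (N [] \<omega>) \<inter> great_circle y = {}"
    unfolding AE_all_countable by (auto intro: AE_impI)
  with neq[of "[]"] AE_space show ?thesis
    by eventually_elim (use y normal_in_sphere in \<open>auto simp: splits_generically_def\<close>)
qed

text \<open>Replacing a normal by its negative swaps the two halves, which a symmetric expression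
  does not see.\<close>

lemma hemisphere_mark_sum:
  fixes F :: "(real^3) set \<Rightarrow> ennreal"
  shows "(\<Sum>b\<in>UNIV. F (A \<inter> hemisphere b (snd (mark w \<omega>)))) = (\<Sum>b\<in>UNIV. F (A \<inter> hemisphere b (N w \<omega>)))"
  using representative_cases[of "N w \<omega>"] by (auto simp: mark_def UNIV_bool add.commute)

text \<open>A piece at time \<open>s\<close> belongs to the cell of \<open>w\<close> if that is
  still uncut, and otherwise to one of its children. Given the past this is
  \<open>nn_integral_edge_count_step\<close>, after \<open>nn_integral_cell_step\<close> has
  averaged over the cutting circle.\<close>

lemma intensity_step:
  assumes y: "y \<in> sphere2" and \<theta>: "0 \<le> \<theta>" and w: "w \<noteq> []"
  shows "(\<integral>\<^sup>+\<omega>. alive \<theta> y s w \<omega> \<partial>\<Omega>) =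
    (\<integral>\<^sup>+\<omega>. dying \<theta> y s w \<omega> \<partial>\<Omega>) + (\<Sum>b\<in>UNIV. \<integral>\<^sup>+\<omega>. alive \<theta> y s (b # w) \<omega> \<partial>\<Omega>)"
proof -
  define k where "k = length w"
  let ?P = "past k \<Otimes>\<^sub>M (borel \<Otimes>\<^sub>M borel) :: ('a \<times> real \<times> (real^3)) measure"
  let ?p = "\<lambda>\<omega>. C w \<omega> \<inter> great_circle y"
  define h where "h r A = (if r \<le> s \<and> A \<noteq> {} then ennreal (edge_count \<theta> (s - r) (len A)) else 0)" for r A
  define g where "g \<omega> z = (\<Sum>b\<in>UNIV. h (birth w \<omega> + fst z) (?p \<omega> \<inter> hemisphere b (snd z)))" for \<omega> and z :: "real \<times> (real^3)"
  have gm: "(\<lambda>(\<omega>, z). g \<omega> z) \<in> borel_measurable ?P"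
  proof -
    have poly: "random_polytope ?P (\<lambda>z. ?p (fst z) \<inter> hemisphere b (snd (snd z)))" for b
      by (rule random_polytope_hemisphere[OF random_polytope_compose[OF past_cut measurable_fst]]) (auto simp: k_def)
    note [measurable] = len_measurable[OF poly] random_polytope_nonempty[OF poly] past_birth[of w k]
    have [measurable]: "birth w \<in> borel_measurable (past k)" by (rule past_birth) (simp add: k_def)
    have [measurable]: "(\<lambda>z. edge_count \<theta> (s - (birth w (fst z) + fst (snd z))) (len (?p (fst z) \<inter> hemisphere b (snd (snd z))))) \<in> borel_measurable ?P" for b
      unfolding edge_count_def by measurable
    show ?thesis unfolding g_def h_def case_prod_unfold by measurable
  qed
  have "(\<Sum>b\<in>UNIV. \<integral>\<^sup>+\<omega>. alive \<theta> y s (b # w) \<omega> \<partial>\<Omega>) = (\<integral>\<^sup>+\<omega>. (\<Sum>b\<in>UNIV. alive \<theta> y s (b # w) \<omega>) \<partial>\<Omega>)"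
    by (rule nn_integral_sum[symmetric]) measurable
  also have "\<dots> = (\<integral>\<^sup>+\<omega>. g \<omega> (mark w \<omega>) \<partial>\<Omega>)"
  proof (rule nn_integral_cong)
    fix \<omega>
    have "alive \<theta> y s (b # w) \<omega> = h (birth w \<omega> + \<tau> w \<omega>) (?p \<omega> \<inter> hemisphere b (N w \<omega>))" for b
    proof -
      have "C (b # w) \<omega> \<inter> great_circle y = ?p \<omega> \<inter> hemisphere b (N w \<omega>)" by auto
      then show ?thesis by (simp add: alive_def h_def)
    qed
    then show "(\<Sum>b\<in>UNIV. alive \<theta> y s (b # w) \<omega>) = g \<omega> (mark w \<omega>)"
      unfolding g_def hemisphere_mark_sum by (simp add: mark_def)
  qed
  also have "\<dots> = (\<integral>\<^sup>+\<omega>. \<integral>\<^sup>+z. mark_density w \<omega> z * g \<omega> z \<partial>base \<partial>\<Omega>)"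
    by (rule mark_law[of w k]) (use gm in \<open>auto simp: k_def\<close>)
  finally have children: "(\<Sum>b\<in>UNIV. \<integral>\<^sup>+\<omega>. alive \<theta> y s (b # w) \<omega> \<partial>\<Omega>) = \<dots>" .
  have dm: "dying \<theta> y s w \<in> borel_measurable \<Omega>"
  proof -
    note [measurable] = past_birth[OF order_refl, of w] len_measurable[OF past_cut[OF order_refl], of w y]
      random_polytope_nonempty[OF past_cut[OF order_refl], of w y] past_len[OF order_refl, of w]
    have "dying \<theta> y s w \<in> borel_measurable (past (length w))" unfolding dying_def by measurable
    then show ?thesis by (rule measurable_past)
  qed
  have gm2: "(\<lambda>\<omega>. \<integral>\<^sup>+z. mark_density w \<omega> z * g \<omega> z \<partial>base) \<in> borel_measurable \<Omega>"
    by (rule measurable_past[OF mark_density_integral_measurable[OF _ gm]]) (simp add: k_def)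
  have "(\<integral>\<^sup>+\<omega>. dying \<theta> y s w \<omega> \<partial>\<Omega>) + (\<integral>\<^sup>+\<omega>. \<integral>\<^sup>+z. mark_density w \<omega> z * g \<omega> z \<partial>base \<partial>\<Omega>) =
    (\<integral>\<^sup>+\<omega>. dying \<theta> y s w \<omega> + (\<integral>\<^sup>+z. mark_density w \<omega> z * g \<omega> z \<partial>base) \<partial>\<Omega>)"
    by (rule nn_integral_add[symmetric, OF dm gm2])
  also have "\<dots> = (\<integral>\<^sup>+\<omega>. alive \<theta> y s w \<omega> \<partial>\<Omega>)"
  proof (rule nn_integral_cong_AE)
    show "AE \<omega> in \<Omega>. dying \<theta> y s w \<omega> + (\<integral>\<^sup>+z. mark_density w \<omega> z * g \<omega> z \<partial>base) = alive \<theta> y s w \<omega>"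
      using AE_space AE_splits_generically[OF y]
    proof eventually_elim
      case (elim \<omega>)
      note \<omega> = elim(1)
      have gen: "splits_generically (\<lambda>v. N v \<omega>) w y" using elim by blast
      define p where "p = ?p \<omega>"
      define l where "l = len p"
      define \<Lambda> where "\<Lambda> = len (C w \<omega>)"
      define b where "b = birth w \<omega>"
      have l: "0 \<le> l" "l \<le> \<Lambda>" unfolding l_def \<Lambda>_def p_def by (auto intro!: len_mono const_cell \<omega>)
      have "(\<lambda>z. (\<omega>, z)) \<in> measurable (borel \<Otimes>\<^sub>M borel) ?P" by (rule measurable_Pair1') (use \<omega> in simp)
      from measurable_compose[OF this gm] have gy: "g \<omega> \<in> borel_measurable (borel \<Otimes>\<^sub>M borel)" by simp
      show ?case
      proof (cases "p = {} \<or> s < b")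
        \<comment> \<open>Nothing arises from an empty segment or from a cell born after
          \<open>s\<close>, so all three terms vanish.\<close>
        case True
        have "h (b + T) (p \<inter> A) = 0" if "0 \<le> T" for T A using True that by (auto simp: h_def)
        then have z: "indicator {0..} T * g \<omega> (T, x) = 0" for T x by (simp add: g_def p_def b_def indicator_def)
        have "(\<integral>\<^sup>+z. mark_density w \<omega> z * g \<omega> z \<partial>base) = (\<integral>\<^sup>+z. 0 \<partial>base)"
        proof (rule nn_integral_cong)
          fix z :: "real \<times> (real^3)"
          obtain T x where "z = (T, x)" by (cases z)
          then show "mark_density w \<omega> z * g \<omega> z = 0" using z[of T x] by (auto simp: mark_density_def indicator_def)
        qed
        moreover have "dying \<theta> y s w \<omega> = 0" "alive \<theta> y s w \<omega> = 0"
          using True by (auto simp: dying_def alive_def p_def b_def)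
        ultimately show ?thesis by simp
      next
        case False
        then have ne: "p \<noteq> {}" and R: "0 \<le> s - b" by auto
        define R where "R = s - b"
        have "(\<integral>\<^sup>+z. mark_density w \<omega> z * g \<omega> z \<partial>base) = (\<integral>\<^sup>+T. ennreal (exp (- \<Lambda> * T)) * indicator {0..} T *
          (\<integral>\<^sup>+x. indicator {x. great_circle x \<inter> C w \<omega> \<noteq> {}} x * g \<omega> (T, x) \<partial>normal_law) \<partial>lborel)"
          unfolding \<Lambda>_def by (rule nn_integral_mark_density[OF \<omega> gy])
        also have "\<dots> = (\<integral>\<^sup>+T. ennreal (exp (- \<Lambda> * T) * ((\<Lambda> - l) * edge_count \<theta> (R - T) l + 2 * edge_count_primitive \<theta> (R - T) l))
          * indicator {0..R} T \<partial>lborel)"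
        proof (rule nn_integral_cong)
          fix T :: real
          show "ennreal (exp (- \<Lambda> * T)) * indicator {0..} T *
              (\<integral>\<^sup>+x. indicator {x. great_circle x \<inter> C w \<omega> \<noteq> {}} x * g \<omega> (T, x) \<partial>normal_law) =
            ennreal (exp (- \<Lambda> * T) * ((\<Lambda> - l) * edge_count \<theta> (R - T) l + 2 * edge_count_primitive \<theta> (R - T) l)) * indicator {0..R} T"
          proof (cases "0 \<le> T \<and> T \<le> R")
            case True
            have pos: "0 \<le> edge_count \<theta> (R - T) l" "0 \<le> edge_count_primitive \<theta> (R - T) l"
              using edge_count_bounds(1)[OF \<theta> _ l(1)] edge_count_primitive_nonneg[OF \<theta> _ l(1)] True by auto
            have geq: "g \<omega> (T, x) = (\<Sum>b\<in>UNIV. if p \<inter> hemisphere b x = {} then 0 else ennreal (edge_count \<theta> (R - T) (len (p \<inter> hemisphere b x))))" for x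
              using True by (auto simp: g_def h_def p_def b_def R_def diff_diff_eq intro!: sum.cong)
            have [measurable]: "(\<lambda>u. ennreal (edge_count \<theta> (R - T) u)) \<in> borel_measurable borel"
              unfolding edge_count_def by measurable
            have "(\<integral>\<^sup>+x. indicator {x. great_circle x \<inter> C w \<omega> \<noteq> {}} x * g \<omega> (T, x) \<partial>normal_law) =
              ennreal (\<Lambda> - l) * ennreal (edge_count \<theta> (R - T) l) + 2 * (\<integral>\<^sup>+u. ennreal (edge_count \<theta> (R - T) u) * indicator {0..l} u \<partial>lborel)"
              unfolding geq l_def p_def \<Lambda>_def
              by (rule nn_integral_cell_step[OF gen w const_cell[OF \<omega>]]) (use ne in \<open>simp_all add: p_def\<close>)
            also have "\<dots> = ennreal ((\<Lambda> - l) * edge_count \<theta> (R - T) l + 2 * edge_count_primitive \<theta> (R - T) l)"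
              using True \<theta> l pos by (simp add: nn_integral_edge_count ennreal_mult ennreal_plus flip: ennreal_numeral)
            finally show ?thesis using True l pos by (simp add: ennreal_mult)
          next
            case False
            have "indicator {0..} T * g \<omega> (T, x) = 0" for x
              using False by (auto simp: g_def h_def indicator_def R_def b_def)
            then have "(\<integral>\<^sup>+x. indicator {x. great_circle x \<inter> C w \<omega> \<noteq> {}} x * g \<omega> (T, x) \<partial>normal_law) = 0 \<or> \<not> 0 \<le> T"
              by (auto simp: indicator_def)
            then show ?thesis using False by (auto simp: indicator_def)
          qed
        qed
        finally have I: "(\<integral>\<^sup>+z. mark_density w \<omega> z * g \<omega> z \<partial>base) = \<dots>" .
        have "dying \<theta> y s w \<omega> = ennreal (exp (- \<Lambda> * R) * exp (- (\<theta> * l)))"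
          using ne R by (simp add: dying_def p_def b_def R_def l_def \<Lambda>_def)
        moreover have "alive \<theta> y s w \<omega> = ennreal (edge_count \<theta> R l)"
          using ne R by (simp add: alive_def p_def b_def R_def l_def)
        ultimately show ?thesis unfolding I
          using nn_integral_edge_count_step[OF \<theta> R[folded R_def] l] by (simp add: add.commute)
      qed
    qed
  qed
  finally show ?thesis unfolding children by simp
qed

text \<open>Both cells of the first generation meet the circle of \<open>y\<close> in half circles
  of length one, and the root splits at rate one; hence the value is the same for every
  \<open>y\<close>.\<close>

lemma intensity_first_generation:
  assumes y: "y \<in> sphere2"
  shows "(\<integral>\<^sup>+\<omega>. alive \<theta> y s [b] \<omega> \<partial>\<Omega>) =
    (\<integral>\<^sup>+T. ennreal (exp (- T)) * ennreal (edge_count \<theta> (s - T) 1) * indicator {0..s} T \<partial>lborel)"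
proof -
  define g where "g z = (if fst z \<le> s then ennreal (edge_count \<theta> (s - fst z) 1) else 0)" for z :: "real \<times> (real^3)"
  have [measurable]: "g \<in> borel_measurable (borel \<Otimes>\<^sub>M borel)"
    unfolding g_def edge_count_def by measurable
  have "(\<integral>\<^sup>+\<omega>. alive \<theta> y s [b] \<omega> \<partial>\<Omega>) = (\<integral>\<^sup>+\<omega>. g (mark [] \<omega>) \<partial>\<Omega>)"
  proof (rule nn_integral_cong_AE)
    show "AE \<omega> in \<Omega>. alive \<theta> y s [b] \<omega> = g (mark [] \<omega>)"
      using AE_space AE_splits_generically[OF y]
    proof eventually_elim
      case (elim \<omega>)
      have "len (C [b] \<omega> \<inter> great_circle y) = 1 \<and> C [b] \<omega> \<inter> great_circle y \<noteq> {}"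
        using elim by (intro len_half_circle const_cell) auto
      then show ?case by (simp add: alive_def g_def mark_def)
    qed
  qed
  also have "\<dots> = (\<integral>\<^sup>+\<omega>. \<integral>\<^sup>+z. mark_density [] \<omega> z * g z \<partial>base \<partial>\<Omega>)"
    by (rule mark_law[of "[]" 0 "\<lambda>_. g"]) (auto simp: case_prod_unfold)
  also have "\<dots> = (\<integral>\<^sup>+\<omega>. (\<integral>\<^sup>+T. ennreal (exp (- T)) * ennreal (edge_count \<theta> (s - T) 1) * indicator {0..s} T \<partial>lborel) \<partial>\<Omega>)"
  proof (rule nn_integral_cong)
    fix \<omega> assume \<omega>: "\<omega> \<in> space \<Omega>"
    note [measurable] = hits_set[OF const_cell[OF \<omega>, of _ "[]"]]
    have e: "emeasure normal_law {x. great_circle x \<inter> sphere2 \<noteq> {}} = 1"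
      using emeasure_hits[of sphere2] by (simp add: len_sphere)
    have "(\<integral>\<^sup>+z. mark_density [] \<omega> z * g z \<partial>base) = (\<integral>\<^sup>+T. ennreal (exp (- len (C [] \<omega>) * T)) * indicator {0..} T *
      (\<integral>\<^sup>+x. indicator {x. great_circle x \<inter> C [] \<omega> \<noteq> {}} x * g (T, x) \<partial>normal_law) \<partial>lborel)"
      by (rule nn_integral_mark_density[OF \<omega>]) measurable
    also have "\<dots> = (\<integral>\<^sup>+T. ennreal (exp (- T)) * ennreal (edge_count \<theta> (s - T) 1) * indicator {0..s} T \<partial>lborel)"
    proof (rule nn_integral_cong)
      fix T :: real
      have "(\<integral>\<^sup>+x. indicator {x. great_circle x \<inter> C [] \<omega> \<noteq> {}} x * g (T, x) \<partial>normal_law) =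
        (\<integral>\<^sup>+x. indicator {x. great_circle x \<inter> sphere2 \<noteq> {}} x * (if T \<le> s then ennreal (edge_count \<theta> (s - T) 1) else 0) \<partial>normal_law)"
        by (simp add: g_def)
      also have "\<dots> = (if T \<le> s then ennreal (edge_count \<theta> (s - T) 1) else 0)"
        using hits_set[OF const_cell[OF \<omega>, of _ "[]"]] by (subst nn_integral_multc) (auto simp: e)
      finally show "ennreal (exp (- len (C [] \<omega>) * T)) * indicator {0..} T *
          (\<integral>\<^sup>+x. indicator {x. great_circle x \<inter> C [] \<omega> \<noteq> {}} x * g (T, x) \<partial>normal_law) =
        ennreal (exp (- T)) * ennreal (edge_count \<theta> (s - T) 1) * indicator {0..s} T"
        by (simp add: len_sphere indicator_def)
    qed
    finally show "(\<integral>\<^sup>+z. mark_density [] \<omega> z * g z \<partial>base) = \<dots>" .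
  qed
  also have "\<dots> = (\<integral>\<^sup>+T. ennreal (exp (- T)) * ennreal (edge_count \<theta> (s - T) 1) * indicator {0..s} T \<partial>lborel)"
    by (simp add: \<Omega>.emeasure_space_1)
  finally show ?thesis .
qed

lemma sum_words_Suc:
  fixes F :: "bool list \<Rightarrow> ennreal"
  shows "(\<Sum>w | length w = Suc k. F w) = (\<Sum>w | length w = k. \<Sum>b\<in>UNIV. F (b # w))"
proof -
  have "{w :: bool list. length w = Suc k} = (\<lambda>(w, b). b # w) ` ({w. length w = k} \<times> UNIV)"
    by (auto simp: length_Suc_conv image_iff)
  then have "(\<Sum>w | length w = Suc k. F w) = (\<Sum>(w, b)\<in>{w. length w = k} \<times> UNIV. F (b # w))"
    by (simp add: sum.reindex inj_on_def case_prod_unfold o_def)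
  then show ?thesis by (simp add: sum.cartesian_product)
qed

text \<open>Controls the remainder of the telescoping sum: \<open>edge_count\<close> is at most
  \<open>1 + s\<close> here, and births before \<open>s\<close> become geometrically rare.\<close>

lemma sum_alive_le:
  assumes \<theta>: "0 \<le> \<theta>" and s: "0 \<le> s"
  shows "(\<Sum>w | length w = k. \<integral>\<^sup>+\<omega>. alive \<theta> y s w \<omega> \<partial>\<Omega>) \<le> ennreal ((1 + s) * exp (3 * s) * (1 / 2) ^ k)"
proof -
  have "(\<Sum>w | length w = k. \<integral>\<^sup>+\<omega>. alive \<theta> y s w \<omega> \<partial>\<Omega>) \<le>
    (\<Sum>w | length w = k. ennreal (1 + s) * emeasure \<Omega> {\<omega> \<in> space \<Omega>. birth w \<omega> \<le> s})"
  proof (rule sum_mono)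
    fix w
    have "(\<integral>\<^sup>+\<omega>. alive \<theta> y s w \<omega> \<partial>\<Omega>) \<le> (\<integral>\<^sup>+\<omega>. ennreal (1 + s) * indicator {\<omega> \<in> space \<Omega>. birth w \<omega> \<le> s} \<omega> \<partial>\<Omega>)"
    proof (rule nn_integral_mono_AE)
      have "AE \<omega> in \<Omega>. \<forall>v. 0 < \<tau> v \<omega>" unfolding AE_all_countable using AE_lifetime_pos by blast
      with AE_space show "AE \<omega> in \<Omega>. alive \<theta> y s w \<omega> \<le> ennreal (1 + s) * indicator {\<omega> \<in> space \<Omega>. birth w \<omega> \<le> s} \<omega>"
      proof eventually_elim
        case (elim \<omega>)
        have b0: "0 \<le> birth w \<omega>" by (induction w) (use elim(2) in \<open>auto intro: add_nonneg_nonneg less_imp_le\<close>)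
        show ?case
        proof (cases "birth w \<omega> \<le> s")
          case True
          have "(s - birth w \<omega>) * len (C w \<omega> \<inter> great_circle y) \<le> s * 1"
            using True b0 by (intro mult_mono) auto
          then have "edge_count \<theta> (s - birth w \<omega>) (len (C w \<omega> \<inter> great_circle y)) \<le> 1 + s"
            using edge_count_bounds(2)[OF \<theta>, of "s - birth w \<omega>" "len (C w \<omega> \<inter> great_circle y)"] True by simp
          then show ?thesis using elim(1) True by (auto simp: alive_def ennreal_leI)
        qed (simp add: alive_def)
      qed
    qed
    also have "\<dots> = ennreal (1 + s) * emeasure \<Omega> {\<omega> \<in> space \<Omega>. birth w \<omega> \<le> s}"
      by (subst nn_integral_cmult) auto
    finally show "(\<integral>\<^sup>+\<omega>. alive \<theta> y s w \<omega> \<partial>\<Omega>) \<le> ennreal (1 + s) * emeasure \<Omega> {\<omega> \<in> space \<Omega>. birth w \<omega> \<le> s}" .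
  qed
  also have "\<dots> = ennreal (1 + s) * (\<Sum>w | length w = k. emeasure \<Omega> {\<omega> \<in> space \<Omega>. birth w \<omega> \<le> s})"
    by (rule sum_distrib_left[symmetric])
  also have "\<dots> \<le> ennreal (1 + s) * ennreal (exp (3 * s) * (1 / 2) ^ k)"
    by (rule mult_left_mono[OF sum_emeasure_birth_le]) simp
  also have "ennreal (1 + s) * ennreal (exp (3 * s) * (1 / 2) ^ k) = ennreal ((1 + s) * exp (3 * s) * (1 / 2) ^ k)"
    using s by (subst ennreal_mult[symmetric]) (auto simp: mult.assoc)
  finally show ?thesis .
qed

text \<open>Telescoping of \<open>intensity_step\<close> over all generations from the first
  on.\<close>

lemma intensity:
  assumes y: "y \<in> sphere2" and \<theta>: "0 \<le> \<theta>" and s: "0 \<le> s"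
  shows "(\<Sum>k. \<Sum>w | length w = Suc k. \<integral>\<^sup>+\<omega>. dying \<theta> y s w \<omega> \<partial>\<Omega>) =
    2 * (\<integral>\<^sup>+T. ennreal (exp (- T)) * ennreal (edge_count \<theta> (s - T) 1) * indicator {0..s} T \<partial>lborel)"
proof -
  define A where "A k = (\<Sum>w | length w = k. \<integral>\<^sup>+\<omega>. alive \<theta> y s w \<omega> \<partial>\<Omega>)" for k
  define D where "D k = (\<Sum>w | length w = k. \<integral>\<^sup>+\<omega>. dying \<theta> y s w \<omega> \<partial>\<Omega>)" for k
  have step: "A (Suc k) = D (Suc k) + A (Suc (Suc k))" for k
  proof -
    have "A (Suc k) = (\<Sum>w | length w = Suc k. (\<integral>\<^sup>+\<omega>. dying \<theta> y s w \<omega> \<partial>\<Omega>) + (\<Sum>b\<in>UNIV. \<integral>\<^sup>+\<omega>. alive \<theta> y s (b # w) \<omega> \<partial>\<Omega>))"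
      unfolding A_def by (intro sum.cong refl intensity_step[OF y \<theta>]) auto
    then show ?thesis unfolding A_def D_def sum_words_Suc[where k="Suc k"] sum.distrib by simp
  qed
  have partial: "A 1 = (\<Sum>k<n. D (Suc k)) + A (Suc n)" for n
  proof (induction n)
    case (Suc n)
    then show ?case using step[of n] by (simp add: add.assoc)
  qed simp
  have A0: "A \<longlonglongrightarrow> 0"
  proof (rule tendsto_sandwich[OF _ _ tendsto_const])
    show "eventually (\<lambda>k. A k \<le> ennreal ((1 + s) * exp (3 * s) * (1 / 2) ^ k)) sequentially"
      unfolding A_def using sum_alive_le[OF \<theta> s] by simp
    have "(\<lambda>k. (1 + s) * exp (3 * s) * (1 / 2) ^ k) \<longlonglongrightarrow> (1 + s) * exp (3 * s) * 0"
      by (intro tendsto_intros LIMSEQ_power_zero) simp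
    then have "(\<lambda>k. ennreal ((1 + s) * exp (3 * s) * (1 / 2) ^ k)) \<longlonglongrightarrow> ennreal 0"
      by (intro tendsto_ennrealI) simp
    then show "(\<lambda>k. ennreal ((1 + s) * exp (3 * s) * (1 / 2) ^ k)) \<longlonglongrightarrow> 0" by simp
  qed simp
  have "(\<lambda>n. (\<Sum>k<n. D (Suc k)) + A (Suc n)) \<longlonglongrightarrow> (\<Sum>k. D (Suc k)) + 0"
    by (intro tendsto_add LIMSEQ_Suc[OF A0] summable_LIMSEQ) simp
  then have "(\<lambda>n::nat. A 1) \<longlonglongrightarrow> (\<Sum>k. D (Suc k))" by (simp add: partial[symmetric])
  then have "(\<Sum>k. D (Suc k)) = A 1" using LIMSEQ_unique tendsto_const by metis
  also have "A 1 = (\<Sum>b\<in>UNIV. \<integral>\<^sup>+\<omega>. alive \<theta> y s [b] \<omega> \<partial>\<Omega>)"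
    unfolding A_def One_nat_def sum_words_Suc by simp
  finally show ?thesis by (simp add: D_def intensity_first_generation[OF y] UNIV_bool mult_2)
qed

lemma C_measurable: "random_polytope \<Omega> (C w)"
proof -
  have "(\<lambda>x. x) \<in> measurable \<Omega> (past (length w))"
    using measurable_from_subalg[OF subalgebra_past measurable_ident, of "length w"] by (simp add: id_def)
  from random_polytope_compose[OF past_cell[OF order_refl] this] show ?thesis .
qed

lemma dying_measurable:
  assumes [measurable]: "\<theta> \<in> borel_measurable borel"
  shows "(\<lambda>z. dying (\<theta> (fst (snd z))) (snd (snd z)) (fst (snd z)) w (fst z)) \<in> borel_measurable (\<Omega> \<Otimes>\<^sub>M base)"
proof -
  have poly: "random_polytope (\<Omega> \<Otimes>\<^sub>M base) (\<lambda>z. C w (fst z) \<inter> great_circle (snd (snd z)))"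
    by (rule random_polytope_great_circle[OF random_polytope_compose[OF C_measurable measurable_fst]]) measurable
  note [measurable] = len_measurable[OF poly] random_polytope_nonempty[OF poly] len_measurable[OF C_measurable, of w]
  show ?thesis unfolding dying_def by measurable
qed

text \<open>The mark is exchanged for its density and the lifetime shifted by the birth time. The
  new variable is the split time \<open>s\<close>, so a parameter \<theta> depending on it becomes a
  constant under the integral over \<Omega>.\<close>

lemma edge_weight:
  assumes [measurable]: "\<theta> \<in> borel_measurable borel"
  shows "(\<integral>\<^sup>+\<omega>. (if split w \<omega> \<le> t then ennreal (exp (- (\<theta> (split w \<omega>) * len (C w \<omega> \<inter> great_circle (N w \<omega>))))) else 0) \<partial>\<Omega>) =
    (\<integral>\<^sup>+y. (\<integral>\<^sup>+\<omega>. indicator {0..t} (fst y) * dying (\<theta> (fst y)) (snd y) (fst y) w \<omega> \<partial>\<Omega>) \<partial>base)"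
proof -
  define k where "k = length w"
  let ?P = "past k \<Otimes>\<^sub>M (borel \<Otimes>\<^sub>M borel) :: ('a \<times> real \<times> (real^3)) measure"
  define g where "g \<omega> z = (if birth w \<omega> + fst z \<le> t
    then ennreal (exp (- (\<theta> (birth w \<omega> + fst z) * len (C w \<omega> \<inter> great_circle (snd z))))) else 0)" for \<omega> and z :: "real \<times> (real^3)"
  have gm: "(\<lambda>(\<omega>, z). g \<omega> z) \<in> borel_measurable ?P"
  proof -
    have poly: "random_polytope ?P (\<lambda>z. C w (fst z) \<inter> great_circle (snd (snd z)))"
      by (rule random_polytope_great_circle[OF random_polytope_compose[OF past_cell measurable_fst]]) (auto simp: k_def)
    have [measurable]: "birth w \<in> borel_measurable (past k)" by (rule past_birth) (simp add: k_def)
    note [measurable] = len_measurable[OF poly]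
    show ?thesis unfolding g_def case_prod_unfold by measurable
  qed
  have "(\<integral>\<^sup>+\<omega>. (if split w \<omega> \<le> t then ennreal (exp (- (\<theta> (split w \<omega>) * len (C w \<omega> \<inter> great_circle (N w \<omega>))))) else 0) \<partial>\<Omega>)
    = (\<integral>\<^sup>+\<omega>. g \<omega> (mark w \<omega>) \<partial>\<Omega>)"
    by (rule nn_integral_cong) (simp add: g_def mark_def split_time_def)
  also have "\<dots> = (\<integral>\<^sup>+\<omega>. \<integral>\<^sup>+z. mark_density w \<omega> z * g \<omega> z \<partial>base \<partial>\<Omega>)"
    by (rule mark_law[of w k]) (use gm in \<open>auto simp: k_def\<close>)
  also have "\<dots> = (\<integral>\<^sup>+\<omega>. (\<integral>\<^sup>+y. indicator {0..t} (fst y) * dying (\<theta> (fst y)) (snd y) (fst y) w \<omega> \<partial>base) \<partial>\<Omega>)"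
  proof (rule nn_integral_cong_AE)
    have "AE \<omega> in \<Omega>. \<forall>v. 0 < \<tau> v \<omega>" unfolding AE_all_countable using AE_lifetime_pos by blast
    with AE_space show "AE \<omega> in \<Omega>. (\<integral>\<^sup>+z. mark_density w \<omega> z * g \<omega> z \<partial>base) =
      (\<integral>\<^sup>+y. indicator {0..t} (fst y) * dying (\<theta> (fst y)) (snd y) (fst y) w \<omega> \<partial>base)"
    proof eventually_elim
      case (elim \<omega>)
      note \<omega> = elim(1)
      define b where "b = birth w \<omega>"
      define \<Lambda> where "\<Lambda> = len (C w \<omega>)"
      have b0: "0 \<le> b" unfolding b_def by (induction w) (use elim(2) in \<open>auto intro: add_nonneg_nonneg less_imp_le\<close>)
      note [measurable] = hits_set[OF const_cell[OF \<omega>]]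
      have poly: "random_polytope (borel \<Otimes>\<^sub>M normal_law :: (real \<times> (real^3)) measure) (\<lambda>z. C w \<omega> \<inter> great_circle (snd z))"
        by (rule random_polytope_great_circle[OF const_cell[OF \<omega>]]) measurable
      note [measurable] = len_measurable[OF poly]
      define K where "K s = (\<integral>\<^sup>+x. indicator {x. great_circle x \<inter> C w \<omega> \<noteq> {}} x *
        (if s \<le> t then ennreal (exp (- (\<theta> s * len (C w \<omega> \<inter> great_circle x)))) else 0) \<partial>normal_law)" for s
      have [measurable]: "K \<in> borel_measurable borel"
      proof -
        have "(\<lambda>s. \<integral>\<^sup>+x. indicator {x. great_circle x \<inter> C w \<omega> \<noteq> {}} (snd (s, x)) *
          (if fst (s, x) \<le> t then ennreal (exp (- (\<theta> (fst (s, x)) * len (C w \<omega> \<inter> great_circle (snd (s, x)))))) else 0) \<partial>normal_law) \<in> borel_measurable borel"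
          by measurable
        then show ?thesis by (simp add: K_def[abs_def])
      qed
      define \<phi> where "\<phi> s = ennreal (exp (- \<Lambda> * (s - b))) * indicator {b..} s * K s" for s
      have [measurable]: "\<phi> \<in> borel_measurable borel" unfolding \<phi>_def by measurable
      have "(\<lambda>z. (\<omega>, z)) \<in> measurable (borel \<Otimes>\<^sub>M borel) ?P" by (rule measurable_Pair1') (use \<omega> in simp)
      from measurable_compose[OF this gm] have gy: "g \<omega> \<in> borel_measurable (borel \<Otimes>\<^sub>M borel)" by simp
      have "(\<integral>\<^sup>+z. mark_density w \<omega> z * g \<omega> z \<partial>base) = (\<integral>\<^sup>+T. ennreal (exp (- \<Lambda> * T)) * indicator {0..} T *
          (\<integral>\<^sup>+x. indicator {x. great_circle x \<inter> C w \<omega> \<noteq> {}} x * g \<omega> (T, x) \<partial>normal_law) \<partial>lborel)"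
        unfolding \<Lambda>_def by (rule nn_integral_mark_density[OF \<omega> gy])
      also have "\<dots> = (\<integral>\<^sup>+T. \<phi> (b + 1 * T) \<partial>lborel)"
        unfolding \<phi>_def K_def g_def b_def fst_conv snd_conv mult_1_left by (rule nn_integral_cong) (simp add: indicator_def)
      also have "\<dots> = (\<integral>\<^sup>+s. \<phi> s \<partial>lborel)"
        using nn_integral_real_affine[of \<phi> 1 b] by simp
      also have "\<dots> = (\<integral>\<^sup>+s. \<integral>\<^sup>+x. indicator {0..t} s * dying (\<theta> s) x s w \<omega> \<partial>normal_law \<partial>lborel)"
      proof (rule nn_integral_cong)
        fix s :: real
        have m: "(\<lambda>x. indicator {x. great_circle x \<inter> C w \<omega> \<noteq> {}} x * ennreal (exp (- (\<theta> s * len (C w \<omega> \<inter> great_circle x))))) \<in> borel_measurable normal_law"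
        proof -
          have "(\<lambda>x. (s, x)) \<in> measurable normal_law (borel \<Otimes>\<^sub>M normal_law)" by measurable
          from measurable_compose[OF this len_measurable[OF poly]]
          have [measurable]: "(\<lambda>x. len (C w \<omega> \<inter> great_circle x)) \<in> borel_measurable normal_law" by simp
          show ?thesis by measurable
        qed
        show "\<phi> s = (\<integral>\<^sup>+x. indicator {0..t} s * dying (\<theta> s) x s w \<omega> \<partial>normal_law)"
        proof (cases "b \<le> s \<and> s \<le> t")
          case True
          have "\<phi> s = ennreal (exp (- \<Lambda> * (s - b))) * (\<integral>\<^sup>+x. indicator {x. great_circle x \<inter> C w \<omega> \<noteq> {}} x * ennreal (exp (- (\<theta> s * len (C w \<omega> \<inter> great_circle x)))) \<partial>normal_law)"
            using True by (simp add: \<phi>_def K_def)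
          also have "\<dots> = (\<integral>\<^sup>+x. ennreal (exp (- \<Lambda> * (s - b))) * (indicator {x. great_circle x \<inter> C w \<omega> \<noteq> {}} x * ennreal (exp (- (\<theta> s * len (C w \<omega> \<inter> great_circle x))))) \<partial>normal_law)"
            by (rule nn_integral_cmult[symmetric, OF m])
          also have "\<dots> = (\<integral>\<^sup>+x. indicator {0..t} s * dying (\<theta> s) x s w \<omega> \<partial>normal_law)"
            using True b0 by (intro nn_integral_cong) (auto simp: dying_def indicator_def b_def \<Lambda>_def Int_commute ennreal_mult)
          finally show ?thesis .
        next
          case False
          then have "\<phi> s = 0" by (auto simp: \<phi>_def K_def indicator_def)
          moreover have "(\<integral>\<^sup>+x. indicator {0..t} s * dying (\<theta> s) x s w \<omega> \<partial>normal_law) = (\<integral>\<^sup>+x. 0 \<partial>normal_law)"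
            using False by (intro nn_integral_cong) (auto simp: dying_def indicator_def b_def)
          ultimately show ?thesis by simp
        qed
      qed
      also have "\<dots> = (\<integral>\<^sup>+y. indicator {0..t} (fst y) * dying (\<theta> (fst y)) (snd y) (fst y) w \<omega> \<partial>base)"
      proof -
        have "(\<lambda>y. (\<omega>, y)) \<in> measurable base (\<Omega> \<Otimes>\<^sub>M base)" by (rule measurable_Pair1') (use \<omega> in simp)
        from measurable_compose[OF this dying_measurable[of \<theta> w]]
        have [measurable]: "(\<lambda>y. dying (\<theta> (fst y)) (snd y) (fst y) w \<omega>) \<in> borel_measurable (lborel \<Otimes>\<^sub>M normal_law)"
          by (simp add: base_def)
        show ?thesis unfolding base_def by (subst normal_law.nn_integral_fst[symmetric]) auto
      qed
      finally show ?case .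
    qed
  qed
  also have "\<dots> = (\<integral>\<^sup>+y. (\<integral>\<^sup>+\<omega>. indicator {0..t} (fst y) * dying (\<theta> (fst y)) (snd y) (fst y) w \<omega> \<partial>\<Omega>) \<partial>base)"
  proof -
    interpret pair_sigma_finite \<Omega> base ..
    note [measurable] = dying_measurable[of \<theta> w]
    have "(\<lambda>z. indicator {0..t} (fst (snd z)) * dying (\<theta> (fst (snd z))) (snd (snd z)) (fst (snd z)) w (fst z)) \<in> borel_measurable (\<Omega> \<Otimes>\<^sub>M base)"
      by measurable
    from Fubini[OF this] show ?thesis by simp
  qed
  finally show ?thesis .
qed

text \<open>Summing \<open>edge_weight\<close> over all words except the root. By
  \<open>intensity\<close> the inner value does not depend on the circle, so averaging over circles
  changes nothing.\<close>

lemma edges_total: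
  assumes [measurable]: "\<theta> \<in> borel_measurable borel" and \<theta>: "\<And>s. 0 \<le> s \<Longrightarrow> s \<le> t \<Longrightarrow> 0 \<le> \<theta> s"
  shows "(\<Sum>k. \<Sum>w | length w = Suc k. \<integral>\<^sup>+\<omega>. (if split w \<omega> \<le> t then ennreal (exp (- (\<theta> (split w \<omega>) * len (C w \<omega> \<inter> great_circle (N w \<omega>))))) else 0) \<partial>\<Omega>) =
    (\<integral>\<^sup>+s. indicator {0..t} s * (2 * (\<integral>\<^sup>+T. ennreal (exp (- T)) * ennreal (edge_count (\<theta> s) (s - T) 1) * indicator {0..s} T \<partial>lborel)) \<partial>lborel)"
proof -
  define h where "h w y = (\<integral>\<^sup>+\<omega>. indicator {0..t} (fst y) * dying (\<theta> (fst y)) (snd y) (fst y) w \<omega> \<partial>\<Omega>)" for w and y :: "real \<times> (real^3)"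
  have hm [measurable]: "h w \<in> borel_measurable base" for w
  proof -
    have [measurable]: "(\<lambda>z. dying (\<theta> (fst (fst z))) (snd (fst z)) (fst (fst z)) w (snd z)) \<in> borel_measurable (base \<Otimes>\<^sub>M \<Omega>)"
      using measurable_compose[OF measurable_pair_swap' dying_measurable[of \<theta> w]] by (simp add: case_prod_unfold)
    have "(\<lambda>y. \<integral>\<^sup>+\<omega>. indicator {0..t} (fst (fst (y, \<omega>))) * dying (\<theta> (fst (fst (y, \<omega>)))) (snd (fst (y, \<omega>))) (fst (fst (y, \<omega>))) w (snd (y, \<omega>)) \<partial>\<Omega>) \<in> borel_measurable base"
      by measurable
    then show ?thesis by (simp add: h_def[abs_def])
  qed
  have "(\<Sum>k. \<Sum>w | length w = Suc k. \<integral>\<^sup>+\<omega>. (if split w \<omega> \<le> t then ennreal (exp (- (\<theta> (split w \<omega>) * len (C w \<omega> \<inter> great_circle (N w \<omega>))))) else 0) \<partial>\<Omega>)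
    = (\<Sum>k. \<Sum>w | length w = Suc k. \<integral>\<^sup>+y. h w y \<partial>base)"
    by (simp only: edge_weight[OF assms(1)] h_def)
  also have "\<dots> = (\<integral>\<^sup>+y. (\<Sum>k. \<Sum>w | length w = Suc k. h w y) \<partial>base)"
    by (simp add: nn_integral_suminf nn_integral_sum)
  also have "\<dots> = (\<integral>\<^sup>+s. \<integral>\<^sup>+x. (\<Sum>k. \<Sum>w | length w = Suc k. h w (s, x)) \<partial>normal_law \<partial>lborel)"
  proof -
    have [measurable]: "(\<lambda>y. (\<Sum>k. \<Sum>w | length w = Suc k. h w y)) \<in> borel_measurable (lborel \<Otimes>\<^sub>M normal_law)"
      using hm unfolding base_def by measurable
    show ?thesis unfolding base_def by (subst normal_law.nn_integral_fst[symmetric]) auto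
  qed
  also have "\<dots> = (\<integral>\<^sup>+s. indicator {0..t} s * (2 * (\<integral>\<^sup>+T. ennreal (exp (- T)) * ennreal (edge_count (\<theta> s) (s - T) 1) * indicator {0..s} T \<partial>lborel)) \<partial>lborel)"
  proof (rule nn_integral_cong)
    fix s :: real
    show "(\<integral>\<^sup>+x. (\<Sum>k. \<Sum>w | length w = Suc k. h w (s, x)) \<partial>normal_law) =
      indicator {0..t} s * (2 * (\<integral>\<^sup>+T. ennreal (exp (- T)) * ennreal (edge_count (\<theta> s) (s - T) 1) * indicator {0..s} T \<partial>lborel))"
    proof (cases "s \<in> {0..t}")
      case True
      then have s: "0 \<le> s" "0 \<le> \<theta> s" using \<theta> by auto
      have "(\<integral>\<^sup>+x. (\<Sum>k. \<Sum>w | length w = Suc k. h w (s, x)) \<partial>normal_law) =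
        (\<integral>\<^sup>+x. 2 * (\<integral>\<^sup>+T. ennreal (exp (- T)) * ennreal (edge_count (\<theta> s) (s - T) 1) * indicator {0..s} T \<partial>lborel) \<partial>normal_law)"
      proof (rule nn_integral_cong_AE)
        show "AE x in normal_law. (\<Sum>k. \<Sum>w | length w = Suc k. h w (s, x)) =
          2 * (\<integral>\<^sup>+T. ennreal (exp (- T)) * ennreal (edge_count (\<theta> s) (s - T) 1) * indicator {0..s} T \<partial>lborel)"
          using AE_normal_in_sphere
        proof eventually_elim
          case (elim x)
          show ?case using intensity[OF elim s(2,1)] True by (simp add: h_def)
        qed
      qed
      then show ?thesis using True normal_law.emeasure_space_1 by simp
    qed (simp add: h_def)
  qed
  finally show ?thesis .
qed

section \<open>Incidences of an edge\<close>

text \<open>The weight \<open>X\<close> is hidden in the factor of one arbitrary node of the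
  generation, since those factors may depend on the past.\<close>

lemma generation_law_weighted:
  assumes X: "X \<in> borel_measurable (past k)" and X1: "\<And>\<omega>. X \<omega> \<le> (1 :: ennreal)"
    and g: "\<And>w. length w = k \<Longrightarrow> (\<lambda>(\<omega>, y). g w \<omega> y) \<in> borel_measurable (past k \<Otimes>\<^sub>M (borel \<Otimes>\<^sub>M borel))"
    and g1: "\<And>w \<omega> y. g w \<omega> y \<le> (1 :: ennreal)"
  shows "(\<integral>\<^sup>+\<omega>. X \<omega> * (\<Prod>w | length w = k. g w \<omega> (mark w \<omega>)) \<partial>\<Omega>) =
    (\<integral>\<^sup>+\<omega>. X \<omega> * (\<Prod>w | length w = k. \<integral>\<^sup>+y. mark_density w \<omega> y * g w \<omega> y \<partial>base) \<partial>\<Omega>)"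
proof -
  define u :: "bool list" where "u = replicate k True"
  have u: "u \<in> {w. length w = k}" by (simp add: u_def)
  define g' where "g' w \<omega> y = (if w = u then X \<omega> else 1) * g w \<omega> y" for w \<omega> and y :: "real \<times> (real^3)"
  have fold: "(\<Prod>w | length w = k. (if w = u then X \<omega> else 1) * f w) = X \<omega> * (\<Prod>w | length w = k. f w)"
    for f :: "bool list \<Rightarrow> ennreal" and \<omega>
    using u finite_words[of k] by (simp add: prod.distrib prod.delta)
  have "(\<integral>\<^sup>+\<omega>. X \<omega> * (\<Prod>w | length w = k. g w \<omega> (mark w \<omega>)) \<partial>\<Omega>) =
    (\<integral>\<^sup>+\<omega>. indicator (space \<Omega>) \<omega> * (\<Prod>w | length w = k. g' w \<omega> (mark w \<omega>)) \<partial>\<Omega>)"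
    unfolding g'_def fold by (rule nn_integral_cong) simp
  also have "\<dots> = (\<integral>\<^sup>+\<omega>. indicator (space \<Omega>) \<omega> * (\<Prod>w | length w = k. \<integral>\<^sup>+y. mark_density w \<omega> y * g' w \<omega> y \<partial>base) \<partial>\<Omega>)"
  proof (rule generation_law)
    show "space \<Omega> \<in> sets (past k)" using sets.top[of "past k"] by simp
    fix w :: "bool list" assume "length w = k"
    note [measurable] = g[OF this] X
    have "(\<lambda>z. (if w = u then X (fst z) else 1) * (\<lambda>(\<omega>, y). g w \<omega> y) z) \<in> borel_measurable (past k \<Otimes>\<^sub>M (borel \<Otimes>\<^sub>M borel))"
      by measurable
    then show "(\<lambda>(\<omega>, y). g' w \<omega> y) \<in> borel_measurable (past k \<Otimes>\<^sub>M (borel \<Otimes>\<^sub>M borel))"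
      by (simp add: g'_def case_prod_unfold)
  next
    fix w \<omega> y
    show "g' w \<omega> y \<le> 1" unfolding g'_def by (cases "w = u") (simp_all add: mult_le_one X1 g1)
  qed
  also have "\<dots> = (\<integral>\<^sup>+\<omega>. X \<omega> * (\<Prod>w | length w = k. \<integral>\<^sup>+y. mark_density w \<omega> y * g w \<omega> y \<partial>base) \<partial>\<Omega>)"
  proof (rule nn_integral_cong)
    fix \<omega> assume \<omega>: "\<omega> \<in> space \<Omega>"
    have "(\<integral>\<^sup>+y. mark_density w \<omega> y * g' w \<omega> y \<partial>base) = (if w = u then X \<omega> else 1) * (\<integral>\<^sup>+y. mark_density w \<omega> y * g w \<omega> y \<partial>base)"
      if w: "length w = k" for w
    proof -
      have "(\<lambda>y. (\<omega>, y)) \<in> measurable (borel \<Otimes>\<^sub>M borel) (past k \<Otimes>\<^sub>M (borel \<Otimes>\<^sub>M borel))" by (rule measurable_Pair1') (use \<omega> in simp)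
      from measurable_compose[OF this g[OF w]] have [measurable]: "g w \<omega> \<in> borel_measurable (borel \<Otimes>\<^sub>M borel)" by simp
      note [measurable] = mark_density_measurable_section[OF \<omega>, of w]
      have "(\<integral>\<^sup>+y. mark_density w \<omega> y * g' w \<omega> y \<partial>base) = (\<integral>\<^sup>+y. (if w = u then X \<omega> else 1) * (mark_density w \<omega> y * g w \<omega> y) \<partial>base)"
        by (rule nn_integral_cong) (simp add: g'_def ac_simps)
      also have "\<dots> = (if w = u then X \<omega> else 1) * (\<integral>\<^sup>+y. mark_density w \<omega> y * g w \<omega> y \<partial>base)"
        by (rule nn_integral_cmult) measurable
      finally show ?thesis .
    qed
    then have "(\<Prod>w | length w = k. \<integral>\<^sup>+y. mark_density w \<omega> y * g' w \<omega> y \<partial>base) =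
      (\<Prod>w | length w = k. (if w = u then X \<omega> else 1) * (\<integral>\<^sup>+y. mark_density w \<omega> y * g w \<omega> y \<partial>base))"
      by (intro prod.cong) auto
    then show "indicator (space \<Omega>) \<omega> * (\<Prod>w | length w = k. \<integral>\<^sup>+y. mark_density w \<omega> y * g' w \<omega> y \<partial>base) =
      X \<omega> * (\<Prod>w | length w = k. \<integral>\<^sup>+y. mark_density w \<omega> y * g w \<omega> y \<partial>base)"
      using \<omega> by (simp add: fold)
  qed
  finally show ?thesis .
qed

definition incident :: "real \<Rightarrow> bool list \<Rightarrow> bool list \<Rightarrow> 'a \<Rightarrow> bool"
  where "incident t w v \<omega> \<longleftrightarrow> split v \<omega> \<le> t \<and> great_circle (N v \<omega>) \<inter> (C v \<omega> \<inter> great_circle (N w \<omega>)) \<noteq> {}"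

text \<open>Accounts for the incidences decided by the first \<open>k\<close> generations.
  Multiplied by the \<open>open_factor\<close> of all words of length \<open>k\<close> it becomes
  the conditional generating function given these generations.\<close>

definition known_factor :: "real \<Rightarrow> real \<Rightarrow> bool list \<Rightarrow> nat \<Rightarrow> 'a \<Rightarrow> ennreal"
  where "known_factor z t w k \<omega> =
    (\<Prod>v | length v < k \<and> descends v w. if incident t w v \<omega> then ennreal z else 1)"

text \<open>The conditional generating function of the incidences on the part of the edge of \<open>w\<close> in the cell \<open>v\<close>.\<close>

definition open_factor :: "real \<Rightarrow> real \<Rightarrow> bool list \<Rightarrow> bool list \<Rightarrow> 'a \<Rightarrow> ennreal"
  where "open_factor z t w v \<omega> = (if descends v w
    then ennreal (exp (- ((1 - z) * max 0 (t - birth v \<omega>) * len (C v \<omega> \<inter> great_circle (N w \<omega>))))) else 1)"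

lemma finite_short_words: "finite {v :: bool list. length v < k \<and> P v}"
proof -
  have "{v :: bool list. length v < k \<and> P v} \<subseteq> (\<Union>j<k. {w. length w = j})" by auto
  then show ?thesis by (rule finite_subset) (simp add: finite_words)
qed

lemma past_incident:
  assumes "length v < k" "length w < k"
  shows "Measurable.pred (past k) (incident t w v)"
proof -
  note [measurable] = past_split[OF assms(1)]
  have [measurable]: "Measurable.pred (past k) (\<lambda>\<omega>. great_circle (N v \<omega>) \<inter> (C v \<omega> \<inter> great_circle (N w \<omega>)) \<noteq> {})"
    using assms by (intro random_polytope_hits random_polytope_great_circle past_cell past_normal) auto
  show ?thesis unfolding incident_def by measurable
qed

lemma past_known_factor:
  assumes "length w < k"
  shows "known_factor z t w k \<in> borel_measurable (past k)"
proof -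
  have "(\<lambda>\<omega>. if incident t w v \<omega> then ennreal z else 1) \<in> borel_measurable (past k)" if "length v < k" for v
  proof -
    note [measurable] = past_incident[OF that assms, of t]
    show ?thesis by measurable
  qed
  then show ?thesis unfolding known_factor_def[abs_def] by (intro borel_measurable_prod_ennreal) auto
qed

lemma hemisphere_mark_prod:
  fixes F :: "(real^3) set \<Rightarrow> ennreal"
  shows "(\<Prod>b\<in>UNIV. F (A \<inter> hemisphere b (snd (mark w \<omega>)))) = (\<Prod>b\<in>UNIV. F (A \<inter> hemisphere b (N w \<omega>)))"
  using representative_cases[of "N w \<omega>"] by (auto simp: mark_def UNIV_bool mult.commute)

text \<open>The circle of \<open>w\<close> takes the role of the fixed circle. It is not the root
  circle, and any other ancestor of \<open>v\<close> differs from \<open>w\<close> in length, so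
  general position applies.\<close>

lemma AE_len_split_mark:
  assumes \<omega>: "\<omega> \<in> space \<Omega>" and gp: "general_position (\<lambda>v. \<tau> v \<omega>) (\<lambda>v. N v \<omega>)"
    and w: "w \<noteq> []" and v: "descends v w"
  shows "AE x in normal_law. len (C v \<omega> \<inter> great_circle (N w \<omega>) \<inter> hemisphere True x) +
      len (C v \<omega> \<inter> great_circle (N w \<omega>) \<inter> hemisphere False x) = len (C v \<omega> \<inter> great_circle (N w \<omega>))"
proof (rule AE_len_split[OF _ _ const_cell[OF \<omega>]])
  interpret generic_splitting "\<lambda>v. \<tau> v \<omega>" "\<lambda>v. N v \<omega>" by unfold_locales (rule gp)
  show "v \<noteq> []" using v by (auto simp: descends_def)
  have lw: "length [] < length w" using w by simp
  have "great_circle (N i \<omega>) = great_circle (N w \<omega>) \<or> great_circle (N i \<omega>) \<inter> great_circle (N [] \<omega>) \<inter> great_circle (N w \<omega>) = {}"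
    if i: "descends v i" "i \<noteq> []" for i
  proof (cases "i = w")
    case False
    have "length i \<noteq> length w"
    proof
      assume eq: "length i = length w"
      obtain u b u' b' where "v = u @ b # i" "v = u' @ b' # w" using v i by (auto simp: descends_def)
      with eq False show False by (metis append_eq_append_conv list.inject length_Cons)
    qed
    then consider "length i < length w" | "length w < length i" by linarith
    then show ?thesis
    proof cases
      case 1
      then show ?thesis using triple[of "[]" i w] i(2) by (auto simp: Int_commute Int_left_commute)
    next
      case 2
      then show ?thesis using triple[of "[]" w i] lw by (auto simp: Int_commute Int_left_commute)
    qed
  qed simp
  then show "splits_generically (\<lambda>v. N v \<omega>) v (N w \<omega>)"
    unfolding splits_generically_def using in_sphere circle_neq[OF lw] by blast
qed

text \<open>The conditional generating function is a martingale over the generations. A node of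
  generation \<open>k\<close> contributes its own possible incidence and the factors of its two
  children; averaging over its mark gives back its \<open>open_factor\<close>, by
  \<open>nn_integral_incidence_step\<close>. \<open>X\<close> permits a restriction that depends on
  the past.\<close>

lemma incidence_step:
  assumes z: "0 \<le> z" "z \<le> 1" and w: "w \<noteq> []" and k: "length w < k"
    and X: "X \<in> borel_measurable (past k)" "\<And>\<omega>. X \<omega> \<le> (1 :: ennreal)"
  shows "(\<integral>\<^sup>+\<omega>. X \<omega> * (known_factor z t w (Suc k) \<omega> * (\<Prod>v | length v = Suc k. open_factor z t w v \<omega>)) \<partial>\<Omega>) =
    (\<integral>\<^sup>+\<omega>. X \<omega> * (known_factor z t w k \<omega> * (\<Prod>v | length v = k. open_factor z t w v \<omega>)) \<partial>\<Omega>)"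
proof -
  define \<zeta> where "\<zeta> = 1 - z"
  have \<zeta>: "0 \<le> \<zeta>" "\<zeta> \<le> 1" using z by (auto simp: \<zeta>_def)
  let ?P = "past k \<Otimes>\<^sub>M (borel \<Otimes>\<^sub>M borel) :: ('a \<times> real \<times> (real^3)) measure"
  let ?p = "\<lambda>v \<omega>. C v \<omega> \<inter> great_circle (N w \<omega>)"
  define e where "e r A = ennreal (exp (- (\<zeta> * max 0 (t - r) * len A)))" for r A
  have e1: "e r A \<le> 1" for r A unfolding e_def using \<zeta> by (simp add: ennreal_le_1)
  \<comment> \<open>What \<open>v\<close> and its two children contribute, as a function of the mark
    of \<open>v\<close>.\<close>
  define g where "g v \<omega> y = (if descends v w
    then (if birth v \<omega> + fst y \<le> t \<and> great_circle (snd y) \<inter> ?p v \<omega> \<noteq> {} then ennreal z else 1) *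
      (\<Prod>b\<in>UNIV. e (birth v \<omega> + fst y) (?p v \<omega> \<inter> hemisphere b (snd y))) else 1)" for v \<omega> and y :: "real \<times> (real^3)"
  have g1: "g v \<omega> y \<le> 1" for v \<omega> y
    unfolding g_def using z e1 by (auto intro!: mult_le_one prod_le_1 simp: ennreal_le_1)
  have gm: "(\<lambda>(\<omega>, y). g v \<omega> y) \<in> borel_measurable ?P" if v: "length v = k" for v
  proof -
    have polyv: "random_polytope (past k) (?p v)"
      using k v by (intro random_polytope_great_circle past_cell past_normal) auto
    have poly: "random_polytope ?P (\<lambda>z. ?p v (fst z))" by (rule random_polytope_compose[OF polyv measurable_fst])
    have polyb: "random_polytope ?P (\<lambda>z. ?p v (fst z) \<inter> hemisphere b (snd (snd z)))" for b
      by (rule random_polytope_hemisphere[OF poly]) measurable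
    have [measurable]: "Measurable.pred ?P (\<lambda>z. great_circle (snd (snd z)) \<inter> ?p v (fst z) \<noteq> {})"
      by (rule random_polytope_hits[OF poly]) measurable
    note [measurable] = len_measurable[OF polyb]
    have [measurable]: "birth v \<in> borel_measurable (past k)" by (rule past_birth) (simp add: v)
    have [measurable]: "(\<lambda>z. e (birth v (fst z) + fst (snd z)) (?p v (fst z) \<inter> hemisphere b (snd (snd z)))) \<in> borel_measurable ?P" for b
      unfolding e_def by measurable
    show ?thesis unfolding g_def case_prod_unfold UNIV_bool by simp
  qed
  have Xm: "(\<lambda>\<omega>. X \<omega> * known_factor z t w k \<omega>) \<in> borel_measurable (past k)"
    using X(1) past_known_factor[OF k, of z t] by (rule borel_measurable_times_ennreal)
  have kf1: "known_factor z t w j \<omega> \<le> 1" for j \<omega>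
    unfolding known_factor_def using z by (intro prod_le_1) (auto simp: ennreal_le_1)
  have X1: "X \<omega> * known_factor z t w k \<omega> \<le> 1" for \<omega> by (rule mult_le_one[OF X(2) _ kf1]) simp
  have split_words: "{v. length v < Suc k \<and> descends v w} = {v. length v < k \<and> descends v w} \<union> {v. length v = k \<and> descends v w}"
    by auto
  have "(\<integral>\<^sup>+\<omega>. X \<omega> * (known_factor z t w (Suc k) \<omega> * (\<Prod>v | length v = Suc k. open_factor z t w v \<omega>)) \<partial>\<Omega>) =
    (\<integral>\<^sup>+\<omega>. (X \<omega> * known_factor z t w k \<omega>) * (\<Prod>v | length v = k. g v \<omega> (mark v \<omega>)) \<partial>\<Omega>)"
  proof (rule nn_integral_cong)
    fix \<omega>
    have 1: "known_factor z t w (Suc k) \<omega> = known_factor z t w k \<omega> *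
      (\<Prod>v | length v = k \<and> descends v w. if incident t w v \<omega> then ennreal z else 1)"
      unfolding known_factor_def split_words
      by (rule prod.union_disjoint) (auto intro: finite_short_words finite_subset[OF _ finite_words[of k]])
    have 2: "(\<Prod>v | length v = k \<and> descends v w. if incident t w v \<omega> then ennreal z else 1) =
      (\<Prod>v | length v = k. if descends v w then if incident t w v \<omega> then ennreal z else 1 else 1)"
      using finite_words[of k] by (simp add: prod.inter_filter[symmetric] Collect_conj_eq[symmetric] prod.If_cases Int_def)
    have 3: "(\<Prod>v | length v = Suc k. open_factor z t w v \<omega>) = (\<Prod>v | length v = k. \<Prod>b\<in>UNIV. open_factor z t w (b # v) \<omega>)"
    proof -
      have "{w :: bool list. length w = Suc k} = (\<lambda>(w, b). b # w) ` ({w. length w = k} \<times> UNIV)"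
        by (auto simp: length_Suc_conv image_iff)
      then have "(\<Prod>v | length v = Suc k. open_factor z t w v \<omega>) = (\<Prod>(v, b)\<in>{w. length w = k} \<times> UNIV. open_factor z t w (b # v) \<omega>)"
        by (simp add: prod.reindex inj_on_def case_prod_unfold o_def)
      then show ?thesis by (simp add: prod.cartesian_product)
    qed
    have 4: "(if descends v w then if incident t w v \<omega> then ennreal z else 1 else 1) * (\<Prod>b\<in>UNIV. open_factor z t w (b # v) \<omega>) = g v \<omega> (mark v \<omega>)"
      if v: "length v = k" for v
    proof (cases "descends v w")
      case True
      have d: "descends (b # v) w" for b using True by (simp add: descends_Cons)
      have c: "C (b # v) \<omega> \<inter> great_circle (N w \<omega>) = ?p v \<omega> \<inter> hemisphere b (N v \<omega>)" for b by auto
      have "(\<Prod>b\<in>UNIV. open_factor z t w (b # v) \<omega>) = (\<Prod>b\<in>UNIV. e (birth v \<omega> + \<tau> v \<omega>) (?p v \<omega> \<inter> hemisphere b (N v \<omega>)))"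
        unfolding open_factor_def c using d by (simp add: e_def \<zeta>_def)
      also have "\<dots> = (\<Prod>b\<in>UNIV. e (birth v \<omega> + fst (mark v \<omega>)) (?p v \<omega> \<inter> hemisphere b (snd (mark v \<omega>))))"
        unfolding hemisphere_mark_prod by (simp add: mark_def)
      finally show ?thesis using True by (simp add: g_def incident_def mark_def split_time_def)
    next
      case False
      then have "\<not> descends (b # v) w" for b using v k by (auto simp: descends_Cons)
      then show ?thesis using False by (simp add: g_def open_factor_def)
    qed
    show "X \<omega> * (known_factor z t w (Suc k) \<omega> * (\<Prod>v | length v = Suc k. open_factor z t w v \<omega>)) =
      (X \<omega> * known_factor z t w k \<omega>) * (\<Prod>v | length v = k. g v \<omega> (mark v \<omega>))"
      unfolding 1 2 3 mult.assoc prod.distrib[symmetric] using 4 by simp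
  qed
  also have "\<dots> = (\<integral>\<^sup>+\<omega>. (X \<omega> * known_factor z t w k \<omega>) * (\<Prod>v | length v = k. \<integral>\<^sup>+y. mark_density v \<omega> y * g v \<omega> y \<partial>base) \<partial>\<Omega>)"
    by (rule generation_law_weighted[OF Xm X1 gm g1])
  also have "\<dots> = (\<integral>\<^sup>+\<omega>. X \<omega> * (known_factor z t w k \<omega> * (\<Prod>v | length v = k. open_factor z t w v \<omega>)) \<partial>\<Omega>)"
  proof (rule nn_integral_cong_AE)
    have "AE \<omega> in \<Omega>. \<forall>v. 0 < len (C v \<omega>)" unfolding AE_all_countable using AE_len_pos by blast
    with AE_space AE_general_position
    show "AE \<omega> in \<Omega>. (X \<omega> * known_factor z t w k \<omega>) * (\<Prod>v | length v = k. \<integral>\<^sup>+y. mark_density v \<omega> y * g v \<omega> y \<partial>base) =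
      X \<omega> * (known_factor z t w k \<omega> * (\<Prod>v | length v = k. open_factor z t w v \<omega>))"
    proof eventually_elim
      case (elim \<omega>)
      note \<omega> = elim(1) and gp = elim(2) and pos = elim(3)
      have "(\<integral>\<^sup>+y. mark_density v \<omega> y * g v \<omega> y \<partial>base) = open_factor z t w v \<omega>" if v: "length v = k" for v
      proof (cases "descends v w")
        case False
        then show ?thesis using pos mark_density_total[OF \<omega>, of v] by (simp add: g_def open_factor_def) (metis less_irrefl)
      next
        case True
        define \<Lambda> where "\<Lambda> = len (C v \<omega>)"
        define l where "l = len (?p v \<omega>)"
        define b where "b = birth v \<omega>"
        define R where "R = max 0 (t - b)"
        have poly: "random_polytope (borel :: (real^3) measure) (\<lambda>_. ?p v \<omega>)"
          by (rule random_polytope_great_circle[OF const_cell[OF \<omega>]]) simp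
        note [measurable] = hits_set[OF poly] hits_set[OF const_cell[OF \<omega>, of _ v]]
        have l: "0 \<le> l" "l \<le> \<Lambda>" "0 < \<Lambda>" using pos unfolding l_def \<Lambda>_def by (auto intro!: len_mono const_cell \<omega>)
        have "(\<lambda>y. (\<omega>, y)) \<in> measurable (borel \<Otimes>\<^sub>M borel) ?P" by (rule measurable_Pair1') (use \<omega> in simp)
        from measurable_compose[OF this gm[OF v]] have gy: "g v \<omega> \<in> borel_measurable (borel \<Otimes>\<^sub>M borel)" by simp
        have "(\<integral>\<^sup>+y. mark_density v \<omega> y * g v \<omega> y \<partial>base) = (\<integral>\<^sup>+T. ennreal (exp (- \<Lambda> * T)) * indicator {0..} T *
          (\<integral>\<^sup>+x. indicator {x. great_circle x \<inter> C v \<omega> \<noteq> {}} x * g v \<omega> (T, x) \<partial>normal_law) \<partial>lborel)"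
          unfolding \<Lambda>_def by (rule nn_integral_mark_density[OF \<omega> gy])
        also have "\<dots> = (\<integral>\<^sup>+T. ennreal (exp (- (\<Lambda> * T))) * indicator {0..} T *
          (if T \<le> R then ennreal ((\<Lambda> - \<zeta> * l) * exp (- (\<zeta> * (R - T) * l))) else ennreal \<Lambda>) \<partial>lborel)"
        proof (rule nn_integral_cong_AE, rule AE_mp[OF AE_lborel_singleton[of 0]], rule AE_I2, rule impI)
          fix T :: real assume T0: "T \<noteq> 0"
          define E where "E = exp (- (\<zeta> * max 0 (t - (b + T)) * l))"
          have E: "0 \<le> E" by (simp add: E_def)
          \<comment> \<open>The lengths of the two pieces add up, so the product of the exponentials
            does not depend on where the segment is cut.\<close>
          have prodE: "AE x in normal_law. (\<Prod>c\<in>UNIV. e (b + T) (?p v \<omega> \<inter> hemisphere c x)) = ennreal E"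
            using AE_len_split_mark[OF \<omega> gp w True]
          proof eventually_elim
            case (elim x)
            then show ?case unfolding e_def E_def l_def elim[symmetric]
              by (simp add: UNIV_bool ennreal_mult[symmetric] mult_exp_exp algebra_simps)
          qed
          have "(\<integral>\<^sup>+x. indicator {x. great_circle x \<inter> C v \<omega> \<noteq> {}} x * g v \<omega> (T, x) \<partial>normal_law) =
            (\<integral>\<^sup>+x. (indicator ({x. great_circle x \<inter> C v \<omega> \<noteq> {}} - {x. great_circle x \<inter> ?p v \<omega> \<noteq> {}}) x +
              (if b + T \<le> t then ennreal z else 1) * indicator {x. great_circle x \<inter> ?p v \<omega> \<noteq> {}} x) * ennreal E \<partial>normal_law)"
          proof (rule nn_integral_cong_AE)
            show "AE x in normal_law. indicator {x. great_circle x \<inter> C v \<omega> \<noteq> {}} x * g v \<omega> (T, x) =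
              (indicator ({x. great_circle x \<inter> C v \<omega> \<noteq> {}} - {x. great_circle x \<inter> ?p v \<omega> \<noteq> {}}) x +
              (if b + T \<le> t then ennreal z else 1) * indicator {x. great_circle x \<inter> ?p v \<omega> \<noteq> {}} x) * ennreal E"
              using prodE
            proof eventually_elim
              case (elim x)
              have g: "g v \<omega> (T, x) = (if b + T \<le> t \<and> great_circle x \<inter> ?p v \<omega> \<noteq> {} then ennreal z else 1) * ennreal E"
                unfolding g_def fst_conv snd_conv b_def[symmetric] elim using True by simp
              have sub: "great_circle x \<inter> ?p v \<omega> \<noteq> {} \<Longrightarrow> great_circle x \<inter> C v \<omega> \<noteq> {}" by blast
              show ?case unfolding g using sub
                by (cases "great_circle x \<inter> ?p v \<omega> = {}"; cases "great_circle x \<inter> C v \<omega> = {}") (simp_all add: indicator_def)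
            qed
          qed
          also have "\<dots> = (emeasure normal_law ({x. great_circle x \<inter> C v \<omega> \<noteq> {}} - {x. great_circle x \<inter> ?p v \<omega> \<noteq> {}}) +
            (if b + T \<le> t then ennreal z else 1) * emeasure normal_law {x. great_circle x \<inter> ?p v \<omega> \<noteq> {}}) * ennreal E"
            by (subst nn_integral_multc, measurable) (subst nn_integral_add, auto simp: nn_integral_cmult)
          also have "emeasure normal_law ({x. great_circle x \<inter> C v \<omega> \<noteq> {}} - {x. great_circle x \<inter> ?p v \<omega> \<noteq> {}}) = ennreal (\<Lambda> - l)"
            by (subst normal_law.emeasure_eq_measure, subst normal_law.finite_measure_Diff) (auto simp: len_def \<Lambda>_def l_def)
          also have "emeasure normal_law {x. great_circle x \<inter> ?p v \<omega> \<noteq> {}} = ennreal l"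
            unfolding l_def by (rule emeasure_hits)
          finally have I: "(\<integral>\<^sup>+x. indicator {x. great_circle x \<inter> C v \<omega> \<noteq> {}} x * g v \<omega> (T, x) \<partial>normal_law) =
            (ennreal (\<Lambda> - l) + (if b + T \<le> t then ennreal z else 1) * ennreal l) * ennreal E" .
          show "ennreal (exp (- \<Lambda> * T)) * indicator {0..} T * (\<integral>\<^sup>+x. indicator {x. great_circle x \<inter> C v \<omega> \<noteq> {}} x * g v \<omega> (T, x) \<partial>normal_law) =
            ennreal (exp (- (\<Lambda> * T))) * indicator {0..} T *
            (if T \<le> R then ennreal ((\<Lambda> - \<zeta> * l) * exp (- (\<zeta> * (R - T) * l))) else ennreal \<Lambda>)"
          proof (cases "0 < T")
            case False
            then show ?thesis using T0 by (simp add: indicator_def)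
          next
            case T: True
            show ?thesis
            proof (cases "b + T \<le> t")
              case True
              then have R: "T \<le> R" "R - T = t - (b + T)" "max 0 (t - (b + T)) = t - (b + T)" using T by (auto simp: R_def)
              \<comment> \<open>Missing the segment has weight 1, hitting it has weight
                \<open>z\<close>.\<close>
              have "ennreal (\<Lambda> - l) + ennreal z * ennreal l = ennreal (\<Lambda> - \<zeta> * l)"
                using l z by (simp add: ennreal_mult[symmetric] ennreal_plus[symmetric] \<zeta>_def algebra_simps del: ennreal_plus)
              moreover have "ennreal (\<Lambda> - \<zeta> * l) * ennreal E = ennreal ((\<Lambda> - \<zeta> * l) * exp (- (\<zeta> * (R - T) * l)))"
                unfolding R(2) E_def R(3) by (rule ennreal_mult''[symmetric]) simp
              ultimately show ?thesis unfolding I using True R(1) by simp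
            next
              case False
              then have R: "\<not> T \<le> R" "E = 1" using T by (auto simp: R_def E_def)
              have "ennreal (\<Lambda> - l) + ennreal l = ennreal \<Lambda>" using l by (simp add: ennreal_plus[symmetric] del: ennreal_plus)
              then show ?thesis unfolding I using False R by simp
            qed
          qed
        qed
        also have "\<dots> = ennreal (exp (- (\<zeta> * R * l)))"
          by (rule nn_integral_incidence_step[OF \<zeta> _ l]) (simp add: R_def)
        also have "\<dots> = open_factor z t w v \<omega>" using True by (simp add: open_factor_def R_def l_def b_def \<zeta>_def)
        finally show ?thesis .
      qed
      then show ?case by (simp add: mult.assoc)
    qed
  qed
  finally show ?thesis .
qed

end

lemma sum_words_by_length:
  fixes F :: "bool list \<Rightarrow> ennreal"
  assumes "finite S"
  shows "(\<Sum>w\<in>S. F w) = (\<Sum>k. \<Sum>w | length w = k. if w \<in> S then F w else 0)"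
proof -
  obtain K where K: "\<And>w. w \<in> S \<Longrightarrow> length w < K"
    using finite_nat_set_iff_bounded[of "length ` S"] assms by auto
  have "(\<Sum>k. \<Sum>w | length w = k. if w \<in> S then F w else 0) = (\<Sum>k<K. \<Sum>w | length w = k. if w \<in> S then F w else 0)"
    by (rule suminf_finite) (use K in \<open>auto intro!: sum.neutral\<close>)
  also have "\<dots> = (\<Sum>w\<in>(\<Union>k<K. {w. length w = k}). if w \<in> S then F w else 0)"
    by (rule sum.UNION_disjoint[symmetric]) (auto simp: finite_words)
  also have "\<dots> = (\<Sum>w\<in>S. if w \<in> S then F w else 0)"
    by (rule sum.mono_neutral_right) (use K in \<open>auto simp: finite_words\<close>)
  finally show ?thesis by simp
qed

section \<open>Generating functions of the incidence numbers\<close>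

context splitting_process
begin

definition incidence_number :: "real \<Rightarrow> bool list \<Rightarrow> 'a \<Rightarrow> nat"
  where "incidence_number t w \<omega> = card {v. descends v w \<and> incident t w v \<omega>}"

lemma split_measurable [measurable]: "split w \<in> borel_measurable \<Omega>"
  by (rule measurable_past[OF past_split[of w "Suc (length w)"]]) simp

lemma incident_measurable [measurable]: "Measurable.pred \<Omega> (incident t w v)"
  by (rule measurable_past[OF past_incident[of v "Suc (length v + length w)" w]]) auto

lemma incidence_number_measurable [measurable]: "incidence_number t w \<in> measurable \<Omega> (count_space UNIV)"
proof -
  \<comment> \<open>Words are encoded as natural numbers, so that membership in the random set is
    tested number by number.\<close>
  have "(\<lambda>\<omega>. card (to_nat ` {v. descends v w \<and> incident t w v \<omega>})) \<in> measurable \<Omega> (count_space UNIV)"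
  proof (rule measurable_card)
    fix i
    have "{\<omega> \<in> space \<Omega>. i \<in> to_nat ` {v. descends v w \<and> incident t w v \<omega>}} =
      {\<omega> \<in> space \<Omega>. \<exists>v. i = to_nat v \<and> descends v w \<and> incident t w v \<omega>}" by auto
    also have "\<dots> \<in> sets \<Omega>" by measurable
    finally show "{\<omega> \<in> space \<Omega>. i \<in> to_nat ` {v. descends v w \<and> incident t w v \<omega>}} \<in> sets \<Omega>" .
  qed
  then show ?thesis by (simp add: incidence_number_def[abs_def] card_image inj_on_def)
qed

text \<open>\<open>Z k\<close> interpolates between the two sides. In the first generation after
  \<open>w\<close> no incidence is decided and both children contain the whole edge, hence the
  factor 2. For large \<open>k\<close> all cells are born after \<open>t\<close> and only one factor
  \<open>z\<close> per incidence is left. In between \<open>incidence_step\<close> keeps the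
  integral constant.\<close>

lemma incidence_generating_function:
  assumes z: "0 \<le> z" "z \<le> 1" and w: "w \<noteq> []"
  shows "(\<integral>\<^sup>+\<omega>. (if split w \<omega> \<le> t then ennreal z ^ incidence_number t w \<omega> else 0) \<partial>\<Omega>) =
    (\<integral>\<^sup>+\<omega>. (if split w \<omega> \<le> t then
      ennreal (exp (- (2 * (1 - z) * (t - split w \<omega>) * len (C w \<omega> \<inter> great_circle (N w \<omega>))))) else 0) \<partial>\<Omega>)"
proof -
  define X where "X \<omega> = (if split w \<omega> \<le> t then 1 else 0 :: ennreal)" for \<omega>
  define Z where "Z k \<omega> = X \<omega> * (known_factor z t w k \<omega> * (\<Prod>v | length v = k. open_factor z t w v \<omega>))" for k \<omega>
  have X1: "X \<omega> \<le> 1" for \<omega> by (simp add: X_def)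
  have Xm: "X \<in> borel_measurable (past k)" if "length w < k" for k
  proof -
    note [measurable] = past_split[OF that]
    show ?thesis unfolding X_def by measurable
  qed
  have const: "(\<integral>\<^sup>+\<omega>. Z (Suc (length w)) \<omega> \<partial>\<Omega>) = (\<integral>\<^sup>+\<omega>. Z k \<omega> \<partial>\<Omega>)" if "Suc (length w) \<le> k" for k
    using that
  proof (induction k rule: dec_induct)
    case (step k)
    then show ?case unfolding Z_def using incidence_step[OF z w _ Xm X1, of k t] by simp
  qed simp
  have kf1: "known_factor z t w j \<omega> \<le> 1" for j \<omega>
    unfolding known_factor_def using z by (intro prod_le_1) (auto simp: ennreal_le_1)
  have of1: "open_factor z t w v \<omega> \<le> 1" for v \<omega>
    unfolding open_factor_def using z by (auto simp: ennreal_le_1)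
  have Z1: "Z k \<omega> \<le> 1" for k \<omega>
    unfolding Z_def by (intro mult_le_one X1 kf1 prod_le_1) (auto simp: of1)
  have Zm [measurable]: "Z k \<in> borel_measurable \<Omega>" if "length w < k" for k
  proof -
    have "open_factor z t w v \<in> borel_measurable (past k)" if "length v = k" for v
    proof -
      have "random_polytope (past k) (\<lambda>\<omega>. C v \<omega> \<inter> great_circle (N w \<omega>))"
        using that \<open>length w < k\<close> by (intro random_polytope_great_circle past_cell past_normal) auto
      note [measurable] = len_measurable[OF this] past_birth[of v k]
      have [measurable]: "birth v \<in> borel_measurable (past k)" by (rule past_birth) (simp add: that)
      show ?thesis unfolding open_factor_def by measurable
    qed
    then have "(\<lambda>\<omega>. \<Prod>v | length v = k. open_factor z t w v \<omega>) \<in> borel_measurable (past k)"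
      by (intro borel_measurable_prod_ennreal) auto
    then have "Z k \<in> borel_measurable (past k)" unfolding Z_def
      by (intro borel_measurable_times_ennreal Xm past_known_factor that)
    then show ?thesis by (rule measurable_past)
  qed
  have first: "(\<integral>\<^sup>+\<omega>. Z (Suc (length w)) \<omega> \<partial>\<Omega>) = (\<integral>\<^sup>+\<omega>. (if split w \<omega> \<le> t then
      ennreal (exp (- (2 * (1 - z) * (t - split w \<omega>) * len (C w \<omega> \<inter> great_circle (N w \<omega>))))) else 0) \<partial>\<Omega>)"
  proof (rule nn_integral_cong)
    fix \<omega>
    have "{v. length v < Suc (length w) \<and> descends v w} = {}" using descends_length by fastforce
    then have 1: "known_factor z t w (Suc (length w)) \<omega> = 1" by (simp only: known_factor_def prod.empty)
    have "(\<Prod>v | length v = Suc (length w). open_factor z t w v \<omega>) = (\<Prod>v\<in>range (\<lambda>b. b # w). open_factor z t w v \<omega>)"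
    proof (rule prod.mono_neutral_right)
      show "\<forall>v\<in>{v. length v = Suc (length w)} - range (\<lambda>b. b # w). open_factor z t w v \<omega> = 1"
      proof
        fix v assume v: "v \<in> {v. length v = Suc (length w)} - range (\<lambda>b. b # w)"
        then obtain b u where bu: "v = b # u" "length u = length w" by (auto simp: length_Suc_conv)
        have "u \<noteq> w" using v bu by auto
        then have "\<not> descends v w" using bu descends_length[of u w] by (auto simp: descends_Cons)
        then show "open_factor z t w v \<omega> = 1" by (simp add: open_factor_def)
      qed
    qed (auto simp: finite_words)
    also have "\<dots> = (\<Prod>b\<in>UNIV. open_factor z t w (b # w) \<omega>)" by (subst prod.reindex) (auto simp: inj_on_def)
    also have "\<dots> = (\<Prod>b\<in>(UNIV :: bool set). ennreal (exp (- ((1 - z) * max 0 (t - split w \<omega>) * len (C w \<omega> \<inter> great_circle (N w \<omega>))))))"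
    proof (rule prod.cong)
      fix b :: bool
      have "C (b # w) \<omega> \<inter> great_circle (N w \<omega>) = C w \<omega> \<inter> great_circle (N w \<omega>)"
        by (auto simp: hemisphere_def great_circle_def)
      then show "open_factor z t w (b # w) \<omega> = ennreal (exp (- ((1 - z) * max 0 (t - split w \<omega>) * len (C w \<omega> \<inter> great_circle (N w \<omega>)))))"
        by (simp only: open_factor_def descends_Cons split_time_eq_birth_time[of _ w b]) simp
    qed simp
    also have "\<dots> = ennreal (exp (- (2 * (1 - z) * max 0 (t - split w \<omega>) * len (C w \<omega> \<inter> great_circle (N w \<omega>)))))"
      by (simp add: UNIV_bool ennreal_mult[symmetric] mult_exp_exp algebra_simps)
    finally show "Z (Suc (length w)) \<omega> = (if split w \<omega> \<le> t then
      ennreal (exp (- (2 * (1 - z) * (t - split w \<omega>) * len (C w \<omega> \<inter> great_circle (N w \<omega>))))) else 0)"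
      by (simp add: Z_def 1 X_def)
  qed
  have "(\<lambda>k. \<integral>\<^sup>+\<omega>. Z (Suc (length w) + k) \<omega> \<partial>\<Omega>) \<longlonglongrightarrow>
    (\<integral>\<^sup>+\<omega>. (if split w \<omega> \<le> t then ennreal z ^ incidence_number t w \<omega> else 0) \<partial>\<Omega>)"
  proof (rule nn_integral_dominated_convergence[where w="\<lambda>_. 1"])
    show "AE \<omega> in \<Omega>. (\<lambda>k. Z (Suc (length w) + k) \<omega>) \<longlonglongrightarrow> (if split w \<omega> \<le> t then ennreal z ^ incidence_number t w \<omega> else 0)"
      using AE_general_position
    proof eventually_elim
      case (elim \<omega>)
      interpret generic_splitting "\<lambda>v. \<tau> v \<omega>" "\<lambda>v. N v \<omega>" by unfold_locales (rule elim)
      obtain n :: nat where n: "t < real n" using reals_Archimedean2 by blast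
      obtain K where K: "\<And>v. K \<le> length v \<Longrightarrow> real n < birth v \<omega>" using late[of n] by blast
      have Zk: "Z k \<omega> = (if split w \<omega> \<le> t then ennreal z ^ incidence_number t w \<omega> else 0)" if k: "K \<le> k" for k
      proof -
        have "open_factor z t w v \<omega> = 1" if "length v = k" for v
          using K[of v] that k n by (simp add: open_factor_def)
        then have 1: "(\<Prod>v | length v = k. open_factor z t w v \<omega>) = 1" by (intro prod.neutral) auto
        have "\<not> incident t w v \<omega>" if "k \<le> length v" for v
        proof -
          have "t < birth v \<omega>" using K[of v] that k n by linarith
          then have "t < split v \<omega>" using lifetime_pos[of v] by (simp add: split_time_def)
          then show ?thesis by (simp add: incident_def)
        qed
        then have "{v. descends v w \<and> incident t w v \<omega>} = {v. (length v < k \<and> descends v w) \<and> incident t w v \<omega>}"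
          by (auto simp: not_le[symmetric])
        moreover have "known_factor z t w k \<omega> = ennreal z ^ card {v. (length v < k \<and> descends v w) \<and> incident t w v \<omega>}"
          unfolding known_factor_def using finite_short_words[of k "\<lambda>v. descends v w"]
          by (simp add: prod.If_cases Int_def)
        ultimately show ?thesis by (simp add: Z_def 1 X_def incidence_number_def)
      qed
      have "eventually (\<lambda>k. Z (Suc (length w) + k) \<omega> = (if split w \<omega> \<le> t then ennreal z ^ incidence_number t w \<omega> else 0)) sequentially"
        using eventually_ge_at_top[of K] by eventually_elim (rule Zk, simp)
      then show ?case by (rule tendsto_eventually)
    qed
  qed (auto simp: Z1 \<Omega>.emeasure_space_1)
  moreover have "(\<integral>\<^sup>+\<omega>. Z (Suc (length w) + k) \<omega> \<partial>\<Omega>) = (\<integral>\<^sup>+\<omega>. Z (Suc (length w)) \<omega> \<partial>\<Omega>)" for k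
    by (rule const[symmetric]) simp
  ultimately have "(\<lambda>k::nat. \<integral>\<^sup>+\<omega>. Z (Suc (length w)) \<omega> \<partial>\<Omega>) \<longlonglongrightarrow>
    (\<integral>\<^sup>+\<omega>. (if split w \<omega> \<le> t then ennreal z ^ incidence_number t w \<omega> else 0) \<partial>\<Omega>)" by simp
  from LIMSEQ_unique[OF this tendsto_const] first show ?thesis by simp
qed

text \<open>Not normalised: its value at \<open>z = 1\<close> is the mean number of edges
  (\<open>mean_edge_number_eq\<close>).\<close>

definition generating_function :: "real \<Rightarrow> real \<Rightarrow> ennreal"
  where "generating_function t z =
    (\<Sum>k. \<Sum>w | length w = k. \<integral>\<^sup>+\<omega>. (if split w \<omega> \<le> t then ennreal z ^ incidence_number t w \<omega> else 0) \<partial>\<Omega>)"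

text \<open>This is the value in \<open>edges_total\<close> for \<theta> s = 2 (1 - z) (t - s), the
  exponent found in \<open>incidence_generating_function\<close>.\<close>

definition rest_function :: "real \<Rightarrow> real \<Rightarrow> ennreal"
  where "rest_function t z = (\<integral>\<^sup>+s. indicator {0..t} s *
    (2 * (\<integral>\<^sup>+T. ennreal (exp (- T)) * ennreal (edge_count (2 * (1 - z) * (t - s)) (s - T) 1) * indicator {0..s} T \<partial>lborel)) \<partial>lborel)"

text \<open>All edges except the first one are accounted for by \<open>rest_function\<close>.\<close>

lemma generating_function_bounds:
  assumes z: "0 \<le> z" "z \<le> 1"
  shows "rest_function t z \<le> generating_function t z" "generating_function t z \<le> 1 + rest_function t z"
proof -
  define a where "a w = (\<integral>\<^sup>+\<omega>. (if split w \<omega> \<le> t then ennreal z ^ incidence_number t w \<omega> else 0) \<partial>\<Omega>)" for w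
  define A where "A k = (\<Sum>w | length w = k. a w)" for k
  have "A (Suc k) = (\<Sum>w | length w = Suc k. \<integral>\<^sup>+\<omega>. (if split w \<omega> \<le> t then
      ennreal (exp (- (2 * (1 - z) * (t - split w \<omega>) * len (C w \<omega> \<inter> great_circle (N w \<omega>))))) else 0) \<partial>\<Omega>)" for k
    unfolding A_def a_def by (intro sum.cong refl incidence_generating_function z) auto
  then have rest: "(\<Sum>k. A (Suc k)) = rest_function t z"
    unfolding rest_function_def using edges_total[of "\<lambda>s. 2 * (1 - z) * (t - s)" t] z by simp
  have "generating_function t z = (\<Sum>k. A (k + 1)) + (\<Sum>k<1. A k)"
    unfolding generating_function_def A_def a_def by (rule suminf_offset) simp
  moreover have "(\<Sum>k<1. A k) = a []" by (simp add: A_def)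
  ultimately have eq: "generating_function t z = rest_function t z + a []" by (simp add: rest)
  have "a [] \<le> (\<integral>\<^sup>+\<omega>. 1 \<partial>\<Omega>)"
    unfolding a_def by (rule nn_integral_mono) (use z in \<open>auto simp: power_le_one ennreal_le_1\<close>)
  then have "a [] \<le> 1" by (simp add: \<Omega>.emeasure_space_1)
  then show "rest_function t z \<le> generating_function t z" "generating_function t z \<le> 1 + rest_function t z"
    unfolding eq by (auto simp: add.commute add_mono)
qed

lemma mean_edge_number_eq: "mean_edge_number \<Omega> \<tau> N t = enn2real (generating_function t 1)"
proof -
  have "(\<integral>\<^sup>+\<omega>. of_nat (card (maximal_edges (\<lambda>w. \<tau> w \<omega>) (\<lambda>w. N w \<omega>) t)) \<partial>\<Omega>) =
    (\<integral>\<^sup>+\<omega>. (\<Sum>k. \<Sum>w | length w = k. if split w \<omega> \<le> t then 1 else 0) \<partial>\<Omega>)"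
  proof (rule nn_integral_cong_AE)
    show "AE \<omega> in \<Omega>. (of_nat (card (maximal_edges (\<lambda>w. \<tau> w \<omega>) (\<lambda>w. N w \<omega>) t)) :: ennreal) =
      (\<Sum>k. \<Sum>w | length w = k. if split w \<omega> \<le> t then 1 else 0)"
      using AE_general_position
    proof eventually_elim
      case (elim \<omega>)
      interpret generic_splitting "\<lambda>v. \<tau> v \<omega>" "\<lambda>v. N v \<omega>" by unfold_locales (rule elim)
      show ?case unfolding card_maximal_edges
        using sum_words_by_length[OF finite_split[of t], of "\<lambda>_. 1"] by simp
    qed
  qed
  also have "\<dots> = generating_function t 1"
    unfolding generating_function_def ennreal_1 power_one by (simp add: nn_integral_suminf nn_integral_sum)
  finally show ?thesis by (simp add: mean_edge_number_def)
qed

definition incidence_weight :: "real \<Rightarrow> nat \<Rightarrow> ennreal"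
  where "incidence_weight t n =
    (\<Sum>k. \<Sum>w | length w = k. \<integral>\<^sup>+\<omega>. (if split w \<omega> \<le> t \<and> incidence_number t w \<omega> = n then 1 else 0) \<partial>\<Omega>)"

lemma typical_incidence_prob_eq:
  "typical_incidence_prob \<Omega> \<tau> N t n = enn2real (incidence_weight t n) / enn2real (generating_function t 1)"
proof -
  have "(\<integral>\<^sup>+\<omega>. (let M = maximal_edges (\<lambda>w. \<tau> w \<omega>) (\<lambda>w. N w \<omega>) t
       in \<Sum>(e, s)\<in>M. if internal_incidences e s M = n then 1 else 0) \<partial>\<Omega>) =
    (\<integral>\<^sup>+\<omega>. (\<Sum>k. \<Sum>w | length w = k. if split w \<omega> \<le> t \<and> incidence_number t w \<omega> = n then 1 else 0) \<partial>\<Omega>)"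
  proof (rule nn_integral_cong_AE)
    show "AE \<omega> in \<Omega>. (let M = maximal_edges (\<lambda>w. \<tau> w \<omega>) (\<lambda>w. N w \<omega>) t
       in \<Sum>(e, s)\<in>M. if internal_incidences e s M = n then 1 else (0 :: ennreal)) =
      (\<Sum>k. \<Sum>w | length w = k. if split w \<omega> \<le> t \<and> incidence_number t w \<omega> = n then 1 else 0)"
      using AE_general_position
    proof eventually_elim
      case (elim \<omega>)
      interpret generic_splitting "\<lambda>v. \<tau> v \<omega>" "\<lambda>v. N v \<omega>" by unfold_locales (rule elim)
      have "(\<Sum>k. \<Sum>w | length w = k. if split w \<omega> \<le> t \<and> incidence_number t w \<omega> = n then 1 else 0) =
        (\<Sum>w | split w \<omega> \<le> t. if incidence_number t w \<omega> = n then 1 else (0 :: ennreal))"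
        unfolding sum_words_by_length[OF finite_split[of t]]
        by (intro arg_cong[where f=suminf] ext sum.cong) auto
      then show ?case
        unfolding Let_def sum_maximal_edges internal_incidences_eq incidence_number_def incident_def by simp
    qed
  qed
  also have "\<dots> = incidence_weight t n"
    unfolding incidence_weight_def by (simp add: nn_integral_suminf nn_integral_sum)
  finally show ?thesis by (simp add: typical_incidence_prob_def mean_edge_number_eq)
qed

text \<open>Edges are grouped by their number of incidences; all exchanges concern nonnegative
  terms.\<close>

lemma suminf_incidence_weight:
  "(\<Sum>n. incidence_weight t n * ennreal z ^ n) = generating_function t z"
proof -
  have single: "(\<Sum>n. (if P \<and> j = n then 1 else 0) * ennreal z ^ n) = (if P then ennreal z ^ j else 0)" for P and j :: nat
  proof -
    have "(\<Sum>n. (if P \<and> j = n then 1 else 0) * ennreal z ^ n) = (\<Sum>n\<in>{j}. (if P \<and> j = n then 1 else 0) * ennreal z ^ n)"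
      by (rule suminf_finite) auto
    then show ?thesis by simp
  qed
  define I where "I w n = (\<integral>\<^sup>+\<omega>. (if split w \<omega> \<le> t \<and> incidence_number t w \<omega> = n then 1 else 0) \<partial>\<Omega>)" for w n
  have "(\<Sum>n. I w n * ennreal z ^ n) = (\<integral>\<^sup>+\<omega>. (if split w \<omega> \<le> t then ennreal z ^ incidence_number t w \<omega> else 0) \<partial>\<Omega>)" for w
  proof -
    have "(\<Sum>n. I w n * ennreal z ^ n) =
      (\<Sum>n. \<integral>\<^sup>+\<omega>. (if split w \<omega> \<le> t \<and> incidence_number t w \<omega> = n then 1 else 0) * ennreal z ^ n \<partial>\<Omega>)"
      unfolding I_def by (subst nn_integral_multc) auto
    also have "\<dots> = (\<integral>\<^sup>+\<omega>. (\<Sum>n. (if split w \<omega> \<le> t \<and> incidence_number t w \<omega> = n then 1 else 0) * ennreal z ^ n) \<partial>\<Omega>)"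
      by (rule nn_integral_suminf[symmetric]) measurable
    finally show ?thesis unfolding single .
  qed
  then have "generating_function t z = (\<Sum>k. \<Sum>w | length w = k. \<Sum>n. I w n * ennreal z ^ n)"
    by (simp add: generating_function_def)
  also have "\<dots> = (\<Sum>k. \<Sum>n. \<Sum>w | length w = k. I w n * ennreal z ^ n)"
    by (simp add: suminf_sum)
  also have "\<dots> = (\<Sum>n. \<Sum>k. \<Sum>w | length w = k. I w n * ennreal z ^ n)"
  proof -
    have "(\<Sum>k. \<Sum>n. F k n) = (\<Sum>n. \<Sum>k. F k n)" for F :: "nat \<Rightarrow> nat \<Rightarrow> ennreal"
      using nn_integral_suminf[of F "count_space (UNIV :: nat set)"] 
        nn_integral_suminf[of "\<lambda>n k. F k n" "count_space (UNIV :: nat set)"]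
      by (simp add: nn_integral_count_space_nat)
    then show ?thesis .
  qed
  also have "\<dots> = (\<Sum>n. incidence_weight t n * ennreal z ^ n)"
    unfolding incidence_weight_def I_def[symmetric] by (simp only: sum_distrib_right ennreal_suminf_multc[symmetric])
  finally show ?thesis by simp
qed

end

section \<open>Convergence of generating functions\<close>

text \<open>The difference \<open>r - r * ratio \<theta> r\<close> equals
  \<open>r * \<theta> / (r + \<theta>)\<close>. Its monotonicity says that lowering \<open>s\<close>
  by \<open>T\<close> lowers \<open>s * ratio \<theta> s\<close> by at most
  \<open>T\<close>.\<close>

lemma ratio_deficit_mono:
  assumes "0 \<le> \<theta>" "0 \<le> r" "r \<le> s"
  shows "r - r * ratio \<theta> r \<le> s - s * ratio \<theta> s"
proof (cases "\<theta> = 0")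
  case False
  then have pos: "0 < r + \<theta>" "0 < s + \<theta>" using assms by auto
  have "r - r * ratio \<theta> r = r * \<theta> / (r + \<theta>)" "s - s * ratio \<theta> s = s * \<theta> / (s + \<theta>)"
    using False pos by (simp_all add: ratio_def field_simps)
  moreover have "r * \<theta> / (r + \<theta>) \<le> s * \<theta> / (s + \<theta>)"
  proof -
    have "r * \<theta> * \<theta> \<le> s * \<theta> * \<theta>" using assms by (intro mult_right_mono) auto
    then show ?thesis using pos by (simp add: field_simps)
  qed
  ultimately show ?thesis by simp
qed (simp add: ratio_def)

lemma ratio_mono:
  assumes "0 \<le> \<theta>" "0 \<le> r" "r \<le> s"
  shows "r * ratio \<theta> r \<le> s * ratio \<theta> s"
proof (cases "\<theta> = 0 \<or> r = 0")
  case True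
  then show ?thesis using assms ratio_bounds[of \<theta> s] by (auto simp: ratio_def)
next
  case False
  then have pos: "0 < r + \<theta>" "0 < s + \<theta>" using assms by auto
  have "ratio \<theta> r \<le> ratio \<theta> s" using False pos assms by (simp add: ratio_def field_simps mult_left_mono)
  then show ?thesis using assms ratio_bounds[of \<theta> r] by (intro mult_mono) auto
qed

lemma nn_integral_exp_interval:
  assumes "0 \<le> s"
  shows "(\<integral>\<^sup>+T. ennreal (exp (- T)) * indicator {0..s} T \<partial>lborel) = ennreal (1 - exp (- s))"
    "(\<integral>\<^sup>+T. ennreal (exp (- T) * (T + 1)) * indicator {0..s} T \<partial>lborel) \<le> 2"
proof -
  have "(\<integral>\<^sup>+T. ennreal (exp (- T)) * indicator {0..s} T \<partial>lborel) = ennreal (- exp (- s) - (- exp (- 0)))"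
    by (rule nn_integral_FTC_Icc) (use assms in \<open>auto intro!: derivative_eq_intros\<close>)
  then show "(\<integral>\<^sup>+T. ennreal (exp (- T)) * indicator {0..s} T \<partial>lborel) = ennreal (1 - exp (- s))" by simp
  have "(\<integral>\<^sup>+T. ennreal (exp (- T) * (T + 1)) * indicator {0..s} T \<partial>lborel) =
    ennreal (- exp (- s) * (s + 2) - (- exp (- 0) * (0 + 2)))"
    by (rule nn_integral_FTC_Icc) (use assms in \<open>auto intro!: derivative_eq_intros simp: algebra_simps\<close>)
  also have "\<dots> \<le> ennreal 2" using assms by (intro ennreal_leI) auto
  finally show "(\<integral>\<^sup>+T. ennreal (exp (- T) * (T + 1)) * indicator {0..s} T \<partial>lborel) \<le> 2" by simp
qed

text \<open>The exponential time \<open>T\<close> of the first split costs only a bounded amount.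
  The 3 in the lower bound is made of 2 for the integral of \<open>exp (- T) * (T + 1)\<close> and 1
  for truncating \<open>T\<close> at \<open>s\<close>, because
  \<open>s * ratio \<theta> s * exp (- s) \<le> 1\<close>.\<close>

lemma edge_count_average_bounds:
  assumes \<theta>: "0 \<le> \<theta>" and s: "0 \<le> s"
  defines "B \<equiv> (\<integral>\<^sup>+T. ennreal (exp (- T)) * ennreal (edge_count \<theta> (s - T) 1) * indicator {0..s} T \<partial>lborel)"
  shows "B \<le> ennreal (s * ratio \<theta> s) + 1" "ennreal (s * ratio \<theta> s) \<le> B + 3"
proof -
  define c where "c = s * ratio \<theta> s"
  have c: "0 \<le> c" "c \<le> s" using ratio_bounds[OF \<theta> s] s by (auto simp: c_def mult_left_le)
  have F: "edge_count \<theta> (s - T) 1 \<le> c + 1" "c \<le> edge_count \<theta> (s - T) 1 + (T + 1)" if "0 \<le> T" "T \<le> s" for T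
  proof -
    have "\<bar>edge_count \<theta> (s - T) 1 - (s - T) * ratio \<theta> (s - T)\<bar> \<le> 1"
      using edge_count_bounds(3)[OF \<theta>, of "s - T" 1] that by simp
    moreover have "(s - T) * ratio \<theta> (s - T) \<le> c" unfolding c_def using that by (intro ratio_mono \<theta>) auto
    moreover have "c \<le> (s - T) * ratio \<theta> (s - T) + T"
      using ratio_deficit_mono[OF \<theta>, of "s - T" s] that by (simp add: c_def)
    ultimately show "edge_count \<theta> (s - T) 1 \<le> c + 1" "c \<le> edge_count \<theta> (s - T) 1 + (T + 1)" by linarith+
  qed
  have "B \<le> (\<integral>\<^sup>+T. ennreal (c + 1) * (ennreal (exp (- T)) * indicator {0..s} T) \<partial>lborel)"
    unfolding B_def
  proof (rule nn_integral_mono)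
    fix T
    show "ennreal (exp (- T)) * ennreal (edge_count \<theta> (s - T) 1) * indicator {0..s} T
      \<le> ennreal (c + 1) * (ennreal (exp (- T)) * indicator {0..s} T)"
    proof (cases "0 \<le> T \<and> T \<le> s")
      case True
      then have "ennreal (exp (- T)) * ennreal (edge_count \<theta> (s - T) 1) \<le> ennreal (exp (- T)) * ennreal (c + 1)"
        by (intro mult_left_mono ennreal_leI F(1)) auto
      with True show ?thesis by (simp add: mult.commute)
    qed (auto simp: indicator_def)
  qed
  also have "\<dots> = ennreal (c + 1) * ennreal (1 - exp (- s))"
    by (subst nn_integral_cmult) (auto simp: nn_integral_exp_interval[OF s])
  also have "\<dots> \<le> ennreal (c + 1) * 1" by (intro mult_left_mono) (auto simp: ennreal_le_1)
  also have "\<dots> = ennreal c + 1" using c by (simp add: ennreal_plus)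
  finally show "B \<le> ennreal (s * ratio \<theta> s) + 1" by (simp add: c_def)
  have m: "(\<lambda>T. ennreal (exp (- T)) * ennreal (edge_count \<theta> (s - T) 1) * indicator {0..s} T) \<in> borel_measurable lborel"
    unfolding edge_count_def by measurable
  have "ennreal c * ennreal (1 - exp (- s)) = (\<integral>\<^sup>+T. ennreal c * (ennreal (exp (- T)) * indicator {0..s} T) \<partial>lborel)"
    by (subst nn_integral_cmult) (auto simp: nn_integral_exp_interval[OF s])
  also have "\<dots> \<le> (\<integral>\<^sup>+T. ennreal (exp (- T)) * ennreal (edge_count \<theta> (s - T) 1) * indicator {0..s} T +
      ennreal (exp (- T) * (T + 1)) * indicator {0..s} T \<partial>lborel)"
  proof (rule nn_integral_mono)
    fix T
    have "c * exp (- T) \<le> exp (- T) * edge_count \<theta> (s - T) 1 + exp (- T) * (T + 1)" if "0 \<le> T" "T \<le> s"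
      using mult_left_mono[OF F(2)[OF that], of "exp (- T)"] by (simp add: algebra_simps)
    moreover have "0 \<le> edge_count \<theta> (s - T) 1" if "T \<le> s" using edge_count_bounds(1)[OF \<theta>, of "s - T" 1] that by simp
    ultimately show "ennreal c * (ennreal (exp (- T)) * indicator {0..s} T) \<le>
      ennreal (exp (- T)) * ennreal (edge_count \<theta> (s - T) 1) * indicator {0..s} T + ennreal (exp (- T) * (T + 1)) * indicator {0..s} T"
      using c by (auto simp: indicator_def ennreal_mult[symmetric] ennreal_plus[symmetric] simp del: ennreal_plus intro!: ennreal_leI)
  qed
  also have "\<dots> = B + (\<integral>\<^sup>+T. ennreal (exp (- T) * (T + 1)) * indicator {0..s} T \<partial>lborel)"
    unfolding B_def by (rule nn_integral_add[OF m]) measurable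
  also have "\<dots> \<le> B + 2" by (intro add_left_mono nn_integral_exp_interval(2)[OF s])
  finally have 1: "ennreal (c * (1 - exp (- s))) \<le> B + 2" using c s by (simp add: ennreal_mult)
  have "c * exp (- s) \<le> 1"
  proof -
    have "c * exp (- s) \<le> exp s * exp (- s)"
    proof (rule mult_right_mono)
      show "c \<le> exp s" using c exp_ge_add_one_self[of s] by linarith
    qed simp
    then show ?thesis by (simp add: mult_exp_exp)
  qed
  then have "ennreal c \<le> ennreal (c * (1 - exp (- s)) + 1)" by (intro ennreal_leI) (simp add: algebra_simps)
  also have "\<dots> = ennreal (c * (1 - exp (- s))) + 1" using c s by (subst ennreal_plus) auto
  also have "\<dots> \<le> B + 2 + 1" by (rule add_right_mono[OF 1])
  finally show "ennreal (s * ratio \<theta> s) \<le> B + 3" by (simp add: c_def add.assoc)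
qed

text \<open>What \<open>generating_function t z\<close> tends to after division by
  \<open>t\<^sup>2\<close>.\<close>

definition limit_function :: "real \<Rightarrow> ennreal"
  where "limit_function z = (\<integral>\<^sup>+u. ennreal (2 * (u * ratio (2 * (1 - z) * (1 - u)) u)) * indicator {0..1} u \<partial>lborel)"

lemma ratio_param_measurable [measurable]:
  "(\<lambda>u. ratio (a * (b - u)) u) \<in> borel_measurable borel"
  unfolding ratio_def by measurable

text \<open>\<open>ratio\<close> is homogeneous of degree zero in its two arguments, so scaling
  leaves one factor \<open>t\<close> from the integrand and one from the measure.\<close>

lemma limit_function_scaled:
  assumes t: "0 < t"
  shows "(\<integral>\<^sup>+s. ennreal (2 * (s * ratio (2 * (1 - z) * (t - s)) s)) * indicator {0..t} s \<partial>lborel) = ennreal (t\<^sup>2) * limit_function z"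
proof -
  have "(\<integral>\<^sup>+s. ennreal (2 * (s * ratio (2 * (1 - z) * (t - s)) s)) * indicator {0..t} s \<partial>lborel) =
    ennreal \<bar>t\<bar> * (\<integral>\<^sup>+u. ennreal (2 * ((0 + t * u) * ratio (2 * (1 - z) * (t - (0 + t * u))) (0 + t * u))) * indicator {0..t} (0 + t * u) \<partial>lborel)"
    by (rule nn_integral_real_affine) (use t in auto)
  also have "(\<integral>\<^sup>+u. ennreal (2 * ((0 + t * u) * ratio (2 * (1 - z) * (t - (0 + t * u))) (0 + t * u))) * indicator {0..t} (0 + t * u) \<partial>lborel) =
    (\<integral>\<^sup>+u. ennreal t * (ennreal (2 * (u * ratio (2 * (1 - z) * (1 - u)) u)) * indicator {0..1} u) \<partial>lborel)"
  proof (rule nn_integral_cong)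
    fix u :: real
    have "t * u + 2 * (1 - z) * (t - t * u) = t * (u + 2 * (1 - z) * (1 - u))" by (simp add: algebra_simps)
    moreover have "2 * (1 - z) * (t - t * u) = 0 \<longleftrightarrow> 2 * (1 - z) * (1 - u) = 0" using t by auto
    ultimately have r: "ratio (2 * (1 - z) * (t - t * u)) (t * u) = ratio (2 * (1 - z) * (1 - u)) u"
      using t unfolding ratio_def by auto
    have i: "indicator {0..t} (t * u) = (indicator {0..1} u :: ennreal)"
      using t by (auto simp: indicator_def zero_le_mult_iff)
    have e: "ennreal (2 * (t * u * ratio (2 * (1 - z) * (1 - u)) u)) = ennreal t * ennreal (2 * (u * ratio (2 * (1 - z) * (1 - u)) u))"
      by (subst ennreal_mult'[symmetric]) (use t in \<open>simp_all add: ac_simps\<close>)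
    show "ennreal (2 * ((0 + t * u) * ratio (2 * (1 - z) * (t - (0 + t * u))) (0 + t * u))) * indicator {0..t} (0 + t * u) =
      ennreal t * (ennreal (2 * (u * ratio (2 * (1 - z) * (1 - u)) u)) * indicator {0..1} u)"
      by (simp only: add_0 r i e) (simp only: mult.assoc)
  qed
  also have "\<dots> = ennreal t * limit_function z"
    unfolding limit_function_def by (rule nn_integral_cmult) measurable
  finally show ?thesis using t by (simp add: mult.assoc[symmetric] ennreal_mult[symmetric] power2_eq_square)
qed

text \<open>Yields the growth \<open>t\<^sup>2\<close> of the mean number of edges, the denominator
  of the typical probability.\<close>

lemma limit_function_1: "limit_function 1 = 1"
proof -
  have "limit_function 1 = (\<integral>\<^sup>+u. ennreal (2 * u) * indicator {0..1} u \<partial>lborel)"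
    by (simp add: limit_function_def ratio_def)
  also have "\<dots> = ennreal (1\<^sup>2 - 0\<^sup>2)"
    by (rule nn_integral_FTC_Icc) (auto intro!: derivative_eq_intros)
  finally show ?thesis by simp
qed

lemma limit_function_le_1:
  assumes "z \<le> 1" shows "limit_function z \<le> 1"
proof -
  have "limit_function z \<le> (\<integral>\<^sup>+u. ennreal (2 * (u * ratio (2 * (1 - 1) * (1 - u)) u)) * indicator {0..1} u \<partial>lborel)"
    unfolding limit_function_def
  proof (rule nn_integral_mono)
    fix u :: real
    have "u * ratio (2 * (1 - z) * (1 - u)) u \<le> u" if "0 \<le> u" "u \<le> 1"
      using ratio_bounds[of "2 * (1 - z) * (1 - u)" u] assms that by (simp add: mult_left_le)
    then show "ennreal (2 * (u * ratio (2 * (1 - z) * (1 - u)) u)) * indicator {0..1} u \<le>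
      ennreal (2 * (u * ratio (2 * (1 - 1) * (1 - u)) u)) * indicator {0..1} u"
      by (auto simp: indicator_def ratio_def intro!: ennreal_leI)
  qed
  then show ?thesis using limit_function_1 by (simp add: limit_function_def)
qed

definition limit_coeff :: "nat \<Rightarrow> real"
  where "limit_coeff n = 2 ^ (n + 1) * integral {0..1} (\<lambda>u::real. u\<^sup>2 * ((1 - u) ^ n / (2 - u) ^ (n + 1)))"

text \<open>The bound 2 is crude: the integrand is 2 times \<open>u\<^sup>2 / (2 - u)\<close> times
  the \<open>n\<close>-th power of \<open>2 * (1 - u) / (2 - u)\<close>, and both quotients are at
  most one. It only has to be uniform in \<open>n\<close>, for the passage to coefficients.\<close>

lemma nn_integral_limit_coeff:
  "(\<integral>\<^sup>+u. ennreal (2 ^ (n + 1) * (u\<^sup>2 * ((1 - u) ^ n / (2 - u) ^ (n + 1)))) * indicator {0..1} u \<partial>lborel) = ennreal (limit_coeff n)"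
    and limit_coeff_bounds: "0 \<le> limit_coeff n" "limit_coeff n \<le> 2"
proof -
  define f where "f u = u\<^sup>2 * ((1 - u) ^ n / (2 - u) ^ (n + 1))" for u :: real
  have cont: "continuous_on {0..1} f" unfolding f_def by (auto intro!: continuous_intros)
  have f0: "0 \<le> f u" if "u \<in> {0..1}" for u using that by (auto simp: f_def)
  have int: "set_integrable lborel {0..1} f"
    by (rule borel_integrable_compact[OF compact_Icc cont, unfolded set_integrable_def[symmetric]])
  have eq: "(LINT u:{0..1}|lborel. f u) = integral {0..1} f"
    by (rule set_borel_integral_eq_integral(2)[OF int])
  have L: "limit_coeff n = 2 ^ (n + 1) * integral {0..1} f" by (simp add: limit_coeff_def f_def[abs_def])
  have "(\<integral>\<^sup>+u. ennreal (2 ^ (n + 1) * f u) * indicator {0..1} u \<partial>lborel) = (\<integral>\<^sup>+u. ennreal (2 ^ (n + 1) * (indicator {0..1} u *\<^sub>R f u)) \<partial>lborel)"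
    by (rule nn_integral_cong) (auto simp: indicator_def)
  also have "\<dots> = ennreal (\<integral>u. 2 ^ (n + 1) * (indicator {0..1} u *\<^sub>R f u) \<partial>lborel)"
    by (rule nn_integral_eq_integral) (use int f0 in \<open>auto simp: set_integrable_def indicator_def intro!: AE_I2\<close>)
  also have "\<dots> = ennreal (limit_coeff n)"
    unfolding L eq[symmetric] set_lebesgue_integral_def by simp
  finally show nn: "(\<integral>\<^sup>+u. ennreal (2 ^ (n + 1) * (u\<^sup>2 * ((1 - u) ^ n / (2 - u) ^ (n + 1)))) * indicator {0..1} u \<partial>lborel) = ennreal (limit_coeff n)"
    unfolding f_def .
  have "0 \<le> integral {0..1} f"
    by (rule integral_nonneg) (use f0 cont in \<open>auto intro: integrable_continuous_real\<close>)
  then show "0 \<le> limit_coeff n" by (simp add: L)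
  have "ennreal (limit_coeff n) \<le> (\<integral>\<^sup>+u. 2 * indicator {0..1::real} u \<partial>lborel)"
    unfolding nn[symmetric]
  proof (rule nn_integral_mono)
    fix u :: real
    have "2 ^ (n + 1) * (u\<^sup>2 * ((1 - u) ^ n / (2 - u) ^ (n + 1))) \<le> 2" if u: "0 \<le> u" "u \<le> 1"
    proof -
      have "2 ^ (n + 1) * (u\<^sup>2 * ((1 - u) ^ n / (2 - u) ^ (n + 1))) = 2 * (u\<^sup>2 / (2 - u)) * (2 * (1 - u) / (2 - u)) ^ n"
        unfolding power_divide power_mult_distrib by (simp add: ac_simps)
      also have "\<dots> \<le> 2 * 1 * 1"
      proof (intro mult_mono power_le_one)
        have "u\<^sup>2 \<le> 1" using u by (simp add: power_le_one)
        then show "u\<^sup>2 / (2 - u) \<le> 1" using u by simp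
      qed (use u in auto)
      finally show ?thesis by simp
    qed
    then show "ennreal (2 ^ (n + 1) * (u\<^sup>2 * ((1 - u) ^ n / (2 - u) ^ (n + 1)))) * indicator {0..1} u \<le> 2 * indicator {0..1} u"
      by (auto simp: indicator_def ennreal_le_iff[of 2, simplified] simp flip: ennreal_numeral intro!: ennreal_leI)
  qed
  also have "\<dots> = ennreal 2" by (subst nn_integral_cmult) auto
  finally show "limit_coeff n \<le> 2" by (subst (asm) ennreal_le_iff) auto
qed

text \<open>A geometric series in \<open>x = 2 * z * (1 - u) / (2 - u)\<close> is summed under the
  integral; \<open>(2 - u) * (1 - x)\<close> is exactly the denominator in
  \<open>ratio\<close>.\<close>

lemma limit_function_series:
  assumes z: "0 < z" "z < 1"
  shows "limit_function z = (\<Sum>n. ennreal (limit_coeff n * z ^ n))"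
proof -
  have "(\<Sum>n. ennreal (limit_coeff n * z ^ n)) = (\<Sum>n. ennreal (limit_coeff n) * ennreal (z ^ n))"
    using z by (simp add: ennreal_mult'')
  also have "\<dots> = (\<Sum>n. \<integral>\<^sup>+u. ennreal (2 ^ (n + 1) * (u\<^sup>2 * ((1 - u) ^ n / (2 - u) ^ (n + 1)))) * indicator {0..1} u * ennreal (z ^ n) \<partial>lborel)"
    unfolding nn_integral_limit_coeff[symmetric] by (subst nn_integral_multc) auto
  also have "\<dots> = (\<integral>\<^sup>+u. (\<Sum>n. ennreal (2 ^ (n + 1) * (u\<^sup>2 * ((1 - u) ^ n / (2 - u) ^ (n + 1)))) * indicator {0..1} u * ennreal (z ^ n)) \<partial>lborel)"
    by (rule nn_integral_suminf[symmetric]) measurable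
  also have "\<dots> = limit_function z"
    unfolding limit_function_def
  proof (rule nn_integral_cong)
    fix u :: real
    show "(\<Sum>n. ennreal (2 ^ (n + 1) * (u\<^sup>2 * ((1 - u) ^ n / (2 - u) ^ (n + 1)))) * indicator {0..1} u * ennreal (z ^ n)) =
      ennreal (2 * (u * ratio (2 * (1 - z) * (1 - u)) u)) * indicator {0..1} u"
    proof (cases "u \<in> {0..1}")
      case True
      then have u: "0 \<le> u" "u \<le> 1" by auto
      define x where "x = 2 * z * (1 - u) / (2 - u)"
      have "2 * (1 - u) / (2 - u) \<le> 1" using u by simp
      then have "z * (2 * (1 - u) / (2 - u)) \<le> z * 1" using z by (intro mult_left_mono) auto
      moreover have "x = z * (2 * (1 - u) / (2 - u))" by (simp add: x_def)
      ultimately have "x \<le> z" by simp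
      then have x: "0 \<le> x" "x < 1" using z u by (simp add: x_def, linarith)
      have summand: "2 ^ (n + 1) * (u\<^sup>2 * ((1 - u) ^ n / (2 - u) ^ (n + 1))) * z ^ n = 2 * u\<^sup>2 / (2 - u) * x ^ n" for n
        unfolding x_def power_divide power_mult_distrib by (simp add: ac_simps)
      have "(\<lambda>n. 2 * u\<^sup>2 / (2 - u) * x ^ n) sums (2 * u\<^sup>2 / (2 - u) * (1 / (1 - x)))"
        by (intro sums_mult geometric_sums) (use x in auto)
      moreover have "2 * u\<^sup>2 / (2 - u) * (1 / (1 - x)) = 2 * (u * ratio (2 * (1 - z) * (1 - u)) u)"
      proof -
        have p: "0 < u + 2 * (1 - z) * (1 - u)"
          using u z by (cases "u = 0") (auto intro: add_pos_nonneg)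
        have "(2 - u) * (1 - x) = u + 2 * (1 - z) * (1 - u)" using u by (simp add: x_def field_simps)
        then have "2 * u\<^sup>2 / (2 - u) * (1 / (1 - x)) = 2 * (u * (u / (u + 2 * (1 - z) * (1 - u))))"
          by (simp add: power2_eq_square)
        \<comment> \<open>At \<open>u = 1\<close> the parameter of \<open>ratio\<close> is zero, and
          the value 1 prescribed there agrees with the quotient.\<close>
        moreover have "ratio (2 * (1 - z) * (1 - u)) u = u / (u + 2 * (1 - z) * (1 - u))"
          using z by (auto simp: ratio_def)
        ultimately show ?thesis by simp
      qed
      ultimately have s: "(\<lambda>n. 2 * u\<^sup>2 / (2 - u) * x ^ n) sums (2 * (u * ratio (2 * (1 - z) * (1 - u)) u))" by simp
      have "(\<Sum>n. ennreal (2 ^ (n + 1) * (u\<^sup>2 * ((1 - u) ^ n / (2 - u) ^ (n + 1)))) * indicator {0..1} u * ennreal (z ^ n)) =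
        (\<Sum>n. ennreal (2 * u\<^sup>2 / (2 - u) * x ^ n))"
      proof (intro arg_cong[where f=suminf] ext)
        fix n
        have "ennreal (2 ^ (n + 1) * (u\<^sup>2 * ((1 - u) ^ n / (2 - u) ^ (n + 1)))) * ennreal (z ^ n) =
          ennreal (2 ^ (n + 1) * (u\<^sup>2 * ((1 - u) ^ n / (2 - u) ^ (n + 1))) * z ^ n)"
          by (rule ennreal_mult''[symmetric]) (use z in simp)
        with True show "ennreal (2 ^ (n + 1) * (u\<^sup>2 * ((1 - u) ^ n / (2 - u) ^ (n + 1)))) * indicator {0..1} u * ennreal (z ^ n) =
          ennreal (2 * u\<^sup>2 / (2 - u) * x ^ n)"
          unfolding summand by simp
      qed
      also have "\<dots> = ennreal (2 * (u * ratio (2 * (1 - z) * (1 - u)) u))"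
        by (rule suminf_ennreal_eq[OF _ s]) (use u x in auto)
      finally show ?thesis using True by simp
    qed simp
  qed
  finally show ?thesis ..
qed

section \<open>Power series with uniformly bounded coefficients\<close>

lemma bounded_power_series:
  fixes a :: "nat \<Rightarrow> real"
  assumes a: "\<And>n. 0 \<le> a n \<and> a n \<le> 2" and z: "0 < z" "z < 1"
  shows "summable (\<lambda>n. a n * z ^ n)"
    and "(\<Sum>n. a (Suc n) * z ^ n) = ((\<Sum>n. a n * z ^ n) - a 0) / z"
    and "\<bar>(\<Sum>n. a n * z ^ n) - a 0\<bar> \<le> 2 * z / (1 - z)"
proof -
  have g: "(\<lambda>n. 2 * z ^ n) sums (2 * (1 / (1 - z)))" by (intro sums_mult geometric_sums) (use z in auto)
  have summ: "summable (\<lambda>n. b n * z ^ n)" if b: "\<And>n. 0 \<le> b n \<and> b n \<le> 2" for b :: "nat \<Rightarrow> real"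
  proof (rule summable_comparison_test'[OF sums_summable[OF g], of 0])
    show "norm (b n * z ^ n) \<le> 2 * z ^ n" for n using b[of n] z by (simp add: abs_mult mult_right_mono)
  qed
  show s: "summable (\<lambda>n. a n * z ^ n)" by (rule summ[OF a])
  have s': "summable (\<lambda>n. a (Suc n) * z ^ n)" by (rule summ[of "\<lambda>n. a (Suc n)", OF a])
  have "(\<Sum>n. a n * z ^ n) - a 0 = (\<Sum>n. a (Suc n) * z ^ Suc n)" using suminf_split_head[OF s] by simp
  also have "\<dots> = (\<Sum>n. z * (a (Suc n) * z ^ n))" by (simp add: ac_simps)
  also have "\<dots> = z * (\<Sum>n. a (Suc n) * z ^ n)" by (rule suminf_mult[OF s'])
  finally have eq: "(\<Sum>n. a n * z ^ n) - a 0 = z * (\<Sum>n. a (Suc n) * z ^ n)" .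
  then show "(\<Sum>n. a (Suc n) * z ^ n) = ((\<Sum>n. a n * z ^ n) - a 0) / z" using z by simp
  have "0 \<le> (\<Sum>n. a (Suc n) * z ^ n)" by (rule suminf_nonneg[OF s']) (use a z in auto)
  moreover have "(\<Sum>n. a (Suc n) * z ^ n) \<le> (\<Sum>n. 2 * z ^ n)"
    by (rule suminf_le[OF _ s' sums_summable[OF g]]) (use a z in \<open>auto intro: mult_right_mono\<close>)
  ultimately have "\<bar>z * (\<Sum>n. a (Suc n) * z ^ n)\<bar> \<le> z * (2 * (1 / (1 - z)))"
    using z sums_unique[OF g] by (simp add: abs_mult mult_left_mono)
  then show "\<bar>(\<Sum>n. a n * z ^ n) - a 0\<bar> \<le> 2 * z / (1 - z)" unfolding eq by (simp add: mult.commute)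
qed

text \<open>At small \<open>z\<close> a power series with bounded coefficients is uniformly close to
  its constant term, so convergence at one such \<open>z\<close> controls the constant
  terms.\<close>

lemma constant_coeff_tendsto:
  fixes p :: "real \<Rightarrow> nat \<Rightarrow> real" and c :: "nat \<Rightarrow> real"
  assumes p: "\<And>t n. 0 \<le> p t n \<and> p t n \<le> 2" and c: "\<And>n. 0 \<le> c n \<and> c n \<le> 2"
    and lim: "\<And>z. 0 < z \<Longrightarrow> z < 1 \<Longrightarrow> ((\<lambda>t. \<Sum>n. p t n * z ^ n) \<longlongrightarrow> (\<Sum>n. c n * z ^ n)) F"
  shows "((\<lambda>t. p t 0) \<longlongrightarrow> c 0) F"
proof (rule tendstoI)
  fix e :: real assume e: "0 < e"
  \<comment> \<open>Then the tail is at most \<open>2 * z / (1 - z) \<le> 4 * z \<le> e / 4\<close>,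
    and three errors of \<open>e / 4\<close> stay below \<open>e\<close>.\<close>
  define z where "z = min (1/2) (e / 16)"
  have z: "0 < z" "z < 1" "z \<le> 1/2" "z \<le> e / 16" using e by (auto simp: z_def)
  have "4 * z * z \<le> 2 * z" using z mult_left_mono[of z "1/2" "4 * z"] by simp
  then have "2 * z / (1 - z) \<le> 4 * z" using z by (simp add: field_simps)
  then have b: "2 * z / (1 - z) \<le> e / 4" using z by linarith
  from tendstoD[OF lim[OF z(1,2)], of "e / 4"] e
  have "eventually (\<lambda>t. dist (\<Sum>n. p t n * z ^ n) (\<Sum>n. c n * z ^ n) < e / 4) F" by simp
  then show "eventually (\<lambda>t. dist (p t 0) (c 0) < e) F"
  proof eventually_elim
    case (elim t)
    have "\<bar>(\<Sum>n. p t n * z ^ n) - p t 0\<bar> \<le> e / 4" "\<bar>(\<Sum>n. c n * z ^ n) - c 0\<bar> \<le> e / 4"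
      using bounded_power_series(3)[of "p t", OF p z(1,2)] bounded_power_series(3)[of c, OF c z(1,2)] b by linarith+
    then show ?case using elim e unfolding dist_real_def by linarith
  qed
qed

text \<open>Shifting the coefficients reduces every coefficient to the constant one.\<close>

lemma coeff_tendsto:
  fixes p :: "real \<Rightarrow> nat \<Rightarrow> real" and c :: "nat \<Rightarrow> real"
  assumes "\<And>t n. 0 \<le> p t n \<and> p t n \<le> 2" "\<And>n. 0 \<le> c n \<and> c n \<le> 2"
    and "\<And>z. 0 < z \<Longrightarrow> z < 1 \<Longrightarrow> ((\<lambda>t. \<Sum>n. p t n * z ^ n) \<longlongrightarrow> (\<Sum>n. c n * z ^ n)) F"
  shows "((\<lambda>t. p t n) \<longlongrightarrow> c n) F"
  using assms
proof (induction n arbitrary: p c)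
  case (0 p c)
  then show ?case by (rule constant_coeff_tendsto)
next
  case (Suc n p c)
  show ?case
  proof (rule Suc.IH[of "\<lambda>t n. p t (Suc n)" "\<lambda>n. c (Suc n)"])
    fix z :: real assume z: "0 < z" "z < 1"
    have "((\<lambda>t. ((\<Sum>n. p t n * z ^ n) - p t 0) / z) \<longlongrightarrow> ((\<Sum>n. c n * z ^ n) - c 0) / z) F"
      by (intro tendsto_intros Suc.prems(3)[OF z] constant_coeff_tendsto[OF Suc.prems]) (use z in auto)
    then show "((\<lambda>t. \<Sum>n. p t (Suc n) * z ^ n) \<longlongrightarrow> (\<Sum>n. c (Suc n) * z ^ n)) F"
      using bounded_power_series(2)[of "p t" for t, OF Suc.prems(1) z] bounded_power_series(2)[of c, OF Suc.prems(2) z] by simp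
  qed (use Suc.prems in auto)
qed

section \<open>Passage to the limit\<close>

context splitting_process
begin

text \<open>The pointwise errors 1 and 3 of \<open>edge_count_average_bounds\<close> are doubled by
  the factor in \<open>rest_function\<close> and integrated over \<open>{0..t}\<close>.\<close>

lemma rest_function_bounds:
  assumes z: "0 \<le> z" "z \<le> 1" and t: "0 < t"
  shows "rest_function t z \<le> ennreal (t\<^sup>2) * limit_function z + ennreal (2 * t)"
    "ennreal (t\<^sup>2) * limit_function z \<le> rest_function t z + ennreal (6 * t)"
proof -
  define B where "B s = (\<integral>\<^sup>+T. ennreal (exp (- T)) * ennreal (edge_count (2 * (1 - z) * (t - s)) (s - T) 1) * indicator {0..s} T \<partial>lborel)" for s
  define h where "h s = s * ratio (2 * (1 - z) * (t - s)) s" for s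
  have b: "B s \<le> ennreal (h s) + 1" "ennreal (h s) \<le> B s + 3" if "0 \<le> s" "s \<le> t" for s
    using edge_count_average_bounds[of "2 * (1 - z) * (t - s)" s] z that by (simp_all add: B_def h_def)
  have h0: "0 \<le> h s" if "0 \<le> s" "s \<le> t" for s
    using ratio_bounds[of "2 * (1 - z) * (t - s)" s] z that by (simp add: h_def)
  have [measurable]: "h \<in> borel_measurable borel" unfolding h_def by measurable
  have [measurable]: "B \<in> borel_measurable borel"
  proof -
    have "(\<lambda>s. \<integral>\<^sup>+T. ennreal (exp (- snd (s, T))) * ennreal (edge_count (2 * (1 - z) * (t - fst (s, T))) (fst (s, T) - snd (s, T)) 1) *
      (if 0 \<le> snd (s, T) \<and> snd (s, T) \<le> fst (s, T) then 1 else 0) \<partial>lborel) \<in> borel_measurable borel"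
      unfolding edge_count_def ratio_def by measurable
    also have "(\<lambda>s. \<integral>\<^sup>+T. ennreal (exp (- snd (s, T))) * ennreal (edge_count (2 * (1 - z) * (t - fst (s, T))) (fst (s, T) - snd (s, T)) 1) *
      (if 0 \<le> snd (s, T) \<and> snd (s, T) \<le> fst (s, T) then 1 else 0) \<partial>lborel) = B"
      unfolding B_def by (intro ext nn_integral_cong) (auto simp: indicator_def)
    finally show ?thesis .
  qed
  have I: "(\<integral>\<^sup>+s. ennreal (2 * h s) * indicator {0..t} s \<partial>lborel) = ennreal (t\<^sup>2) * limit_function z"
    unfolding h_def by (rule limit_function_scaled[OF t])
  have c: "(\<integral>\<^sup>+s. ennreal a * indicator {0..t} s \<partial>lborel) = ennreal (a * t)" if "0 \<le> a" for a
    using t that by (subst nn_integral_cmult) (auto simp: ennreal_mult[symmetric])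
  have R: "rest_function t z = (\<integral>\<^sup>+s. indicator {0..t} s * (2 * B s) \<partial>lborel)"
    by (simp add: rest_function_def B_def)
  have "rest_function t z \<le> (\<integral>\<^sup>+s. ennreal (2 * h s) * indicator {0..t} s + ennreal 2 * indicator {0..t} s \<partial>lborel)"
    unfolding R
  proof (rule nn_integral_mono)
    fix s
    show "indicator {0..t} s * (2 * B s) \<le> ennreal (2 * h s) * indicator {0..t} s + ennreal 2 * indicator {0..t} s"
    proof (cases "s \<in> {0..t}")
      case True
      have "2 * B s \<le> 2 * (ennreal (h s) + 1)" using b(1)[of s] True by (intro mult_left_mono) auto
      also have "\<dots> = ennreal (2 * h s) + 2" using h0[of s] True by (simp add: distrib_left ennreal_mult)
      finally show ?thesis using True by simp
    qed simp
  qed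
  also have "\<dots> = ennreal (t\<^sup>2) * limit_function z + ennreal (2 * t)"
    unfolding I[symmetric] c[of 2, simplified, symmetric] by (subst nn_integral_add) auto
  finally show "rest_function t z \<le> ennreal (t\<^sup>2) * limit_function z + ennreal (2 * t)" .
  have "ennreal (t\<^sup>2) * limit_function z \<le> (\<integral>\<^sup>+s. indicator {0..t} s * (2 * B s) + ennreal 6 * indicator {0..t} s \<partial>lborel)"
    unfolding I[symmetric]
  proof (rule nn_integral_mono)
    fix s
    show "ennreal (2 * h s) * indicator {0..t} s \<le> indicator {0..t} s * (2 * B s) + ennreal 6 * indicator {0..t} s"
    proof (cases "s \<in> {0..t}")
      case True
      have "ennreal (2 * h s) = 2 * ennreal (h s)" using h0[of s] True by (simp add: ennreal_mult)
      also have "\<dots> \<le> 2 * (B s + 3)" using b(2)[of s] True by (intro mult_left_mono) auto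
      also have "\<dots> = 2 * B s + 6" by (simp add: distrib_left)
      finally show ?thesis using True by simp
    qed simp
  qed
  also have "\<dots> = rest_function t z + ennreal (6 * t)"
    unfolding R c[of 6, simplified, symmetric] by (subst nn_integral_add) auto
  finally show "ennreal (t\<^sup>2) * limit_function z \<le> rest_function t z + ennreal (6 * t)" .
qed

text \<open>All errors are at most linear in \<open>t\<close>, while the main term is
  quadratic.\<close>

lemma generating_function_asymptotics:
  assumes z: "0 \<le> z" "z \<le> 1"
  shows "((\<lambda>t. enn2real (generating_function t z) / t\<^sup>2) \<longlongrightarrow> enn2real (limit_function z)) at_top"
    and "0 < t \<Longrightarrow> generating_function t z < \<top>"
proof -
  define L where "L = enn2real (limit_function z)"
  have L: "limit_function z = ennreal L" "0 \<le> L"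
    using le_less_trans[OF limit_function_le_1[OF z(2)] ennreal_one_less_top] unfolding L_def
    by (simp_all add: ennreal_enn2real enn2real_nonneg)
  have bnd: "generating_function t z \<le> ennreal (t\<^sup>2 * L + 2 * t + 1)" "ennreal (t\<^sup>2 * L) \<le> generating_function t z + ennreal (6 * t)"
    if t: "0 < t" for t
  proof -
    have "generating_function t z \<le> 1 + (ennreal (t\<^sup>2) * ennreal L + ennreal (2 * t))"
      using generating_function_bounds(2)[OF z, of t] rest_function_bounds(1)[OF z t]
      by (auto simp: L intro: order_trans add_left_mono)
    also have "\<dots> = ennreal (t\<^sup>2 * L + 2 * t + 1)" using t L(2) by (simp add: ennreal_mult ennreal_plus add.commute)
    finally show "generating_function t z \<le> ennreal (t\<^sup>2 * L + 2 * t + 1)" .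
    have "ennreal (t\<^sup>2) * ennreal L \<le> generating_function t z + ennreal (6 * t)"
      using generating_function_bounds(1)[OF z, of t] rest_function_bounds(2)[OF z t]
      by (auto simp: L intro: order_trans add_right_mono)
    then show "ennreal (t\<^sup>2 * L) \<le> generating_function t z + ennreal (6 * t)" using L(2) by (simp add: ennreal_mult)
  qed
  show fin: "generating_function t z < \<top>" if "0 < t" for t
    using bnd(1)[OF that] by (rule le_less_trans) simp
  have real: "enn2real (generating_function t z) \<le> t\<^sup>2 * L + 2 * t + 1" "t\<^sup>2 * L - 6 * t \<le> enn2real (generating_function t z)"
    if t: "0 < t" for t
  proof -
    obtain G where G: "generating_function t z = ennreal G" "0 \<le> G" using fin[OF t] by (cases "generating_function t z") auto
    have "G \<le> t\<^sup>2 * L + 2 * t + 1"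
      using bnd(1)[OF t, unfolded G(1)] by (subst (asm) ennreal_le_iff) (use t L(2) in auto)
    then show "enn2real (generating_function t z) \<le> t\<^sup>2 * L + 2 * t + 1" using G by simp
    have "ennreal (t\<^sup>2 * L) \<le> ennreal (G + 6 * t)" using bnd(2)[OF t] G t by simp
    then have "t\<^sup>2 * L \<le> G + 6 * t" by (subst (asm) ennreal_le_iff) (use t G(2) in auto)
    then show "t\<^sup>2 * L - 6 * t \<le> enn2real (generating_function t z)" using G by simp
  qed
  have inv: "((\<lambda>t::real. a / t) \<longlongrightarrow> 0) at_top" for a by (rule tendsto_divide_0[OF tendsto_const]) (rule filterlim_at_top_imp_at_infinity[OF filterlim_ident])
  show "((\<lambda>t. enn2real (generating_function t z) / t\<^sup>2) \<longlongrightarrow> enn2real (limit_function z)) at_top"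
  proof (rule tendsto_sandwich)
    show "eventually (\<lambda>t. L - 6 / t \<le> enn2real (generating_function t z) / t\<^sup>2) at_top"
      using eventually_gt_at_top[of 0]
    proof eventually_elim
      case (elim t)
      have "L - 6 / t = (t\<^sup>2 * L - 6 * t) / t\<^sup>2" using elim by (simp add: field_simps power2_eq_square)
      also have "\<dots> \<le> enn2real (generating_function t z) / t\<^sup>2" using real(2)[OF elim] by (rule divide_right_mono) simp
      finally show ?case .
    qed
    show "eventually (\<lambda>t. enn2real (generating_function t z) / t\<^sup>2 \<le> L + 2 / t + 1 / t * (1 / t)) at_top"
      using eventually_gt_at_top[of 0]
    proof eventually_elim
      case (elim t)
      have "enn2real (generating_function t z) / t\<^sup>2 \<le> (t\<^sup>2 * L + 2 * t + 1) / t\<^sup>2" using real(1)[OF elim] by (rule divide_right_mono) simp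
      also have "\<dots> = L + 2 / t + 1 / t * (1 / t)" using elim by (simp add: field_simps power2_eq_square)
      finally show ?case .
    qed
    have "((\<lambda>t. L - 6 / t) \<longlongrightarrow> L - 0) at_top" by (intro tendsto_intros inv)
    then show "((\<lambda>t. L - 6 / t) \<longlongrightarrow> enn2real (limit_function z)) at_top" by (simp add: L_def)
    have "((\<lambda>t. L + 2 / t + 1 / t * (1 / t)) \<longlongrightarrow> L + 0 + 0 * 0) at_top" by (intro tendsto_intros inv)
    then show "((\<lambda>t. L + 2 / t + 1 / t * (1 / t)) \<longlongrightarrow> enn2real (limit_function z)) at_top" by (simp add: L_def)
  qed
qed

lemma typical_incidence_prob_tendsto:
  "((\<lambda>t. typical_incidence_prob \<Omega> \<tau> N t n) \<longlongrightarrow> limit_coeff n) at_top"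
proof -
  define g where "g t z = enn2real (generating_function t z)" for t z
  \<comment> \<open>Zero at nonpositive times, because \<open>coeff_tendsto\<close> asks for the
    bounds at every \<open>t\<close>.\<close>
  define p where "p t n = (if 0 < t then typical_incidence_prob \<Omega> \<tau> N t n else 0)" for t n
  have W: "incidence_weight t n \<le> generating_function t 1" for t n
  proof -
    have "incidence_weight t n = (\<Sum>n\<in>{n}. incidence_weight t n * ennreal 1 ^ n)" by simp
    also have "\<dots> \<le> (\<Sum>n. incidence_weight t n * ennreal 1 ^ n)" by (rule sum_le_suminf) auto
    finally show ?thesis by (simp only: suminf_incidence_weight)
  qed
  have pt: "p t n = enn2real (incidence_weight t n) / g t 1" if "0 < t" for t n
    using that by (simp add: p_def g_def typical_incidence_prob_eq)
  have p01: "0 \<le> p t n \<and> p t n \<le> 1" for t n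
  proof (cases "0 < t")
    case True
    have "enn2real (incidence_weight t n) \<le> g t 1"
      unfolding g_def by (rule enn2real_mono[OF W]) (rule generating_function_asymptotics(2)[OF _ _ True], auto)
    moreover have "0 \<le> g t 1" by (simp add: g_def enn2real_nonneg)
    ultimately show ?thesis using True by (cases "g t 1 = 0") (simp_all add: pt enn2real_nonneg)
  qed (simp add: p_def)
  have series: "(\<Sum>n. p t n * z ^ n) = g t z / g t 1" if t: "0 < t" and z: "0 < z" "z < 1" for t z
  proof -
    have fin: "incidence_weight t n < \<top>" for n
      using W[of t n] generating_function_asymptotics(2)[of 1 t] t by (auto intro: le_less_trans)
    have "(\<Sum>n. ennreal (enn2real (incidence_weight t n) * z ^ n)) = (\<Sum>n. incidence_weight t n * ennreal z ^ n)"
      using z fin by (simp add: ennreal_mult'' ennreal_power)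
    also have "\<dots> = generating_function t z" by (rule suminf_incidence_weight)
    finally have s: "(\<Sum>n. ennreal (enn2real (incidence_weight t n) * z ^ n)) = generating_function t z" .
    have fz: "generating_function t z < \<top>" using generating_function_asymptotics(2)[of z t] t z by simp
    have summ: "summable (\<lambda>n. enn2real (incidence_weight t n) * z ^ n)"
      by (rule summable_suminf_not_top) (use z s fz in \<open>auto simp: enn2real_nonneg\<close>)
    have "ennreal (\<Sum>n. enn2real (incidence_weight t n) * z ^ n) = generating_function t z"
      unfolding s[symmetric] by (rule suminf_ennreal2[symmetric]) (use z summ in \<open>auto simp: enn2real_nonneg\<close>)
    moreover have "0 \<le> (\<Sum>n. enn2real (incidence_weight t n) * z ^ n)"
      by (rule suminf_nonneg[OF summ]) (use z in \<open>auto simp: enn2real_nonneg\<close>)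
    ultimately have "(\<Sum>n. enn2real (incidence_weight t n) * z ^ n) = g t z"
      unfolding g_def by (metis enn2real_ennreal)
    then have "(\<lambda>n. enn2real (incidence_weight t n) * z ^ n) sums g t z" using summ by (simp add: sums_iff)
    from sums_unique[OF sums_divide[OF this, of "g t 1"]] show ?thesis using t by (simp add: pt)
  qed
  have "((\<lambda>t. p t n) \<longlongrightarrow> limit_coeff n) at_top"
  proof (rule coeff_tendsto)
    show "0 \<le> p t n \<and> p t n \<le> 2" for t n using p01[of t n] by linarith
    show "0 \<le> limit_coeff n \<and> limit_coeff n \<le> 2" for n using limit_coeff_bounds by blast
    fix z :: real assume z: "0 < z" "z < 1"
    have L: "(\<Sum>n. limit_coeff n * z ^ n) = enn2real (limit_function z)"
    proof -
      have summ: "summable (\<lambda>n. limit_coeff n * z ^ n)"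
        by (rule bounded_power_series(1)) (use z limit_coeff_bounds in auto)
      have "limit_function z = ennreal (\<Sum>n. limit_coeff n * z ^ n)"
        unfolding limit_function_series[OF z] by (rule suminf_ennreal2) (use summ z limit_coeff_bounds in auto)
      moreover have "0 \<le> (\<Sum>n. limit_coeff n * z ^ n)"
        by (rule suminf_nonneg[OF summ]) (use z limit_coeff_bounds in auto)
      ultimately show ?thesis by simp
    qed
    \<comment> \<open>Scaling both parts by \<open>t\<^sup>2\<close> makes each converge; the
      denominator tends to 1 by \<open>limit_function_1\<close>.\<close>
    have "((\<lambda>t. (g t z / t\<^sup>2) / (g t 1 / t\<^sup>2)) \<longlongrightarrow> enn2real (limit_function z) / enn2real (limit_function 1)) at_top"
      unfolding g_def by (intro tendsto_divide generating_function_asymptotics(1)) (use z in \<open>auto simp: limit_function_1\<close>)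
    then have "((\<lambda>t. (g t z / t\<^sup>2) / (g t 1 / t\<^sup>2)) \<longlongrightarrow> (\<Sum>n. limit_coeff n * z ^ n)) at_top"
      by (simp add: L limit_function_1)
    moreover have "eventually (\<lambda>t. (g t z / t\<^sup>2) / (g t 1 / t\<^sup>2) = (\<Sum>n. p t n * z ^ n)) at_top"
      using eventually_gt_at_top[of 0] by eventually_elim (simp add: series[OF _ z])
    ultimately show "((\<lambda>t. \<Sum>n. p t n * z ^ n) \<longlongrightarrow> (\<Sum>n. limit_coeff n * z ^ n)) at_top"
      by (rule Lim_transform_eventually)
  qed
  moreover have "eventually (\<lambda>t. p t n = typical_incidence_prob \<Omega> \<tau> N t n) at_top"
    using eventually_gt_at_top[of 0] by eventually_elim (simp add: p_def)
  ultimately show ?thesis by (rule Lim_transform_eventually)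
qed

end

theorem corollary8p4:
  fixes \<kappa> :: "(real^3) set measure"
    and \<Omega> :: "'a measure"
    and \<tau> :: "bool list \<Rightarrow> 'a \<Rightarrow> real"
    and N :: "bool list \<Rightarrow> 'a \<Rightarrow> real^3"
    and n :: nat
  assumes "splitting_process \<kappa> \<Omega> \<tau> N"
  shows "((\<lambda>t. typical_incidence_prob \<Omega> \<tau> N t n) \<longlongrightarrow>
           2 ^ (n + 1) * integral {0..1} (\<lambda>u::real. u\<^sup>2 * ((1 - u) ^ n / (2 - u) ^ (n + 1)))) at_top"
  using splitting_process.typical_incidence_prob_tendsto[OF assms] unfolding limit_coeff_def .

end
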